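(* Let $G=GL(m|n)$, let $R=K[G]^G=\{f\in K[G]\mid \nu_l(f)=f\otimes 1\}$ be the superalgebra of (co)adjoint invariants, and let $\phi:K[G]\to A=K[x_1^{\pm1},\dots,x_m^{\pm1},y_1^{\pm1},\dots,y_n^{\pm1}]$ be the superalgebra epimorphism with $\phi(c_{ij})=\delta_{ij}x_i$ if $i\le m$ and $\phi(c_{ij})=\delta_{ij}y_{i-m}$ if $i>m$. Then the restriction of $\phi$ to $R$ is a monomorphism.
   Context: $K$ is an algebraically closed field, $m,n\ge1$. Superspaces are $\mathbb Z/2$-graded, $|f|$ denotes parity; in a commutative superalgebra $ab=(-1)^{|a||b|}ba$ and odd elements square to zero. $G=GL(m|n)$ is the supergroup with coordinate Hopf superalgebra $K[G]=K[c_{ij}\mid 1\le i,j\le m+n]_{d_1,d_2}$, where $K[c_{ij}]$ is the free commutative superalgebra with $|c_{ij}|=|i|+|j|$ mod $2$, $|i|=0$ for $i\le m$ and $|i|=1$ for $i>m$, localized at $d_1=\det(c_{ij})_{1\le i,j\le m}$ and $d_2=\det(c_{ij})_{m+1\le i,j\le m+n}$; $\delta_G(c_{ij})=\sum_tc_{it}\otimes c_{tj}$, the counit sends $c_{ij}$ to $\delta_{ij}$, and $s_G$ is the antipode. The coadjoint coaction is $\nu_l(f)=\sum(-1)^{|f_1||f_2|}f_2\otimes s_G(f_1)f_3$ (Sweedler notation $\sum f_1\otimes f_2\otimes f_3$ for the iterated comultiplication of $f$). $A$ is the ordinary commutative Laurent polynomial algebra (purely even). *)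

theory Defs
  imports
    "HOL-Computational_Algebra.Polynomial"
    "HOL-Library.Poly_Mapping"
    "HOL-Library.Z2"
    "HOL-Combinatorics.Permutations"
begin

section \<open>Superalgebra homomorphisms\<close>

text \<open>
  Parities are elements of \<^typ>\<open>bit\<close>.  A superspace is given by its scalar multiplication and by the
  projections \<open>part p\<close> onto the homogeneous component of parity \<open>p\<close>.
\<close>

definition koszul :: "bit \<Rightarrow> bit \<Rightarrow> 'a::group_add \<Rightarrow> 'a" where
  "koszul p q x = (if p * q = 1 then - x else x)"

definition even_linear ::
  "('k::comm_ring_1 \<Rightarrow> 'a::ab_group_add \<Rightarrow> 'a) \<Rightarrow> (bit \<Rightarrow> 'a \<Rightarrow> 'a) \<Rightarrow>
   ('k \<Rightarrow> 'b::ab_group_add \<Rightarrow> 'b) \<Rightarrow> (bit \<Rightarrow> 'b \<Rightarrow> 'b) \<Rightarrow> ('a \<Rightarrow> 'b) \<Rightarrow> bool" where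
  "even_linear scA partA scB partB f \<longleftrightarrow>
     module_hom scA scB f \<and> (\<forall>p x. f (partA p x) = partB p (f x))"

definition superalgebra_hom ::
  "('k::comm_ring_1 \<Rightarrow> 'a::ring_1 \<Rightarrow> 'a) \<Rightarrow> (bit \<Rightarrow> 'a \<Rightarrow> 'a) \<Rightarrow>
   ('k \<Rightarrow> 'b::ring_1 \<Rightarrow> 'b) \<Rightarrow> (bit \<Rightarrow> 'b \<Rightarrow> 'b) \<Rightarrow> ('a \<Rightarrow> 'b) \<Rightarrow> bool" where
  "superalgebra_hom scA partA scB partB f \<longleftrightarrow>
     even_linear scA partA scB partB f \<and> f 1 = 1 \<and> (\<forall>x y. f (x * y) = f x * f y)"

definition purely_even :: "bit \<Rightarrow> 'a::zero \<Rightarrow> 'a" where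
  "purely_even p x = (if p = 0 then x else 0)"

lemma koszul_add: "koszul p q (x + y) = koszul p q x + koszul p q (y::'a::ab_group_add)"
  by (simp add: koszul_def)


section \<open>The free associative algebra on the matrix coordinates\<close>

text \<open>Monomials in noncommuting variables; \<open>'x fmon \<Rightarrow>\<^sub>0 'k\<close> is the free associative \<open>'k\<close>-algebra on \<open>'x\<close>.\<close>

datatype 'x fmon = FMon (letters: "'x list")

instantiation fmon :: (type) monoid_add
begin
definition zero_fmon :: "'a fmon" where "zero_fmon = FMon []"
definition plus_fmon :: "'a fmon \<Rightarrow> 'a fmon \<Rightarrow> 'a fmon" where
  "plus_fmon u v = FMon (letters u @ letters v)"
instance by standard (auto simp: zero_fmon_def plus_fmon_def)
end

lemma letters_zero [simp]: "letters 0 = []"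
  by (simp add: zero_fmon_def)

lemma letters_plus [simp]: "letters (u + v) = letters u @ letters v"
  by (simp add: plus_fmon_def)

text \<open>
  The index set \<open>{1..m+n}\<close> is \<open>'m + 'n\<close>, where \<open>'m\<close> and \<open>'n\<close> are finite linearly ordered types with
  \<open>m\<close> and \<open>n\<close> elements; the coordinate \<open>c\<^bsub>ij\<^esub>\<close> is indexed by the pair \<open>(i, j)\<close>.
\<close>

type_synonym ('m, 'n) gen = "('m + 'n) \<times> ('m + 'n)"

definition ipar :: "'m + 'n \<Rightarrow> bit" where
  "ipar i = (case i of Inl _ \<Rightarrow> 0 | Inr _ \<Rightarrow> 1)"

definition gpar :: "('m, 'n) gen \<Rightarrow> bit" where
  "gpar x = ipar (fst x) + ipar (snd x)"

definition wpar :: "('m, 'n) gen fmon \<Rightarrow> bit" where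
  "wpar w = sum_list (map gpar (letters w))"

abbreviation rvar :: "'x \<Rightarrow> 'x fmon \<Rightarrow>\<^sub>0 'k::ring_1" where
  "rvar x \<equiv> Poly_Mapping.single (FMon [x]) 1"

lift_definition rpart :: "bit \<Rightarrow> (('m, 'n) gen fmon \<Rightarrow>\<^sub>0 'k::zero) \<Rightarrow> (('m, 'n) gen fmon \<Rightarrow>\<^sub>0 'k)"
  is "\<lambda>p f w. if wpar w = p then f w else 0"
  by (rule finite_subset) auto

lemma wpar_zero [simp]: "wpar 0 = 0"
  by (simp add: wpar_def)

lemma wpar_plus [simp]: "wpar (u + v) = wpar u + wpar v"
  by (simp add: wpar_def)

lemma bit_add_self [simp]: "(p::bit) + p = 0"
  by (cases p) auto

lemma bit_add_self2 [simp]: "(p::bit) + (p + q) = q"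
  by (cases p; cases q) auto

lemma poly_mapping_span_induct [case_names single add]:
  fixes f :: "'x \<Rightarrow>\<^sub>0 'k::ab_group_add"
  assumes s: "\<And>w c. P (Poly_Mapping.single w c)"
    and a: "\<And>f g. P f \<Longrightarrow> P g \<Longrightarrow> P (f + g)"
  shows "P f"
proof (induction f rule: update_induct)
  case const
  show ?case using s[of undefined 0] by simp
next
  case (update f w c)
  have "Poly_Mapping.update w c f = f + Poly_Mapping.single w c"
    by (rule poly_mapping_eqI)
      (use update(1) in \<open>auto simp: lookup_update lookup_add lookup_single when_def not_in_keys_iff_lookup_eq_zero\<close>)
  with a[OF update(3) s] show ?case by simp
qed

lemma rpart_single [simp]:
  "rpart p (Poly_Mapping.single w c) = (if wpar w = p then Poly_Mapping.single w c else 0)"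
  by (rule poly_mapping_eqI) (auto simp: rpart.rep_eq lookup_single when_def)

lemma rpart_add: "rpart p (f + g) = rpart p f + rpart p (g :: _ \<Rightarrow>\<^sub>0 'k::monoid_add)"
  by (rule poly_mapping_eqI) (auto simp: rpart.rep_eq lookup_add)

lemma rpart_zero [simp]: "rpart p 0 = 0"
  by (rule poly_mapping_eqI) (auto simp: rpart.rep_eq)

lemma rpart_diff: "rpart p (f - g) = rpart p f - rpart p (g :: _ \<Rightarrow>\<^sub>0 'k::ab_group_add)"
  by (rule poly_mapping_eqI) (auto simp: rpart.rep_eq lookup_minus)

lemma rpart_sum: "rpart 0 f + rpart 1 f = (f :: _ \<Rightarrow>\<^sub>0 'k::monoid_add)"
  by (rule poly_mapping_eqI) (auto simp: rpart.rep_eq lookup_add)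

lemma rpart_rpart: "rpart p (rpart q f) = (if p = q then rpart p f else 0)"
  by (rule poly_mapping_eqI) (auto simp: rpart.rep_eq)

lemma rpart_mult:
  "rpart p (f * g) = rpart 0 f * rpart p g + rpart 1 f * rpart (p + 1) (g :: _ \<Rightarrow>\<^sub>0 'k::ring_1)"
proof (induction f rule: poly_mapping_span_induct)
  case (single u c)
  show ?case
  proof (induction g rule: poly_mapping_span_induct)
    case (single v d)
    show ?case
      by (cases p; cases "wpar u"; cases "wpar v") (auto simp: mult_single)
  qed (simp add: rpart_add algebra_simps)
qed (simp add: rpart_add algebra_simps)


section \<open>The free commutative superalgebra on the matrix coordinates\<close>

text \<open>
  The square of an odd generator is a separate relation, needed in characteristic 2; squares of all
  odd elements then vanish.
\<close>

inductive_set sc_ideal :: "(('m, 'n) gen fmon \<Rightarrow>\<^sub>0 'k::field) set" where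
  comm: "rvar x * rvar y - koszul (gpar x) (gpar y) (rvar y * rvar x) \<in> sc_ideal"
| sq: "gpar x = 1 \<Longrightarrow> rvar x * rvar x \<in> sc_ideal"
| add: "f \<in> sc_ideal \<Longrightarrow> g \<in> sc_ideal \<Longrightarrow> f + g \<in> sc_ideal"
| lmult: "f \<in> sc_ideal \<Longrightarrow> h * f \<in> sc_ideal"
| rmult: "f \<in> sc_ideal \<Longrightarrow> f * h \<in> sc_ideal"

lemma sc_ideal_zero [simp]: "0 \<in> sc_ideal"
  using sc_ideal.lmult[OF sc_ideal.comm, of 0] by simp

lemma sc_ideal_uminus: "f \<in> sc_ideal \<Longrightarrow> - f \<in> sc_ideal"
  using sc_ideal.lmult[of f "-1"] by simp

lemma sc_ideal_diff: "f \<in> sc_ideal \<Longrightarrow> g \<in> sc_ideal \<Longrightarrow> f - g \<in> sc_ideal"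
  using sc_ideal.add[OF _ sc_ideal_uminus, of f g] by simp

lemma rpart_sc_ideal: "f \<in> sc_ideal \<Longrightarrow> rpart p f \<in> sc_ideal"
proof (induction arbitrary: p rule: sc_ideal.induct)
  case (comm x y)
  have "rpart p (rvar x * rvar y - koszul (gpar x) (gpar y) (rvar y * rvar x)) =
    (if gpar x + gpar y = p then rvar x * rvar y - koszul (gpar x) (gpar y) (rvar y * rvar x)
     else (0 :: ('a, 'b) gen fmon \<Rightarrow>\<^sub>0 'c))"
    by (cases "gpar x"; cases "gpar y"; cases p)
      (auto simp: koszul_def mult_single rpart_diff rpart_add wpar_def plus_fmon_def single_uminus[symmetric])
  then show ?case using sc_ideal.comm[of x y] by (auto simp only: sc_ideal_zero split: if_splits)
next
  case (sq x)
  then show ?case using sc_ideal.sq[OF sq] by (cases p) (simp_all add: mult_single)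
qed (auto simp: rpart_add rpart_mult intro: sc_ideal.intros)

quotient_type (overloaded) ('k, 'm, 'n) sfree = "('m, 'n) gen fmon \<Rightarrow>\<^sub>0 'k::field" /
  "\<lambda>f g. f - g \<in> sc_ideal"
proof (intro equivpI reflpI sympI transpI)
  show "g - f \<in> sc_ideal" if "f - g \<in> sc_ideal" for f g :: "('m, 'n) gen fmon \<Rightarrow>\<^sub>0 'k"
    using sc_ideal_uminus[OF that] by simp
  show "f - h \<in> sc_ideal" if "f - g \<in> sc_ideal" "g - h \<in> sc_ideal"
    for f g h :: "('m, 'n) gen fmon \<Rightarrow>\<^sub>0 'k"
    using sc_ideal.add[OF that] by simp
qed simp

text \<open>Evaluation at scalars; at the identity matrix it yields the counit and shows that the algebras are nonzero.\<close>

definition reval :: "('x \<Rightarrow> 'k::comm_ring_1) \<Rightarrow> ('x fmon \<Rightarrow>\<^sub>0 'k) \<Rightarrow> 'k" where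
  "reval h f = (\<Sum>w\<in>Poly_Mapping.keys f. Poly_Mapping.lookup f w * prod_list (map h (letters w)))"

lemma reval_add: "reval h (f + g) = reval h f + reval h g"
  unfolding reval_def by (rule setsum_keys_plus_distrib) (simp_all add: algebra_simps)

lemma reval_single [simp]: "reval h (Poly_Mapping.single w c) = c * prod_list (map h (letters w))"
  by (simp add: reval_def)

lemma reval_mult: "reval h (f * g) = reval h f * reval h g"
proof (induction f rule: poly_mapping_span_induct)
  case (single u c)
  show ?case
  proof (induction g rule: poly_mapping_span_induct)
    case (single v d)
    show ?case by (simp add: mult_single mult.assoc mult.left_commute)
  qed (simp add: reval_add distrib_left)
qed (simp add: reval_add distrib_right)

lemma reval_uminus: "reval h (- f) = - reval h f"
  using reval_add[of h f "- f"] by (simp add: reval_def eq_neg_iff_add_eq_0 add.commute)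

lemma reval_diff: "reval h (f - g) = reval h f - reval h g"
  using reval_add[of h f "- g"] by (simp add: reval_uminus)

abbreviation kron :: "('m, 'n) gen \<Rightarrow> 'k::comm_ring_1" where
  "kron x \<equiv> (if fst x = snd x then 1 else 0)"

lemma gpar_diag: "fst x = snd x \<Longrightarrow> gpar x = 0"
  by (simp add: gpar_def)

lemma reval_sc_ideal: "f \<in> sc_ideal \<Longrightarrow> reval kron f = 0"
proof (induction rule: sc_ideal.induct)
  case (comm x y)
  then show ?case
    by (cases "fst x = snd x"; cases "fst y = snd y")
      (auto simp: reval_diff reval_mult reval_uminus koszul_def gpar_diag)
next
  case (sq x)
  then show ?case using gpar_diag[of x] by (auto simp: reval_mult)
qed (simp_all add: reval_add reval_mult)

instantiation sfree :: (field, type, type) ring_1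
begin

lift_definition zero_sfree :: "('a, 'b, 'c) sfree" is 0 .
lift_definition one_sfree :: "('a, 'b, 'c) sfree" is 1 .
lift_definition plus_sfree :: "('a, 'b, 'c) sfree \<Rightarrow> ('a, 'b, 'c) sfree \<Rightarrow> ('a, 'b, 'c) sfree" is "(+)"
  using sc_ideal.add by (fastforce simp: algebra_simps)
lift_definition minus_sfree :: "('a, 'b, 'c) sfree \<Rightarrow> ('a, 'b, 'c) sfree \<Rightarrow> ('a, 'b, 'c) sfree" is "(-)"
  using sc_ideal_diff by (fastforce simp: algebra_simps)
lift_definition uminus_sfree :: "('a, 'b, 'c) sfree \<Rightarrow> ('a, 'b, 'c) sfree" is "uminus"
  using sc_ideal_uminus by fastforce
lift_definition times_sfree :: "('a, 'b, 'c) sfree \<Rightarrow> ('a, 'b, 'c) sfree \<Rightarrow> ('a, 'b, 'c) sfree" is "(*)"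
proof -
  fix f f' g g' :: "('b, 'c) gen fmon \<Rightarrow>\<^sub>0 'a"
  assume "f - f' \<in> sc_ideal" "g - g' \<in> sc_ideal"
  from sc_ideal.add[OF sc_ideal.rmult[OF this(1), of g] sc_ideal.lmult[OF this(2), of f']]
  show "f * g - f' * g' \<in> sc_ideal" by (simp add: algebra_simps)
qed

instance
proof
  show "(0 :: ('a, 'b, 'c) sfree) \<noteq> 1"
  proof (transfer, rule notI)
    assume "(0::('b, 'c) gen fmon \<Rightarrow>\<^sub>0 'a) - 1 \<in> sc_ideal"
    from reval_sc_ideal[OF this] show False
      by (simp add: reval_diff reval_uminus flip: single_one)
  qed
qed (transfer, simp add: algebra_simps)+

end

lift_definition sconst :: "'k::field \<Rightarrow> ('k, 'm, 'n) sfree" is "Poly_Mapping.single 0" .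

lift_definition svar :: "('m, 'n) gen \<Rightarrow> ('k::field, 'm, 'n) sfree" is "\<lambda>x. rvar x" .

lift_definition spart :: "bit \<Rightarrow> ('k::field, 'm, 'n) sfree \<Rightarrow> ('k, 'm, 'n) sfree" is rpart
  by (metis rpart_diff rpart_sc_ideal)

lift_definition sword :: "('m, 'n) gen fmon \<Rightarrow> ('k::field, 'm, 'n) sfree" is
  "\<lambda>w. Poly_Mapping.single w 1" .

lift_definition scounit :: "('k::field, 'm, 'n) sfree \<Rightarrow> 'k" is "reval kron"
  using reval_sc_ideal by (fastforce simp: reval_diff)

lemma sconst_central: "sconst k * x = x * sconst k"
proof (transfer)
  fix k and x :: "('b, 'c) gen fmon \<Rightarrow>\<^sub>0 'a"
  have "Poly_Mapping.single 0 k * x = x * Poly_Mapping.single 0 k"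
    by (induction x rule: poly_mapping_span_induct) (simp_all add: mult_single algebra_simps)
  then show "Poly_Mapping.single 0 k * x - x * Poly_Mapping.single 0 k \<in> sc_ideal" by simp
qed

lemma sconst_left: "x * (sconst k * y) = sconst k * (x * y)"
  using sconst_central[of k x] by (simp flip: mult.assoc)

lemma sconst_add: "sconst (k + l) = sconst k + sconst l"
  by transfer (simp add: single_add)

lemma sconst_mult: "sconst (k * l) = sconst k * sconst l"
  by transfer (simp add: mult_single)

lemma sconst_one [simp]: "sconst 1 = 1"
  by transfer simp

lemma sconst_zero [simp]: "sconst 0 = 0"
  by transfer simp

lemma spart_add: "spart p (x + y) = spart p x + spart p y"
  by transfer (simp add: rpart_add)

lemma spart_zero [simp]: "spart p 0 = 0"
  by transfer simp

lemma spart_sum: "spart 0 x + spart 1 x = x"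
  by transfer (simp add: rpart_sum)

lemma spart_spart: "spart p (spart q x) = (if p = q then spart p x else 0)"
  by transfer (simp add: rpart_rpart)

lemma spart_mult: "spart p (x * y) = spart 0 x * spart p y + spart 1 x * spart (p + 1) y"
  by transfer (simp add: rpart_mult)

lemma spart_sconst [simp]: "spart p (sconst k) = (if p = 0 then sconst k else 0)"
  by transfer (auto simp: eq_commute)

lemma spart_one [simp]: "spart p 1 = (if p = 0 then 1 else 0)"
  using spart_sconst[of p 1] by (cases p) simp_all

lemma spart_svar [simp]: "spart p (svar x) = (if p = gpar x then svar x else 0)"
  by transfer (auto simp: wpar_def)

lemma sword_plus: "sword (u + v) = sword u * sword v"
  by transfer (simp add: mult_single)

lemma sword_Cons: "sword (FMon (x # xs)) = svar x * sword (FMon xs)"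
  by transfer (simp add: mult_single plus_fmon_def)

lemma sword_Nil [simp]: "sword (FMon []) = 1"
  by transfer (simp flip: zero_fmon_def)

lemma sfree_span_induct [case_names word add]:
  fixes x :: "('k::field, 'm, 'n) sfree"
  assumes w: "\<And>c w. P (sconst c * sword w)" and a: "\<And>x y. P x \<Longrightarrow> P y \<Longrightarrow> P (x + y)"
  shows "P x"
proof (induction x rule: sfree.abs_induct)
  case (1 y)
  show "P (abs_sfree y)"
  proof (induction y rule: poly_mapping_span_induct)
    case (single u c)
    have "abs_sfree (Poly_Mapping.single u c) = sconst c * sword u"
      by transfer (simp add: mult_single)
    then show ?case using w by simp
  next
    case (add f g)
    then show ?case using a by (simp add: plus_sfree.abs_eq[symmetric])
  qed
qed

lemma svar_supercomm:
  "(svar x :: ('k::field, 'm, 'n) sfree) * svar y = koszul (gpar x) (gpar y) (svar y * svar x)"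
proof (cases "gpar x * gpar y = 1")
  case True
  have "rvar x * rvar y - (- (rvar y * rvar x)) \<in> (sc_ideal :: (('m, 'n) gen fmon \<Rightarrow>\<^sub>0 'k) set)"
    using sc_ideal.comm[of x y] unfolding koszul_def if_P[OF True] .
  then have "(svar x :: ('k, 'm, 'n) sfree) * svar y = - (svar y * svar x)"
    unfolding svar.abs_eq times_sfree.abs_eq uminus_sfree.abs_eq sfree.abs_eq_iff .
  then show ?thesis unfolding koszul_def if_P[OF True] .
next
  case False
  have "rvar x * rvar y - rvar y * rvar x \<in> (sc_ideal :: (('m, 'n) gen fmon \<Rightarrow>\<^sub>0 'k) set)"
    using sc_ideal.comm[of x y] unfolding koszul_def if_not_P[OF False] .
  then have "(svar x :: ('k, 'm, 'n) sfree) * svar y = svar y * svar x"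
    unfolding svar.abs_eq times_sfree.abs_eq sfree.abs_eq_iff .
  then show ?thesis unfolding koszul_def if_not_P[OF False] .
qed

lemma svar_odd_square: "gpar x = 1 \<Longrightarrow> svar x * svar x = 0"
  by transfer (simp add: sc_ideal.sq)

lemma koszul_koszul: "koszul p q (koszul p q' x) = koszul p (q + q') (x::'a::ab_group_add)"
  by (cases p; cases q; cases q') (auto simp: koszul_def)

lemma koszul_koszul': "koszul p q (koszul p' q x) = koszul (p + p') q (x::'a::ab_group_add)"
  by (cases p; cases q; cases p') (auto simp: koszul_def)

lemma koszul_mult:
  "koszul p q x * y = koszul p q (x * y)" "y * koszul p q x = koszul p q (y * (x::'a::ring))"
  by (auto simp: koszul_def)

lemma koszul_0 [simp]: "koszul 0 q x = x" "koszul p 0 x = x"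
  by (auto simp: koszul_def)

lemma svar_sword_supercomm:
  "(svar x :: ('k::field, 'm, 'n) sfree) * sword (FMon ys) = koszul (gpar x) (wpar (FMon ys)) (sword (FMon ys) * svar x)"
proof (induction ys)
  case Nil
  then show ?case by (simp add: wpar_def)
next
  case (Cons y ys)
  have "(svar x :: ('k, 'm, 'n) sfree) * sword (FMon (y # ys)) = koszul (gpar x) (gpar y) (svar y * (svar x * sword (FMon ys)))"
    by (simp add: sword_Cons mult.assoc[symmetric] svar_supercomm[of x y] koszul_mult)
  also have "\<dots> = koszul (gpar x) (gpar y) (koszul (gpar x) (wpar (FMon ys)) (svar y * sword (FMon ys) * svar x))"
    by (simp add: Cons.IH koszul_mult mult.assoc)
  also have "\<dots> = koszul (gpar x) (gpar y + wpar (FMon ys)) (svar y * sword (FMon ys) * svar x)"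
    by (rule koszul_koszul)
  also have "gpar y + wpar (FMon ys) = wpar (FMon (y # ys))"
    by (simp only: wpar_def fmon.sel list.map sum_list.Cons)
  finally show ?case unfolding sword_Cons[of y ys] .
qed

lemma sword_supercomm:
  "(sword (FMon xs) :: ('k::field, 'm, 'n) sfree) * sword (FMon ys) =
   koszul (wpar (FMon xs)) (wpar (FMon ys)) (sword (FMon ys) * sword (FMon xs))"
proof (induction xs)
  case Nil
  then show ?case by (simp add: wpar_def)
next
  case (Cons x xs)
  have "(sword (FMon (x # xs)) :: ('k, 'm, 'n) sfree) * sword (FMon ys) =
    koszul (wpar (FMon xs)) (wpar (FMon ys)) (svar x * sword (FMon ys) * sword (FMon xs))"
    by (simp add: sword_Cons mult.assoc Cons.IH koszul_mult)
  also have "\<dots> = koszul (wpar (FMon xs)) (wpar (FMon ys)) (koszul (gpar x) (wpar (FMon ys))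
     (sword (FMon ys) * sword (FMon (x # xs))))"
    by (simp add: svar_sword_supercomm koszul_mult sword_Cons mult.assoc)
  also have "\<dots> = koszul (wpar (FMon xs) + gpar x) (wpar (FMon ys))
     (sword (FMon ys) * sword (FMon (x # xs)))"
    by (rule koszul_koszul')
  also have "wpar (FMon xs) + gpar x = wpar (FMon (x # xs))"
    unfolding wpar_def fmon.sel list.map sum_list.Cons by (rule add.commute)
  finally show ?case .
qed

lemma spart_sword [simp]: "spart p (sword w) = (if p = wpar w then sword w else 0)"
  by transfer (auto simp: wpar_def)

lemma spart_const_mult: "spart p (sconst c * x) = sconst c * spart p x"
  by (cases p) (simp_all add: spart_mult)

lemma sfree_supercomm:
  fixes x :: "('k::field, 'm, 'n) sfree"
  shows "spart p x * spart q y = koszul p q (spart q y * spart p x)"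
proof (induction x rule: sfree_span_induct)
  case (word c u)
  show ?case
  proof (induction y rule: sfree_span_induct)
    case (word d v)
    show ?case
    proof (cases "p = wpar u \<and> q = wpar v")
      case True
      have "(sword u :: ('k, 'm, 'n) sfree) * sword v = koszul p q (sword v * sword u)"
        using sword_supercomm[of "letters u" "letters v"] True by simp
      then have 1: "sconst c * (sconst d * (sword u * sword v)) =
          koszul p q (sconst c * (sconst d * (sword v * sword u)))"
        by (simp only: koszul_mult)
      have 2: "sconst c * sword u * (sconst d * sword v) = sconst c * (sconst d * (sword u * sword v))"
        by (simp only: mult.assoc sconst_left[of "sword u"])
      have 3: "sconst d * sword v * (sconst c * sword u) = sconst c * (sconst d * (sword v * sword u))"
        by (simp only: mult.assoc sconst_left[of "sword v"] sconst_left[of "sconst d"])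
      have 4: "spart p (sconst c * sword u) = sconst c * sword u" "spart q (sconst d * sword v) = sconst d * sword v"
        using True by (simp_all add: spart_const_mult)
      show ?thesis unfolding 4 2 3 by (rule 1)
    qed (auto simp: spart_const_mult koszul_def)
  qed (simp add: spart_add distrib_left distrib_right koszul_add)
qed (simp add: spart_add distrib_left distrib_right koszul_add)

definition seven :: "('k::field, 'm, 'n) sfree set" where
  "seven = {x. spart 0 x = x}"

lemma seven_odd: "x \<in> seven \<Longrightarrow> spart 1 x = 0"
  unfolding seven_def using spart_spart[of 1 0 x] by simp

lemma seven_central: "x \<in> seven \<Longrightarrow> x * y = y * x"
proof -
  assume x: "x \<in> seven"
  have "x * spart q y = spart q y * x" for q
    using sfree_supercomm[of 0 x q y] x by (simp add: seven_def)
  then have "x * (spart 0 y + spart 1 y) = (spart 0 y + spart 1 y) * x"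
    by (simp only: distrib_left distrib_right)
  then show ?thesis by (simp add: spart_sum)
qed

lemma spart_seven_mult: "x \<in> seven \<Longrightarrow> spart p (x * y) = x * spart p y"
  using seven_odd[of x] by (simp add: spart_mult seven_def)

lemma seven_mult: "x \<in> seven \<Longrightarrow> y \<in> seven \<Longrightarrow> x * y \<in> seven"
  using spart_seven_mult[of x 0 y] by (simp add: seven_def)

lemma seven_one [simp]: "1 \<in> seven"
  by (simp add: seven_def)

lemma seven_zero [simp]: "0 \<in> seven"
  by (simp add: seven_def)

lemma seven_add: "x \<in> seven \<Longrightarrow> y \<in> seven \<Longrightarrow> x + y \<in> seven"
  by (simp add: seven_def spart_add)

lemma seven_uminus: "x \<in> seven \<Longrightarrow> - x \<in> seven"
  using spart_add[of 0 x "- x"] by (simp add: seven_def eq_neg_iff_add_eq_0 add.commute)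

lemma seven_sum: "(\<And>i. i \<in> A \<Longrightarrow> f i \<in> seven) \<Longrightarrow> sum f A \<in> seven"
  by (induction A rule: infinite_finite_induct) (auto intro: seven_add)

lemma seven_prod_list: "(\<And>x. x \<in> set xs \<Longrightarrow> x \<in> seven) \<Longrightarrow> prod_list xs \<in> seven"
  by (induction xs) (auto intro: seven_mult)

lemma seven_power: "x \<in> seven \<Longrightarrow> x ^ k \<in> seven"
  by (induction k) (auto intro: seven_mult)

lemma seven_sign: "of_int (sign p) \<in> seven"
  by (auto simp: sign_def seven_uminus)


section \<open>The coordinate superalgebra of GL(m|n)\<close>

text \<open>
  The entries of the two diagonal blocks are even, hence commute, so the order in which the factors
  of a term of the determinant are multiplied (the order of the row indices) is immaterial.
\<close>

definition block_det :: "('r::{finite, linorder} \<Rightarrow> 'm + 'n) \<Rightarrow> ('k::field, 'm, 'n) sfree" where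
  "block_det \<iota> = (\<Sum>p | p permutes UNIV. of_int (sign p) *
     prod_list (map (\<lambda>i. svar (\<iota> i, \<iota> (p i))) (sorted_list_of_set UNIV)))"

definition loc_set :: "('k::field, 'm::{finite, linorder}, 'n::{finite, linorder}) sfree set" where
  "loc_set = {block_det Inl ^ a * block_det Inr ^ b | a b. True}"

lemma block_det_seven: "(\<And>i j. ipar (\<iota> i) = ipar (\<iota> j)) \<Longrightarrow> block_det \<iota> \<in> seven"
  unfolding block_det_def
proof (intro seven_sum seven_mult seven_sign seven_prod_list)
  fix x p
  assume e: "\<And>i j. ipar (\<iota> i) = ipar (\<iota> j)"
  assume "x \<in> set (map (\<lambda>i. svar (\<iota> i, \<iota> (p i))) (sorted_list_of_set UNIV))"
  then obtain i where "x = svar (\<iota> i, \<iota> (p i))" by auto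
  then show "x \<in> seven" using e[of i "p i"] by (simp add: seven_def gpar_def)
qed

lemma block_det_Inl_seven [simp]: "block_det Inl \<in> seven"
  by (rule block_det_seven) (simp add: ipar_def)

lemma block_det_Inr_seven [simp]: "block_det Inr \<in> seven"
  by (rule block_det_seven) (simp add: ipar_def)

lemma loc_set_seven: "s \<in> loc_set \<Longrightarrow> s \<in> seven"
  unfolding loc_set_def by (auto intro!: seven_mult seven_power)

lemma loc_central: "s \<in> loc_set \<Longrightarrow> x * s = s * x"
  using seven_central[OF loc_set_seven, of s x] by simp

lemma loc_central2: "s \<in> loc_set \<Longrightarrow> x * (s * y) = s * (x * y)"
  using loc_central[of s x] by (simp flip: mult.assoc)

lemma loc_lcomm: "s \<in> loc_set \<Longrightarrow> t \<in> loc_set \<Longrightarrow> s * (t * y) = t * (s * y)"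
  by (rule loc_central2)

lemma loc_one [simp]: "1 \<in> loc_set"
  unfolding loc_set_def by (auto intro!: exI[of _ "0::nat"])

lemma loc_mult [simp]:
  fixes s t :: "('k::field, 'm::{finite, linorder}, 'n::{finite, linorder}) sfree"
  assumes "s \<in> loc_set" "t \<in> loc_set" shows "s * t \<in> loc_set"
proof -
  from assms obtain a b c d where
    st: "s = block_det Inl ^ a * block_det Inr ^ b" "t = block_det Inl ^ c * block_det Inr ^ d"
    unfolding loc_set_def by blast
  have "(block_det Inr :: ('k, 'm, 'n) sfree) ^ b * (block_det Inl ^ c * block_det Inr ^ d) =
      block_det Inl ^ c * (block_det Inr ^ b * block_det Inr ^ d)"
    using seven_central[OF seven_power[OF block_det_Inr_seven], of b "(block_det Inl :: ('k, 'm, 'n) sfree) ^ c"]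
    by (simp flip: mult.assoc)
  then have "s * t = block_det Inl ^ (a + c) * block_det Inr ^ (b + d)"
    by (simp only: st power_add mult.assoc)
  then show ?thesis unfolding loc_set_def by blast
qed

definition loc_rel ::
  "('k::field, 'm::{finite, linorder}, 'n::{finite, linorder}) sfree \<times> ('k, 'm, 'n) sfree \<Rightarrow>
   ('k, 'm, 'n) sfree \<times> ('k, 'm, 'n) sfree \<Rightarrow> bool" where
  "loc_rel = (\<lambda>(f, s) (g, t). s \<in> loc_set \<and> t \<in> loc_set \<and> (\<exists>u\<in>loc_set. u * (f * t - g * s) = 0))"

lemma loc_rel_iff:
  "loc_rel (f, s) (g, t) \<longleftrightarrow> s \<in> loc_set \<and> t \<in> loc_set \<and> (\<exists>u\<in>loc_set. u * (t * f) = u * (s * g))"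
  unfolding loc_rel_def prod.case
  by (intro conj_cong bex_cong refl) (simp add: right_diff_distrib loc_central[of t f] loc_central[of s g])

lemma loc_rel_refl: "s \<in> loc_set \<Longrightarrow> loc_rel (f, s) (f, s)"
  unfolding loc_rel_iff using loc_one by blast

lemma loc_rel_part_equivp: "part_equivp loc_rel"
proof (intro part_equivpI sympI transpI)
  show "\<exists>x. loc_rel x x"
    using loc_rel_refl[OF loc_one] by blast
  fix x y z :: "('a, 'b, 'c) sfree \<times> ('a, 'b, 'c) sfree"
  show "loc_rel y x" if "loc_rel x y"
    using that by (cases x; cases y) (auto simp: loc_rel_iff intro: sym)
  assume xy: "loc_rel x y" and yz: "loc_rel y z"
  obtain f s g t h r where e: "x = (f, s)" "y = (g, t)" "z = (h, r)" by (cases x; cases y; cases z)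
  from xy obtain u where u: "s \<in> loc_set" "t \<in> loc_set" "u \<in> loc_set" "u * (t * f) = u * (s * g)"
    unfolding e loc_rel_iff by blast
  from yz obtain v where v: "r \<in> loc_set" "v \<in> loc_set" "v * (r * g) = v * (t * h)"
    unfolding e loc_rel_iff by blast
  have "(u * (v * t)) * (r * f) = v * (r * (u * (t * f)))"
    using u(1-3) v(1,2) by (simp add: mult.assoc loc_lcomm)
  also have "\<dots> = u * (s * (v * (r * g)))"
    unfolding u(4) using u(1-3) v(1,2) by (simp add: mult.assoc loc_lcomm)
  also have "\<dots> = (u * (v * t)) * (s * h)"
    unfolding v(3) using u(1-3) v(1,2) by (simp add: mult.assoc loc_lcomm)
  finally show "loc_rel x z"
    unfolding e loc_rel_iff using u v by (intro conjI bexI[of _ "u * (v * t)"]) simp_all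
qed

quotient_type (overloaded) ('k, 'm, 'n) coordGL =
  "('k::field, 'm::{finite, linorder}, 'n::{finite, linorder}) sfree \<times> ('k, 'm, 'n) sfree" /
  partial: loc_rel
  by (rule loc_rel_part_equivp)

text \<open>The fraction \<open>f / s\<close>; only meaningful for \<open>s \<in> loc_set\<close>.\<close>

definition loc_frac ::
  "('k::field, 'm::{finite, linorder}, 'n::{finite, linorder}) sfree \<Rightarrow> ('k, 'm, 'n) sfree \<Rightarrow>
   ('k, 'm, 'n) coordGL" where
  "loc_frac f s = abs_coordGL (f, s)"

lemma loc_frac_eq_iff:
  assumes "s \<in> loc_set" "t \<in> loc_set"
  shows "loc_frac f s = loc_frac g t \<longleftrightarrow> (\<exists>u\<in>loc_set. u * (t * f) = u * (s * g))"
proof -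
  have "loc_rel (f, s) (g, t) \<longleftrightarrow> loc_frac f s = loc_frac g t"
    unfolding loc_frac_def using Quotient_rel[OF Quotient_coordGL, of "(f, s)" "(g, t)"]
      loc_rel_refl[OF assms(1)] loc_rel_refl[OF assms(2)] by blast
  then show ?thesis unfolding loc_rel_iff using assms by blast
qed

lemma loc_frac_eqI: "s \<in> loc_set \<Longrightarrow> t \<in> loc_set \<Longrightarrow> t * f = s * g \<Longrightarrow> loc_frac f s = loc_frac g t"
  by (auto simp: loc_frac_eq_iff intro!: bexI[of _ 1])

lemma coordGL_cases [case_names loc_frac]:
  obtains f s where "x = loc_frac f s" "s \<in> loc_set"
proof -
  obtain f s where r: "rep_coordGL x = (f, s)" by (cases "rep_coordGL x")
  have "loc_rel (rep_coordGL x) (rep_coordGL x)" "abs_coordGL (rep_coordGL x) = x"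
    using Quotient_rep_reflp[OF Quotient_coordGL] Quotient_abs_rep[OF Quotient_coordGL] by auto
  then have "s \<in> loc_set" "x = loc_frac f s" by (auto simp: r loc_rel_iff loc_frac_def)
  then show ?thesis by (rule that[rotated])
qed

instantiation coordGL :: (field, "{finite, linorder}", "{finite, linorder}") ring_1
begin

definition zero_coordGL :: "('a, 'b, 'c) coordGL" where "zero_coordGL = loc_frac 0 1"
definition one_coordGL :: "('a, 'b, 'c) coordGL" where "one_coordGL = loc_frac 1 1"

lift_definition plus_coordGL :: "('a, 'b, 'c) coordGL \<Rightarrow> ('a, 'b, 'c) coordGL \<Rightarrow> ('a, 'b, 'c) coordGL"
  is "\<lambda>(f, s) (g, t). (f * t + g * s, s * t)"
proof clarify
  fix f s f' s' g t g' t' :: "('a, 'b, 'c) sfree"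
  assume "loc_rel (f, s) (f', s')" "loc_rel (g, t) (g', t')"
  then obtain u v where u: "s \<in> loc_set" "s' \<in> loc_set" "u \<in> loc_set" "u * (s' * f) = u * (s * f')"
    and v: "t \<in> loc_set" "t' \<in> loc_set" "v \<in> loc_set" "v * (t' * g) = v * (t * g')"
    unfolding loc_rel_iff by blast
  note C = loc_lcomm loc_central[OF u(1), of f] loc_central[OF u(1), of g] loc_central[OF u(2), of g']
    loc_central[OF v(1), of f] loc_central[OF v(2), of f'] mult.assoc
    loc_central2[OF v(3), of f] loc_central2[OF v(2), of f] loc_central2[OF v(3), of f'] loc_central2[OF v(1), of f']
  have 1: "(u * v) * ((s' * t') * (f * t)) = v * (t' * (t * (u * (s' * f))))"
    using u(1-3) v(1-3) by (simp add: C)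
  have 2: "(u * v) * ((s * t) * (f' * t')) = v * (t' * (t * (u * (s * f'))))"
    using u(1-3) v(1-3) by (simp add: C)
  have 3: "(u * v) * ((s' * t') * (g * s)) = u * (s' * (s * (v * (t' * g))))"
    using u(1-3) v(1-3) by (simp add: C)
  have 4: "(u * v) * ((s * t) * (g' * s')) = u * (s' * (s * (v * (t * g'))))"
    using u(1-3) v(1-3) by (simp add: C)
  have "(u * v) * ((s' * t') * (f * t + g * s)) = (u * v) * ((s * t) * (f' * t' + g' * s'))"
    by (simp only: distrib_left 1 2 3 4 u(4) v(4))
  then show "loc_rel (f * t + g * s, s * t) (f' * t' + g' * s', s' * t')"
    unfolding loc_rel_iff using u v by (intro conjI bexI[of _ "u * v"]) simp_all
qed

lift_definition uminus_coordGL :: "('a, 'b, 'c) coordGL \<Rightarrow> ('a, 'b, 'c) coordGL"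
  is "\<lambda>(f, s). (- f, s)"
  by (clarsimp simp: loc_rel_iff)

definition minus_coordGL :: "('a, 'b, 'c) coordGL \<Rightarrow> ('a, 'b, 'c) coordGL \<Rightarrow> ('a, 'b, 'c) coordGL"
  where "minus_coordGL x y = x + - y"

lift_definition times_coordGL :: "('a, 'b, 'c) coordGL \<Rightarrow> ('a, 'b, 'c) coordGL \<Rightarrow> ('a, 'b, 'c) coordGL"
  is "\<lambda>(f, s) (g, t). (f * g, s * t)"
proof clarify
  fix f s f' s' g t g' t' :: "('a, 'b, 'c) sfree"
  assume "loc_rel (f, s) (f', s')" "loc_rel (g, t) (g', t')"
  then obtain u v where u: "s \<in> loc_set" "s' \<in> loc_set" "u \<in> loc_set" "u * (s' * f) = u * (s * f')"
    and v: "t \<in> loc_set" "t' \<in> loc_set" "v \<in> loc_set" "v * (t' * g) = v * (t * g')"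
    unfolding loc_rel_iff by blast
  note C = loc_lcomm loc_central[OF u(1), of f] loc_central[OF u(1), of g] loc_central[OF u(2), of g']
    loc_central[OF v(1), of f] loc_central[OF v(2), of f'] mult.assoc
    loc_central2[OF v(3), of f] loc_central2[OF v(2), of f] loc_central2[OF v(3), of f'] loc_central2[OF v(1), of f']
  have 1: "(u * v) * ((s' * t') * (f * g)) = (u * (s' * f)) * (v * (t' * g))"
    using u(1-3) v(1-3) by (simp add: C)
  have 2: "(u * v) * ((s * t) * (f' * g')) = (u * (s * f')) * (v * (t * g'))"
    using u(1-3) v(1-3) by (simp add: C)
  have "(u * v) * ((s' * t') * (f * g)) = (u * v) * ((s * t) * (f' * g'))"
    by (simp only: 1 2 u(4) v(4))
  then show "loc_rel (f * g, s * t) (f' * g', s' * t')"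
    unfolding loc_rel_iff using u v by (intro conjI bexI[of _ "u * v"]) simp_all
qed

lemma loc_frac_add: "s \<in> loc_set \<Longrightarrow> t \<in> loc_set \<Longrightarrow> loc_frac f s + loc_frac g t = loc_frac (f * t + g * s) (s * t)"
  unfolding loc_frac_def by (subst plus_coordGL.abs_eq) (simp_all add: loc_rel_refl)

lemma loc_frac_mult: "s \<in> loc_set \<Longrightarrow> t \<in> loc_set \<Longrightarrow> loc_frac f s * loc_frac g t = loc_frac (f * g) (s * t)"
  unfolding loc_frac_def by (subst times_coordGL.abs_eq) (simp_all add: loc_rel_refl)

lemma loc_frac_uminus: "s \<in> loc_set \<Longrightarrow> - loc_frac f s = loc_frac (- f) s"
  unfolding loc_frac_def by (subst uminus_coordGL.abs_eq) (simp_all add: loc_rel_refl)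

lemma loc_frac_add_same: "s \<in> loc_set \<Longrightarrow> loc_frac f s + loc_frac g s = loc_frac (f + g) s"
  by (simp add: loc_frac_add) (rule loc_frac_eqI, simp_all add: loc_central[of s f] loc_central[of s g] distrib_left mult.assoc)

lemma scounit_mult: "scounit (x * y) = scounit x * scounit y"
  by transfer (simp add: reval_mult)

lemma scounit_add: "scounit (x + y) = scounit x + scounit y"
  by transfer (simp add: reval_add)

lemma scounit_uminus: "scounit (- x) = - scounit x"
  by transfer (simp add: reval_uminus)

lemma scounit_zero [simp]: "scounit 0 = 0"
  by transfer (simp add: reval_def)

lemma scounit_one [simp]: "scounit 1 = 1"
  by transfer (simp flip: single_one)

lemma scounit_svar: "scounit (svar x) = kron x"
  by transfer simp

lemma scounit_sconst [simp]: "scounit (sconst k) = k"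
  by transfer simp

lemma scounit_sum: "scounit (sum f A) = (\<Sum>i\<in>A. scounit (f i))"
  by (induction A rule: infinite_finite_induct) (auto simp: scounit_add)

lemma scounit_prod_list: "scounit (prod_list xs) = prod_list (map scounit xs)"
  by (induction xs) (auto simp: scounit_mult)

lemma scounit_power: "scounit (x ^ k) = scounit x ^ k"
  by (induction k) (auto simp: scounit_mult)

lemma scounit_block_det:
  fixes \<iota> :: "'r::{finite, linorder} \<Rightarrow> 'm + 'n"
  assumes i: "inj \<iota>"
  shows "scounit (block_det \<iota> :: ('k::field, 'm, 'n) sfree) = 1"
proof -
  have "scounit (block_det \<iota> :: ('k::field, 'm, 'n) sfree) =
      (\<Sum>p | p permutes (UNIV::'r set). if p = id then 1 else 0)"
    unfolding block_det_def scounit_sum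
  proof (rule sum.cong[OF refl], goal_cases)
    case (1 p)
    show ?case
    proof (cases "p = id")
      case True
      then show ?thesis
        by (simp add: scounit_mult scounit_prod_list o_def scounit_svar map_replicate_const)
    next
      case False
      then obtain i where "p i \<noteq> i" by (auto simp: fun_eq_iff)
      then have "\<iota> i \<noteq> \<iota> (p i)" using i by (auto dest: injD)
      then have "(0::'k) \<in> set (map (\<lambda>i. kron (\<iota> i, \<iota> (p i))) (sorted_list_of_set UNIV))"
        by force
      then show ?thesis using False
        by (simp add: scounit_mult scounit_prod_list o_def scounit_svar prod_list_zero_iff)
    qed
  qed
  also have "\<dots> = 1"
    by (subst sum.delta) (auto simp: finite_permutations permutes_id)
  finally show ?thesis .
qed

lemma scounit_loc: "s \<in> loc_set \<Longrightarrow> scounit s = 1"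
  unfolding loc_set_def by (auto simp: scounit_mult scounit_power scounit_block_det)

instance
proof
  fix a b c :: "('a, 'b, 'c) coordGL"
  obtain f s where a: "a = loc_frac f s" "s \<in> loc_set" by (cases a rule: coordGL_cases)
  obtain g t where b: "b = loc_frac g t" "t \<in> loc_set" by (cases b rule: coordGL_cases)
  obtain h r where c: "c = loc_frac h r" "r \<in> loc_set" by (cases c rule: coordGL_cases)
  note abc = a(1) b(1) c(1) and m = a(2) b(2) c(2)
  have S: "s * t = t * s" "s * r = r * s" "t * r = r * t"
    "s * (t * x) = t * (s * x)" "s * (r * x) = r * (s * x)" "t * (r * x) = r * (t * x)" for x
    by (rule loc_central[OF m(2)] loc_central[OF m(3)] loc_central[OF m(1)]
        loc_central2[OF m(1)] loc_central2[OF m(2)] loc_central2[OF m(3)])+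
  have M: "f * s = s * f" "f * t = t * f" "f * r = r * f" "g * s = s * g" "g * t = t * g" "g * r = r * g"
    "h * s = s * h" "h * t = t * h" "h * r = r * h"
    "f * (s * x) = s * (f * x)" "f * (t * x) = t * (f * x)" "f * (r * x) = r * (f * x)"
    "g * (s * x) = s * (g * x)" "g * (t * x) = t * (g * x)" "g * (r * x) = r * (g * x)"
    "h * (s * x) = s * (h * x)" "h * (t * x) = t * (h * x)" "h * (r * x) = r * (h * x)" for x
    by (rule loc_central[OF m(1)] loc_central[OF m(2)] loc_central[OF m(3)]
        loc_central2[OF m(1)] loc_central2[OF m(2)] loc_central2[OF m(3)])+
  note A = mult.assoc distrib_left distrib_right
  show "a * b * c = a * (b * c)"
    unfolding abc using m by (simp add: loc_frac_mult mult.assoc)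
  show "1 * a = a" "a * 1 = a"
    unfolding abc one_coordGL_def using m by (simp_all add: loc_frac_mult)
  show "a + b + c = a + (b + c)"
    unfolding abc using m
    by (simp add: loc_frac_add) (rule loc_frac_eqI, simp_all add: A M S add.assoc)
  show "a + b = b + a"
    unfolding abc using m
    by (simp add: loc_frac_add) (rule loc_frac_eqI, simp_all add: A M S add.commute)
  show "0 + a = a"
    unfolding abc zero_coordGL_def using m by (simp add: loc_frac_add)
  show "- a + a = 0"
    unfolding abc zero_coordGL_def using m
    by (simp add: loc_frac_uminus loc_frac_add_same) (rule loc_frac_eqI, simp_all)
  show "a - b = a + - b" by (rule minus_coordGL_def)
  show "(a + b) * c = a * c + b * c"
    unfolding abc using m
    by (simp add: loc_frac_add loc_frac_mult) (rule loc_frac_eqI, simp_all add: A M S)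
  show "a * (b + c) = a * b + a * c"
    unfolding abc using m
    by (simp add: loc_frac_add loc_frac_mult) (rule loc_frac_eqI, simp_all add: A M S)
  show "(0 :: ('a, 'b, 'c) coordGL) \<noteq> 1"
  proof
    assume "(0 :: ('a, 'b, 'c) coordGL) = 1"
    then obtain u :: "('a, 'b, 'c) sfree" where "u \<in> loc_set" "0 = u"
      by (auto simp: zero_coordGL_def one_coordGL_def loc_frac_eq_iff)
    then show False using scounit_loc[of u] by auto
  qed
qed

end

definition coordGL_var ::
  "'m + 'n \<Rightarrow> 'm + 'n \<Rightarrow> ('k::field, 'm::{finite, linorder}, 'n::{finite, linorder}) coordGL" where
  "coordGL_var i j = loc_frac (svar (i, j)) 1"

definition coordGL_scale ::
  "'k::field \<Rightarrow> ('k, 'm::{finite, linorder}, 'n::{finite, linorder}) coordGL \<Rightarrow> ('k, 'm, 'n) coordGL" where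
  "coordGL_scale k x = loc_frac (sconst k) 1 * x"

text \<open>The denominators are even, so parity is that of the numerator.\<close>

lift_definition coordGL_part ::
  "bit \<Rightarrow> ('k::field, 'm::{finite, linorder}, 'n::{finite, linorder}) coordGL \<Rightarrow> ('k, 'm, 'n) coordGL"
  is "\<lambda>p (f, s). (spart p f, s)"
proof clarify
  fix p and f s f' s' :: "('k, 'm, 'n) sfree"
  assume "loc_rel (f, s) (f', s')"
  then obtain u where u: "s \<in> loc_set" "s' \<in> loc_set" "u \<in> loc_set" "u * (s' * f) = u * (s * f')"
    unfolding loc_rel_iff by blast
  have "u * (s' * spart p f) = u * (s * spart p f')"
    using arg_cong[OF u(4), of "spart p"] u(1-3) by (simp add: spart_seven_mult loc_set_seven)
  then show "loc_rel (spart p f, s) (spart p f', s')"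
    unfolding loc_rel_iff using u(1-3) by blast
qed

lift_definition coordGL_counit ::
  "('k::field, 'm::{finite, linorder}, 'n::{finite, linorder}) coordGL \<Rightarrow> 'k"
  is "\<lambda>(f, s). scounit f / scounit s"
proof clarify
  fix f s f' s' :: "('k, 'm, 'n) sfree"
  assume "loc_rel (f, s) (f', s')"
  then obtain u where u: "s \<in> loc_set" "s' \<in> loc_set" "u \<in> loc_set" "u * (s' * f) = u * (s * f')"
    unfolding loc_rel_iff by blast
  from arg_cong[OF u(4), of scounit] show "scounit f / scounit s = scounit f' / scounit s'"
    using u(1-3) by (simp add: scounit_mult scounit_loc)
qed

lemma loc_frac_part: "s \<in> loc_set \<Longrightarrow> coordGL_part p (loc_frac f s) = loc_frac (spart p f) s"
  unfolding loc_frac_def by (subst coordGL_part.abs_eq) (simp_all add: loc_rel_refl)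

lemma loc_frac_counit: "s \<in> loc_set \<Longrightarrow> coordGL_counit (loc_frac f s) = scounit f"
  unfolding loc_frac_def by (subst coordGL_counit.abs_eq) (simp_all add: loc_rel_refl scounit_loc)

lemma module_coordGL: "module (coordGL_scale :: 'k::field \<Rightarrow> ('k, 'm::{finite, linorder}, 'n::{finite, linorder}) coordGL \<Rightarrow> _)"
  by standard
    (simp_all add: coordGL_scale_def distrib_left distrib_right sconst_add sconst_mult
      loc_frac_add_same[symmetric] loc_frac_mult one_coordGL_def[symmetric] mult.assoc[symmetric])

lemma coordGL_const_central: "loc_frac (sconst k) 1 * x = x * loc_frac (sconst k) 1"
  by (cases x rule: coordGL_cases) (simp add: loc_frac_mult sconst_central)

lemma coordGL_scale_mult:
  "coordGL_scale k x * y = coordGL_scale k (x * y)" "x * coordGL_scale k y = coordGL_scale k (x * y)"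
  by (simp_all add: coordGL_scale_def mult.assoc) (metis coordGL_const_central mult.assoc)

lemma coordGL_part_add: "coordGL_part p (x + y) = coordGL_part p x + coordGL_part p y"
proof -
  obtain f s where x: "x = loc_frac f s" "s \<in> loc_set" by (cases x rule: coordGL_cases)
  obtain g t where y: "y = loc_frac g t" "t \<in> loc_set" by (cases y rule: coordGL_cases)
  have "spart p (f * t) = spart p f * t" "spart p (g * s) = spart p g * s"
    using x y by (metis loc_central loc_set_seven spart_seven_mult)+
  then show ?thesis using x y by (simp add: loc_frac_add loc_frac_part spart_add)
qed

lemma coordGL_part_mult:
  "coordGL_part p (x * y) =
   coordGL_part 0 x * coordGL_part p y + coordGL_part 1 x * coordGL_part (p + 1) y"
  by (cases x rule: coordGL_cases; cases y rule: coordGL_cases)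
    (simp add: loc_frac_mult loc_frac_part loc_frac_add_same spart_mult)

lemma coordGL_part_sum: "coordGL_part 0 x + coordGL_part 1 x = x"
  by (cases x rule: coordGL_cases) (simp add: loc_frac_part loc_frac_add_same spart_sum)

lemma loc_frac_zero: "s \<in> loc_set \<Longrightarrow> loc_frac 0 s = 0"
  unfolding zero_coordGL_def by (rule loc_frac_eqI) simp_all

lemma coordGL_part_part:
  "coordGL_part p (coordGL_part q x) = (if p = q then coordGL_part p x else 0)"
  by (cases x rule: coordGL_cases) (simp add: loc_frac_part spart_spart loc_frac_zero)

lemma coordGL_part_scale: "coordGL_part p (coordGL_scale k x) = coordGL_scale k (coordGL_part p x)"
  by (cases x rule: coordGL_cases) (simp add: coordGL_scale_def loc_frac_mult loc_frac_part spart_const_mult)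

lemma coordGL_part_one [simp]: "coordGL_part p 1 = (if p = 0 then 1 else 0)"
  by (simp add: one_coordGL_def loc_frac_part loc_frac_zero)

lemma coordGL_counit_hom:
  "superalgebra_hom coordGL_scale coordGL_part (*) purely_even
     (coordGL_counit :: ('k::field, 'm::{finite, linorder}, 'n::{finite, linorder}) coordGL \<Rightarrow> 'k)"
proof -
  have s1: "scounit (spart 1 x) = 0" for x :: "('k, 'm, 'n) sfree"
  proof (induction x rule: sfree_span_induct)
    case (word c w)
    have "wpar w = 1 \<Longrightarrow> scounit (sword w :: ('k, 'm, 'n) sfree) = 0"
    proof transfer
      fix w :: "('m, 'n) gen fmon" assume "wpar w = 1"
      have z: "(\<forall>x\<in>set xs. gpar x = 0) \<Longrightarrow> sum_list (map gpar xs) = 0" for xs :: "('m, 'n) gen list"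
        by (induction xs) auto
      have "\<not> (\<forall>x\<in>set (letters w). gpar x = 0)"
      proof
        assume "\<forall>x\<in>set (letters w). gpar x = 0"
        from z[OF this] \<open>wpar w = 1\<close> show False by (simp add: wpar_def)
      qed
      then obtain x where x: "x \<in> set (letters w)" "gpar x \<noteq> 0" by blast
      then have "fst x \<noteq> snd x" using gpar_diag by blast
      with x(1) have "(0::'k) \<in> set (map kron (letters w))" by force
      then show "reval kron (Poly_Mapping.single w (1::'k)) = 0" by (simp add: prod_list_zero_iff)
    qed
    then show ?case by (auto simp: spart_const_mult scounit_mult)
  qed (simp add: spart_add scounit_add)
  have s0: "scounit (spart 0 x) = scounit x" for x :: "('k, 'm, 'n) sfree"
    using arg_cong[OF spart_sum[of x], of scounit] unfolding scounit_add s1 by simp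
  have "coordGL_counit (x + y) = coordGL_counit x + coordGL_counit y"
    "coordGL_counit (x * y) = coordGL_counit x * coordGL_counit y"
    "coordGL_counit (coordGL_scale k x) = k * coordGL_counit x"
    "coordGL_counit (coordGL_part p x) = purely_even p (coordGL_counit x)"
    for x y :: "('k, 'm, 'n) coordGL" and p k
    by (cases x rule: coordGL_cases; cases y rule: coordGL_cases; cases p;
        simp add: loc_frac_add loc_frac_mult loc_frac_counit scounit_add scounit_mult scounit_loc coordGL_scale_def
          loc_frac_part purely_even_def s0 s1)+
  moreover have "coordGL_counit (1 :: ('k, 'm, 'n) coordGL) = 1"
    by (simp add: one_coordGL_def loc_frac_counit)
  moreover have "module ((*) :: 'k \<Rightarrow> 'k \<Rightarrow> 'k)" by standard (simp_all add: algebra_simps)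
  ultimately show ?thesis
    unfolding superalgebra_hom_def even_linear_def module_hom_def module_hom_axioms_def
    using module_coordGL by blast
qed

lemma coordGL_counit_var: "coordGL_counit (coordGL_var i j) = (if i = j then 1 else 0)"
  by (simp add: coordGL_var_def loc_frac_counit scounit_svar)


section \<open>The tensor square of the coordinate superalgebra\<close>

inductive_set bilin_rels ::
  "(('k::field, 'm::{finite, linorder}, 'n::{finite, linorder}) coordGL \<times> ('k, 'm, 'n) coordGL
    \<Rightarrow>\<^sub>0 'k) set" where
  addl: "Poly_Mapping.single (x + x', y) 1 - Poly_Mapping.single (x, y) 1 - Poly_Mapping.single (x', y) 1
    \<in> bilin_rels"
| addr: "Poly_Mapping.single (x, y + y') 1 - Poly_Mapping.single (x, y) 1 - Poly_Mapping.single (x, y') 1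
    \<in> bilin_rels"
| scl: "Poly_Mapping.single (coordGL_scale k x, y) 1 - Poly_Mapping.single (x, y) k \<in> bilin_rels"
| scr: "Poly_Mapping.single (x, coordGL_scale k y) 1 - Poly_Mapping.single (x, y) k \<in> bilin_rels"
| add: "f \<in> bilin_rels \<Longrightarrow> g \<in> bilin_rels \<Longrightarrow> f + g \<in> bilin_rels"
| scale: "f \<in> bilin_rels \<Longrightarrow> Poly_Mapping.map ((*) k) f \<in> bilin_rels"

lemma lookup_map_times: "Poly_Mapping.lookup (Poly_Mapping.map ((*) k) f) x = k * Poly_Mapping.lookup f (x::'x)"
  for k :: "'k::ring_1"
  by (simp add: map.rep_eq when_def)

lemma map_times_add: "Poly_Mapping.map ((*) k) (f + g) = Poly_Mapping.map ((*) k) f + Poly_Mapping.map ((*) k) g"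
  for k :: "'k::ring_1"
  by (rule poly_mapping_eqI) (simp add: lookup_map_times lookup_add distrib_left)

lemma map_times_diff: "Poly_Mapping.map ((*) k) (f - g) = Poly_Mapping.map ((*) k) f - Poly_Mapping.map ((*) k) g"
  for k :: "'k::ring_1"
  by (rule poly_mapping_eqI) (simp add: lookup_map_times lookup_minus right_diff_distrib)

lemma module_map_times: "module (\<lambda>k. Poly_Mapping.map ((*) (k::'k::comm_ring_1)) :: ('x \<Rightarrow>\<^sub>0 'k) \<Rightarrow> _)"
  by standard (rule poly_mapping_eqI, simp add: lookup_map_times lookup_add algebra_simps)+

lemma bilin_rels_uminus: "f \<in> bilin_rels \<Longrightarrow> - f \<in> bilin_rels"
proof -
  assume "f \<in> bilin_rels"
  from bilin_rels.scale[OF this, of "-1"] show ?thesis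
    by (metis (no_types, lifting) lookup_map_times lookup_uminus mult_minus1 poly_mapping_eqI)
qed

lemma bilin_rels_diff: "f \<in> bilin_rels \<Longrightarrow> g \<in> bilin_rels \<Longrightarrow> f - g \<in> bilin_rels"
  using bilin_rels.add[OF _ bilin_rels_uminus, of f g] by simp

lemma bilin_rels_zero [simp]: "0 \<in> bilin_rels"
  using bilin_rels_diff[OF bilin_rels.addl bilin_rels.addl] by (metis diff_self)

quotient_type (overloaded) ('k, 'm, 'n) coordGL2 =
  "('k::field, 'm::{finite, linorder}, 'n::{finite, linorder}) coordGL \<times> ('k, 'm, 'n) coordGL \<Rightarrow>\<^sub>0 'k" /
  "\<lambda>f g. f - g \<in> bilin_rels"
proof (intro equivpI reflpI sympI transpI)
  fix f g h :: "('k, 'm, 'n) coordGL \<times> ('k, 'm, 'n) coordGL \<Rightarrow>\<^sub>0 'k"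
  show "g - f \<in> bilin_rels" if "f - g \<in> bilin_rels"
    using bilin_rels_uminus[OF that] by simp
  show "f - h \<in> bilin_rels" if "f - g \<in> bilin_rels" "g - h \<in> bilin_rels"
    using bilin_rels.add[OF that] by simp
qed simp

instantiation coordGL2 :: (field, "{finite, linorder}", "{finite, linorder}") ab_group_add
begin

lift_definition zero_coordGL2 :: "('a, 'b, 'c) coordGL2" is 0 .
lift_definition plus_coordGL2 :: "('a, 'b, 'c) coordGL2 \<Rightarrow> ('a, 'b, 'c) coordGL2 \<Rightarrow> ('a, 'b, 'c) coordGL2" is "(+)"
  unfolding add_diff_add by (rule bilin_rels.add)
lift_definition minus_coordGL2 :: "('a, 'b, 'c) coordGL2 \<Rightarrow> ('a, 'b, 'c) coordGL2 \<Rightarrow> ('a, 'b, 'c) coordGL2" is "(-)"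
proof -
  fix f f' g g' :: "('a, 'b, 'c) coordGL \<times> ('a, 'b, 'c) coordGL \<Rightarrow>\<^sub>0 'a"
  assume "f - f' \<in> bilin_rels" "g - g' \<in> bilin_rels"
  from bilin_rels_diff[OF this] show "f - g - (f' - g') \<in> bilin_rels"
    by (simp add: algebra_simps)
qed
lift_definition uminus_coordGL2 :: "('a, 'b, 'c) coordGL2 \<Rightarrow> ('a, 'b, 'c) coordGL2" is uminus
proof -
  fix f f' :: "('a, 'b, 'c) coordGL \<times> ('a, 'b, 'c) coordGL \<Rightarrow>\<^sub>0 'a"
  assume "f - f' \<in> bilin_rels"
  from bilin_rels_uminus[OF this] show "- f - - f' \<in> bilin_rels" by simp
qed

instance
  by standard (transfer, simp add: algebra_simps)+

end

lift_definition coordGL2_scale ::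
  "'k::field \<Rightarrow> ('k, 'm::{finite, linorder}, 'n::{finite, linorder}) coordGL2 \<Rightarrow> ('k, 'm, 'n) coordGL2"
  is "\<lambda>k. Poly_Mapping.map ((*) k)"
  unfolding map_times_diff[symmetric] by (rule bilin_rels.scale)

definition tensor ::
  "('k::field, 'm::{finite, linorder}, 'n::{finite, linorder}) coordGL \<Rightarrow> ('k, 'm, 'n) coordGL \<Rightarrow>
   ('k, 'm, 'n) coordGL2" (infixl "\<otimes>" 67) where
  "x \<otimes> y = abs_coordGL2 (Poly_Mapping.single (x, y) 1)"

definition bilinear_map ::
  "('k::field \<Rightarrow> 'v::ab_group_add \<Rightarrow> 'v) \<Rightarrow>
   (('k, 'm::{finite, linorder}, 'n::{finite, linorder}) coordGL \<Rightarrow> ('k, 'm, 'n) coordGL \<Rightarrow> 'v) \<Rightarrow> bool" where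
  "bilinear_map sc \<beta> \<longleftrightarrow>
     (\<forall>y. module_hom coordGL_scale sc (\<lambda>x. \<beta> x y)) \<and> (\<forall>x. module_hom coordGL_scale sc (\<beta> x))"

text \<open>
  The linear map on the tensor square induced by a bilinear map, evaluated on a representing
  formal sum; it does not depend on the choice of the latter, see \<open>tensor_lift_tensor\<close> and
  \<open>tensor_lift_hom\<close> below.
\<close>

definition tensor_lift ::
  "('k::field \<Rightarrow> 'v::ab_group_add \<Rightarrow> 'v) \<Rightarrow>
   (('k, 'm::{finite, linorder}, 'n::{finite, linorder}) coordGL \<Rightarrow> ('k, 'm, 'n) coordGL \<Rightarrow> 'v) \<Rightarrow>
   ('k, 'm, 'n) coordGL2 \<Rightarrow> 'v" where
  "tensor_lift sc \<beta> t =
     (\<Sum>z\<in>Poly_Mapping.keys (rep_coordGL2 t).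
        sc (Poly_Mapping.lookup (rep_coordGL2 t) z) (\<beta> (fst z) (snd z)))"

lemma module_coordGL2:
  "module (coordGL2_scale :: 'k::field \<Rightarrow> ('k, 'm::{finite, linorder}, 'n::{finite, linorder}) coordGL2 \<Rightarrow> _)"
  by standard
    (transfer, simp add: module.scale_right_distrib[OF module_map_times] module.scale_left_distrib[OF module_map_times]
       module.scale_scale[OF module_map_times] module.scale_one[OF module_map_times])+

lemma map_times_single: "Poly_Mapping.map ((*) k) (Poly_Mapping.single x 1) = Poly_Mapping.single x (k::'k::ring_1)"
  by (rule poly_mapping_eqI) (simp add: lookup_map_times lookup_single when_def)

lemma tensor_add_left: "(x + x') \<otimes> y = x \<otimes> y + x' \<otimes> y"
  unfolding tensor_def plus_coordGL2.abs_eq coordGL2.abs_eq_iff diff_diff_eq[symmetric] by (rule bilin_rels.addl)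

lemma tensor_add_right: "x \<otimes> (y + y') = x \<otimes> y + x \<otimes> y'"
  unfolding tensor_def plus_coordGL2.abs_eq coordGL2.abs_eq_iff diff_diff_eq[symmetric] by (rule bilin_rels.addr)

lemma tensor_scale_left: "coordGL_scale k x \<otimes> y = coordGL2_scale k (x \<otimes> y)"
  unfolding tensor_def coordGL2_scale.abs_eq coordGL2.abs_eq_iff map_times_single by (rule bilin_rels.scl)

lemma tensor_scale_right: "x \<otimes> coordGL_scale k y = coordGL2_scale k (x \<otimes> y)"
  unfolding tensor_def coordGL2_scale.abs_eq coordGL2.abs_eq_iff map_times_single by (rule bilin_rels.scr)

lemma tensor_zero_left [simp]: "0 \<otimes> y = 0"
  using tensor_add_left[of 0 0 y] by simp

lemma tensor_zero_right [simp]: "x \<otimes> 0 = 0"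
  using tensor_add_right[of x 0 0] by simp

lemma tensor_span_induct [case_names tensor add]:
  fixes t :: "('k::field, 'm::{finite, linorder}, 'n::{finite, linorder}) coordGL2"
  assumes p: "\<And>x y. P (x \<otimes> y)" and a: "\<And>t u. P t \<Longrightarrow> P u \<Longrightarrow> P (t + u)"
  shows "P t"
proof (induction t rule: coordGL2.abs_induct)
  case (1 f)
  show "P (abs_coordGL2 f)"
  proof (induction f rule: poly_mapping_span_induct)
    case (single z c)
    have "abs_coordGL2 (Poly_Mapping.single z c) = coordGL2_scale c (fst z \<otimes> snd z)"
      by (simp add: tensor_def coordGL2_scale.abs_eq map_times_single)
    also have "\<dots> = coordGL_scale c (fst z) \<otimes> snd z" by (rule tensor_scale_left[symmetric])
    finally show ?case using p by simp
  next
    case (add f g)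
    then show ?case using a unfolding plus_coordGL2.abs_eq[symmetric] by blast
  qed
qed

lemma tensor_span_induct_homogeneous [case_names tensor add]:
  fixes t :: "('k::field, 'm::{finite, linorder}, 'n::{finite, linorder}) coordGL2"
  assumes p: "\<And>p q x y. coordGL_part p x = x \<Longrightarrow> coordGL_part q y = y \<Longrightarrow> P (x \<otimes> y)"
    and a: "\<And>t u. P t \<Longrightarrow> P u \<Longrightarrow> P (t + u)"
  shows "P t"
proof (induction t rule: tensor_span_induct)
  case (tensor x y)
  have "P (coordGL_part r x \<otimes> coordGL_part q y)" for r q
    by (rule p[of r _ q]) (simp_all add: coordGL_part_part)
  then have "P ((coordGL_part 0 x + coordGL_part 1 x) \<otimes> (coordGL_part 0 y + coordGL_part 1 y))"
    unfolding tensor_add_left tensor_add_right by (intro a) simp_all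
  then show ?case by (simp only: coordGL_part_sum)
qed (rule a)

context
  fixes sc :: "'k::field \<Rightarrow> 'v::ab_group_add \<Rightarrow> 'v"
  assumes sc: "module sc"
begin

interpretation module sc by (rule sc)

private definition raw_lift :: "('x \<Rightarrow> 'y \<Rightarrow> 'v) \<Rightarrow> ('x \<times> 'y \<Rightarrow>\<^sub>0 'k) \<Rightarrow> 'v" where
  "raw_lift \<beta> f = (\<Sum>z\<in>Poly_Mapping.keys f. sc (Poly_Mapping.lookup f z) (\<beta> (fst z) (snd z)))"

private lemma raw_lift_add: "raw_lift \<beta> (f + g) = raw_lift \<beta> f + raw_lift \<beta> g"
  unfolding raw_lift_def by (rule setsum_keys_plus_distrib) (simp_all add: scale_left_distrib)

private lemma raw_lift_single: "raw_lift \<beta> (Poly_Mapping.single z c) = sc c (\<beta> (fst z) (snd z))"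
  by (simp add: raw_lift_def)

private lemma raw_lift_scale: "raw_lift \<beta> (Poly_Mapping.map ((*) k) f) = sc k (raw_lift \<beta> f)"
proof (induction f rule: poly_mapping_span_induct)
  case (single z c)
  then show ?case by (simp add: raw_lift_single)
qed (simp add: map_times_add raw_lift_add scale_right_distrib)

private lemma raw_lift_diff: "raw_lift \<beta> (f - g) = raw_lift \<beta> f - raw_lift \<beta> g"
  using raw_lift_add[of \<beta> "f - g" g] by simp

private lemma raw_lift_rels:
  fixes \<beta> :: "('k, 'm::{finite, linorder}, 'n::{finite, linorder}) coordGL \<Rightarrow> ('k, 'm, 'n) coordGL \<Rightarrow> 'v"
  assumes b: "bilinear_map sc \<beta>" and f: "f \<in> bilin_rels"
  shows "raw_lift \<beta> f = 0"
proof -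
  have *: "\<beta> (x + x') y = \<beta> x y + \<beta> x' y" "\<beta> x (y + y') = \<beta> x y + \<beta> x y'"
    "\<beta> (coordGL_scale k x) y = sc k (\<beta> x y)" "\<beta> x (coordGL_scale k y) = sc k (\<beta> x y)" for x x' y y' k
    using b unfolding bilinear_map_def module_hom_def module_hom_axioms_def by blast+
  from f show ?thesis
    by (induction rule: bilin_rels.induct)
      (simp_all add: raw_lift_add raw_lift_diff raw_lift_scale raw_lift_single *)
qed

private lemma tensor_lift_abs:
  assumes "bilinear_map sc \<beta>"
  shows "tensor_lift sc \<beta> (abs_coordGL2 f) = raw_lift \<beta> f"
proof -
  have "rep_coordGL2 (abs_coordGL2 f) - f \<in> bilin_rels"
    using Quotient3_rep_abs[OF Quotient3_coordGL2, of f] by simp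
  from raw_lift_rels[OF assms this] show ?thesis
    by (simp add: raw_lift_diff tensor_lift_def raw_lift_def[symmetric])
qed

lemma tensor_lift_tensor: "bilinear_map sc \<beta> \<Longrightarrow> tensor_lift sc \<beta> (x \<otimes> y) = \<beta> x y"
  by (simp add: tensor_def tensor_lift_abs raw_lift_single)

lemma tensor_lift_add:
  assumes "bilinear_map sc \<beta>"
  shows "tensor_lift sc \<beta> (t + u) = tensor_lift sc \<beta> t + tensor_lift sc \<beta> u"
proof (induction t rule: coordGL2.abs_induct)
  case (1 f)
  show ?case
    by (induction u rule: coordGL2.abs_induct) (simp add: plus_coordGL2.abs_eq tensor_lift_abs[OF assms] raw_lift_add)
qed

lemma tensor_lift_scale:
  assumes "bilinear_map sc \<beta>"
  shows "tensor_lift sc \<beta> (coordGL2_scale k t) = sc k (tensor_lift sc \<beta> t)"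
  by (induction t rule: coordGL2.abs_induct)
    (simp add: coordGL2_scale.abs_eq tensor_lift_abs[OF assms] raw_lift_scale)

lemma tensor_lift_hom: "bilinear_map sc \<beta> \<Longrightarrow> module_hom coordGL2_scale sc (tensor_lift sc \<beta>)"
  unfolding module_hom_def module_hom_axioms_def
  by (simp add: module_coordGL2 sc tensor_lift_add tensor_lift_scale)

lemma bilinear_mapI:
  assumes "\<And>x x' y. \<beta> (x + x') y = \<beta> x y + \<beta> x' y" "\<And>x y y'. \<beta> x (y + y') = \<beta> x y + \<beta> x y'"
    "\<And>k x y. \<beta> (coordGL_scale k x) y = sc k (\<beta> x y)" "\<And>k x y. \<beta> x (coordGL_scale k y) = sc k (\<beta> x y)"
  shows "bilinear_map sc \<beta>"
  unfolding bilinear_map_def module_hom_def module_hom_axioms_def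
  by (simp add: assms module_coordGL sc)

end

text \<open>
  The product of the tensor square is
  \<open>(x \<otimes> y) (x' \<otimes> y') = (-1)\<^bsup>|y||x'|\<^esup> xx' \<otimes> yy'\<close> for homogeneous \<open>y\<close> and \<open>x'\<close>.
\<close>

definition tensor_mult ::
  "('k::field, 'm::{finite, linorder}, 'n::{finite, linorder}) coordGL \<Rightarrow> ('k, 'm, 'n) coordGL \<Rightarrow>
   ('k, 'm, 'n) coordGL \<Rightarrow> ('k, 'm, 'n) coordGL \<Rightarrow> ('k, 'm, 'n) coordGL2" where
  "tensor_mult x y x' y' =
     (\<Sum>p\<in>{0, 1}. \<Sum>q\<in>{0, 1}. koszul p q ((x * coordGL_part q x') \<otimes> (coordGL_part p y * y')))"

lemma coordGL2_scale_add: "coordGL2_scale k (t + u) = coordGL2_scale k t + coordGL2_scale k u"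
  by (rule module.scale_right_distrib[OF module_coordGL2])

lemma koszul_scale2: "koszul p q (coordGL2_scale k t) = coordGL2_scale k (koszul p q t)"
  by (simp add: koszul_def module.scale_minus_right[OF module_coordGL2])

lemma tensor_mult_linear:
  "tensor_mult (x + z) y x' y' = tensor_mult x y x' y' + tensor_mult z y x' y'"
  "tensor_mult x (y + z) x' y' = tensor_mult x y x' y' + tensor_mult x z x' y'"
  "tensor_mult x y (x' + z) y' = tensor_mult x y x' y' + tensor_mult x y z y'"
  "tensor_mult x y x' (y' + z) = tensor_mult x y x' y' + tensor_mult x y x' z"
  "tensor_mult (coordGL_scale k x) y x' y' = coordGL2_scale k (tensor_mult x y x' y')"
  "tensor_mult x (coordGL_scale k y) x' y' = coordGL2_scale k (tensor_mult x y x' y')"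
  "tensor_mult x y (coordGL_scale k x') y' = coordGL2_scale k (tensor_mult x y x' y')"
  "tensor_mult x y x' (coordGL_scale k y') = coordGL2_scale k (tensor_mult x y x' y')"
  by (simp_all only: tensor_mult_def coordGL_part_add coordGL_part_scale distrib_left distrib_right
    tensor_add_left tensor_add_right koszul_add sum.distrib coordGL_scale_mult tensor_scale_left
    tensor_scale_right koszul_scale2 module.scale_sum_right[OF module_coordGL2])

lemma tensor_mult_bilinear: "bilinear_map coordGL2_scale (tensor_mult x y)"
  by (rule bilinear_mapI[OF module_coordGL2]) (rule tensor_mult_linear)+

lemma tensor_mult_lift_bilinear:
  "bilinear_map coordGL2_scale (\<lambda>x y. tensor_lift coordGL2_scale (tensor_mult x y) u)"
proof (rule bilinear_mapI[OF module_coordGL2])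
  note L = tensor_lift_tensor[OF module_coordGL2 tensor_mult_bilinear]
    tensor_lift_add[OF module_coordGL2 tensor_mult_bilinear]
  fix x x' y y' :: "('a, 'b, 'c) coordGL" and k
  show "tensor_lift coordGL2_scale (tensor_mult (x + x') y) u =
    tensor_lift coordGL2_scale (tensor_mult x y) u + tensor_lift coordGL2_scale (tensor_mult x' y) u"
  proof (induction u rule: tensor_span_induct)
    case (tensor a b)
    show ?case unfolding L by (rule tensor_mult_linear)
  next
    case (add t u)
    then show ?case unfolding L by (simp only: add_ac)
  qed
  show "tensor_lift coordGL2_scale (tensor_mult x (y + y')) u =
    tensor_lift coordGL2_scale (tensor_mult x y) u + tensor_lift coordGL2_scale (tensor_mult x y') u"
  proof (induction u rule: tensor_span_induct)
    case (tensor a b)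
    show ?case unfolding L by (rule tensor_mult_linear)
  next
    case (add t u)
    then show ?case unfolding L by (simp only: add_ac)
  qed
  show "tensor_lift coordGL2_scale (tensor_mult (coordGL_scale k x) y) u =
    coordGL2_scale k (tensor_lift coordGL2_scale (tensor_mult x y) u)"
  proof (induction u rule: tensor_span_induct)
    case (tensor a b)
    show ?case unfolding L by (rule tensor_mult_linear)
  next
    case (add t u)
    then show ?case unfolding L by (simp only: coordGL2_scale_add)
  qed
  show "tensor_lift coordGL2_scale (tensor_mult x (coordGL_scale k y)) u =
    coordGL2_scale k (tensor_lift coordGL2_scale (tensor_mult x y) u)"
  proof (induction u rule: tensor_span_induct)
    case (tensor a b)
    show ?case unfolding L by (rule tensor_mult_linear)
  next
    case (add t u)
    then show ?case unfolding L by (simp only: coordGL2_scale_add)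
  qed
qed

instantiation coordGL2 :: (field, "{finite, linorder}", "{finite, linorder}") ring_1
begin

definition one_coordGL2 :: "('a, 'b, 'c) coordGL2" where "one_coordGL2 = 1 \<otimes> 1"

definition times_coordGL2 ::
  "('a, 'b, 'c) coordGL2 \<Rightarrow> ('a, 'b, 'c) coordGL2 \<Rightarrow> ('a, 'b, 'c) coordGL2" where
  "times_coordGL2 t u = tensor_lift coordGL2_scale (\<lambda>x y. tensor_lift coordGL2_scale (tensor_mult x y) u) t"

lemma tensor_times_tensor: "(x \<otimes> y) * (x' \<otimes> y') = tensor_mult x y x' y'"
  unfolding times_coordGL2_def
  by (subst tensor_lift_tensor[OF module_coordGL2 tensor_mult_lift_bilinear])
    (rule tensor_lift_tensor[OF module_coordGL2 tensor_mult_bilinear])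

lemma coordGL2_distrib_right: "(t + t') * u = t * u + t' * (u :: ('a, 'b, 'c) coordGL2)"
  unfolding times_coordGL2_def by (rule tensor_lift_add[OF module_coordGL2 tensor_mult_lift_bilinear])

lemma coordGL2_distrib_left: "t * (u + u') = t * u + t * (u' :: ('a, 'b, 'c) coordGL2)"
proof (induction t rule: tensor_span_induct)
  case (tensor x y)
  show ?case
    unfolding times_coordGL2_def
    by (subst (1 2 3) tensor_lift_tensor[OF module_coordGL2 tensor_mult_lift_bilinear])
      (rule tensor_lift_add[OF module_coordGL2 tensor_mult_bilinear])
qed (simp only: coordGL2_distrib_right add_ac)

lemma tensor_times_homogeneous:
  assumes "coordGL_part p y = y" "coordGL_part q x' = x'"
  shows "(x \<otimes> y) * (x' \<otimes> y') = koszul p q ((x * x') \<otimes> (y * y'))"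
proof -
  have 1: "coordGL_part r y = (if r = p then y else 0)" for r
    using coordGL_part_part[of r p y] assms(1) by (cases "r = p") simp_all
  have 2: "coordGL_part r x' = (if r = q then x' else 0)" for r
    using coordGL_part_part[of r q x'] assms(2) by (cases "r = q") simp_all
  show ?thesis
    unfolding tensor_times_tensor tensor_mult_def 1 2
    by (cases p; cases q) (simp_all add: koszul_def)
qed

lemma coordGL_part_mult_homogeneous:
  assumes "coordGL_part p x = x" "coordGL_part q y = y"
  shows "coordGL_part (p + q) (x * y) = x * (y :: ('a, 'b, 'c) coordGL)"
proof -
  have 1: "coordGL_part r x = (if r = p then x else 0)" for r
    using coordGL_part_part[of r p x] assms(1) by (cases "r = p") simp_all
  have 2: "coordGL_part r y = (if r = q then y else 0)" for r
    using coordGL_part_part[of r q y] assms(2) by (cases "r = q") simp_all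
  show ?thesis
    unfolding coordGL_part_mult 1 2 by (cases p; cases q) simp_all
qed

lemma coordGL2_koszul_mult:
  "koszul p q t * u = koszul p q (t * u)" "u * koszul p q t = koszul p q (u * (t :: ('a, 'b, 'c) coordGL2))"
proof -
  have "0 * u = 0" "u * 0 = 0" using coordGL2_distrib_right[of 0 0 u] coordGL2_distrib_left[of u 0 0] by simp_all
  then have "- t * u = - (t * u)" "u * - t = - (u * t)"
    using coordGL2_distrib_right[of t "- t" u] coordGL2_distrib_left[of u t "- t"]
    by (simp_all add: eq_neg_iff_add_eq_0 add.commute)
  then show "koszul p q t * u = koszul p q (t * u)" "u * koszul p q t = koszul p q (u * t)"
    by (simp_all add: koszul_def)
qed

instance
proof
  fix t u v :: "('a, 'b, 'c) coordGL2"
  show "(t + u) * v = t * v + u * v" by (rule coordGL2_distrib_right)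
  show "t * (u + v) = t * u + t * v" by (rule coordGL2_distrib_left)
  show "1 * t = t"
    by (induction t rule: tensor_span_induct_homogeneous)
      (simp_all add: one_coordGL2_def coordGL2_distrib_left tensor_times_homogeneous[of 0])
  show "t * 1 = t"
    by (induction t rule: tensor_span_induct_homogeneous)
      (simp_all add: one_coordGL2_def coordGL2_distrib_right tensor_times_homogeneous[of _ _ 0])
  show "t * u * v = t * (u * v)"
  proof (induction t rule: tensor_span_induct_homogeneous)
    case (tensor p q x y)
    note xy = tensor
    show ?case
    proof (induction u rule: tensor_span_induct_homogeneous)
      case (tensor p' q' x' y')
      note xy' = tensor
      show ?case
      proof (induction v rule: tensor_span_induct_homogeneous)
        case (tensor p'' q'' x'' y'')
        have "koszul q p' (koszul (q + q') p'' z) = koszul q' p'' (koszul q (p' + p'') z)"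
          for z :: "('a, 'b, 'c) coordGL2"
          by (cases q; cases p'; cases q'; cases p'') (simp_all add: koszul_def)
        then show ?case
          by (simp only: tensor_times_homogeneous[OF xy(2) xy'(1)] tensor_times_homogeneous[OF xy'(2) tensor(1)]
              coordGL2_koszul_mult
              tensor_times_homogeneous[OF coordGL_part_mult_homogeneous[OF xy(2) xy'(2)] tensor(1)]
              tensor_times_homogeneous[OF xy(2) coordGL_part_mult_homogeneous[OF xy'(1) tensor(1)]] mult.assoc)
      qed (simp add: coordGL2_distrib_left)
    qed (simp add: coordGL2_distrib_left coordGL2_distrib_right)
  qed (simp add: coordGL2_distrib_right)
  show "(0 :: ('a, 'b, 'c) coordGL2) \<noteq> 1"
  proof
    assume 0: "(0 :: ('a, 'b, 'c) coordGL2) = 1"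
    have m: "module ((*) :: 'a \<Rightarrow> 'a \<Rightarrow> 'a)" by standard (simp_all add: algebra_simps)
    have h: "coordGL_counit (x + y) = coordGL_counit x + coordGL_counit y"
      "coordGL_counit (coordGL_scale k x) = k * coordGL_counit x"
      "coordGL_counit (1 :: ('a, 'b, 'c) coordGL) = 1" for x y :: "('a, 'b, 'c) coordGL" and k
      using coordGL_counit_hom[where ?'k = 'a and ?'m = 'b and ?'n = 'c]
      unfolding superalgebra_hom_def even_linear_def module_hom_def module_hom_axioms_def by blast+
    define \<beta> where "\<beta> = (\<lambda>(x :: ('a, 'b, 'c) coordGL) (y :: ('a, 'b, 'c) coordGL). coordGL_counit x * coordGL_counit y)"
    have b: "bilinear_map (*) \<beta>"
      by (rule bilinear_mapI[OF m]) (simp_all add: \<beta>_def h algebra_simps)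
    have "tensor_lift (*) \<beta> (1 \<otimes> 1) = 1"
      by (simp only: tensor_lift_tensor[OF m b]) (simp add: \<beta>_def h)
    moreover have "tensor_lift (*) \<beta> 0 = 0"
      using tensor_lift_add[OF m b, of 0 0] by (simp only: add_0_left add_cancel_right_right)
    ultimately show False using 0 by (simp add: one_coordGL2_def)
  qed
qed

end

definition coordGL2_part ::
  "bit \<Rightarrow> ('k::field, 'm::{finite, linorder}, 'n::{finite, linorder}) coordGL2 \<Rightarrow> ('k, 'm, 'n) coordGL2" where
  "coordGL2_part p =
     tensor_lift coordGL2_scale (\<lambda>x y. \<Sum>q\<in>{0, 1}. coordGL_part q x \<otimes> coordGL_part (p + q) y)"

lemma coordGL2_part_tensor:
  "coordGL2_part p (x \<otimes> y) = (\<Sum>q\<in>{0, 1}. coordGL_part q x \<otimes> coordGL_part (p + q) y)"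
  unfolding coordGL2_part_def
  by (rule tensor_lift_tensor[OF module_coordGL2 bilinear_mapI[OF module_coordGL2]])
    (simp_all only: coordGL_part_add coordGL_part_scale tensor_add_left tensor_add_right sum.distrib
      tensor_scale_left tensor_scale_right module.scale_sum_right[OF module_coordGL2])


section \<open>The Hopf structure and the coadjoint invariants\<close>

definition is_comultiplication ::
  "(('k::field, 'm::{finite, linorder}, 'n::{finite, linorder}) coordGL \<Rightarrow> ('k, 'm, 'n) coordGL2) \<Rightarrow> bool" where
  "is_comultiplication \<delta> \<longleftrightarrow>
     superalgebra_hom coordGL_scale coordGL_part coordGL2_scale coordGL2_part \<delta> \<and>
     (\<forall>i j. \<delta> (coordGL_var i j) = (\<Sum>t\<in>UNIV. coordGL_var i t \<otimes> coordGL_var t j))"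

text \<open>The antipode is the convolution inverse of the identity.\<close>

definition is_antipode ::
  "(('k::field, 'm::{finite, linorder}, 'n::{finite, linorder}) coordGL \<Rightarrow> ('k, 'm, 'n) coordGL2) \<Rightarrow>
   (('k, 'm, 'n) coordGL \<Rightarrow> ('k, 'm, 'n) coordGL) \<Rightarrow> bool" where
  "is_antipode \<delta> s \<longleftrightarrow>
     even_linear coordGL_scale coordGL_part coordGL_scale coordGL_part s \<and>
     (\<forall>f. tensor_lift coordGL_scale (\<lambda>x y. s x * y) (\<delta> f) = coordGL_scale (coordGL_counit f) 1) \<and>
     (\<forall>f. tensor_lift coordGL_scale (\<lambda>x y. x * s y) (\<delta> f) = coordGL_scale (coordGL_counit f) 1)"

text \<open>
  \<open>f \<mapsto> \<Sum> (-1)\<^bsup>|f\<^sub>1||f\<^sub>2|\<^esup> f\<^sub>2 \<otimes> s(f\<^sub>1) f\<^sub>3\<close>, where \<open>\<Sum> f\<^sub>1 \<otimes> f\<^sub>2 \<otimes> f\<^sub>3 = (\<delta> \<otimes> id) (\<delta> f)\<close>: below, \<open>u \<otimes> z\<close> runs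
  through \<open>\<delta> f\<close>, \<open>x \<otimes> y\<close> through \<open>\<delta> u\<close>, and \<open>f\<^sub>1\<close>, \<open>f\<^sub>2\<close> are the homogeneous components of \<open>x\<close>, \<open>y\<close>, and \<open>f\<^sub>3 = z\<close>.
\<close>

definition coadjoint ::
  "(('k::field, 'm::{finite, linorder}, 'n::{finite, linorder}) coordGL \<Rightarrow> ('k, 'm, 'n) coordGL2) \<Rightarrow>
   (('k, 'm, 'n) coordGL \<Rightarrow> ('k, 'm, 'n) coordGL) \<Rightarrow> ('k, 'm, 'n) coordGL \<Rightarrow> ('k, 'm, 'n) coordGL2" where
  "coadjoint \<delta> s f =
     tensor_lift coordGL2_scale
       (\<lambda>u z. tensor_lift coordGL2_scale
          (\<lambda>x y. \<Sum>p\<in>{0, 1}. \<Sum>q\<in>{0, 1}.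
             koszul p q (coordGL_part q y \<otimes> (s (coordGL_part p x) * z)))
          (\<delta> u))
       (\<delta> f)"

definition coadjoint_invariants ::
  "(('k::field, 'm::{finite, linorder}, 'n::{finite, linorder}) coordGL \<Rightarrow> ('k, 'm, 'n) coordGL2) \<Rightarrow>
   (('k, 'm, 'n) coordGL \<Rightarrow> ('k, 'm, 'n) coordGL) \<Rightarrow> ('k, 'm, 'n) coordGL set" where
  "coadjoint_invariants \<delta> s = {f. coadjoint \<delta> s f = f \<otimes> 1}"


section \<open>Laurent polynomials\<close>

text \<open>The group algebra of the free abelian group on the index set; multiplication is convolution.\<close>

type_synonym ('k, 'm, 'n) laurent = "('m + 'n \<Rightarrow>\<^sub>0 int) \<Rightarrow>\<^sub>0 'k"

definition laurent_var :: "'m + 'n \<Rightarrow> ('k::field, 'm, 'n) laurent" where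
  "laurent_var i = Poly_Mapping.single (Poly_Mapping.single i 1) 1"

definition laurent_scale :: "'k::field \<Rightarrow> ('k, 'm, 'n) laurent \<Rightarrow> ('k, 'm, 'n) laurent" where
  "laurent_scale k = Poly_Mapping.map ((*) k)"

lemma module_laurent: "module (laurent_scale :: 'k::field \<Rightarrow> ('k, 'm, 'n) laurent \<Rightarrow> _)"
  unfolding laurent_scale_def[abs_def] by (rule module_map_times)

end

theory Submission
  imports Defs "HOL-Computational_Algebra.Formal_Power_Series"
begin

text \<open>
  Call a superalgebra homomorphism from the coordinate superalgebra to a supercommutative algebra \<open>B\<close> a
  \<open>B\<close>-point; it is the same thing as an invertible supermatrix over \<open>B\<close>.  A coadjoint invariant takes the
  same value at a point \<open>T\<close> and at its conjugate \<open>g\<inverse> T g\<close> by any point \<open>g\<close> (\<open>invariant_conjugation\<close>).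
  Evaluation at a diagonal \<open>T\<close> only sees the image under \<open>\<phi>\<close> (\<open>diagonal_point_factors\<close>), so an
  invariant in the kernel of \<open>\<phi>\<close> vanishes at every conjugate of every diagonal point.  It remains to find one
  such conjugate which is so generic that no nonzero function vanishes there.

  Let \<open>C = (c\<^bsub>ij\<^esub>)\<close> be the matrix of generators of the free commutative superalgebra, and let \<open>B\<close> consist of
  the power series in \<open>z\<close> over that algebra.  As the ground field is infinite, there are distinct nonzero scalars
  \<open>v\<^bsub>i\<^esub>\<close>; put \<open>V = diag(v\<^bsub>i\<^esub>)\<close>, \<open>T = diag(v\<^bsub>i\<^esub> + z c\<^bsub>ii\<^esub>)\<close> and \<open>g = 1 + z X\<close>, where
  \<open>X\<^bsub>ij\<^esub> = c\<^bsub>ij\<^esub> / (v\<^bsub>i\<^esub> - v\<^bsub>j\<^esub>)\<close> off the diagonal and \<open>X\<^bsub>ii\<^esub> = 0\<close>.  The commutator \<open>V X - X V\<close> is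
  the off-diagonal part of \<open>C\<close>, so \<open>g\<inverse> T g = V + z C + O(z\<^sup>2)\<close>.  After the translation by \<open>V\<close>,
  evaluation at this point becomes a substitution \<open>c\<^bsub>ij\<^esub> \<mapsto> z c\<^bsub>ij\<^esub> + O(z\<^sup>2)\<close>.  It sends a nonzero element
  whose lowest homogeneous component has degree \<open>d\<close> to \<open>z\<^sup>d\<close> times that component plus higher powers of \<open>z\<close>,
  hence is injective (\<open>tangent_identity_injective\<close>, \<open>shifted_tangent_identity_injective\<close>).

  Products of points are convolutions.  Testing the coadjoint coaction of \<open>f\<close> against \<open>T\<close> and \<open>g\<close> gives
  \<open>((g \<circ> s) * T) * g\<close> evaluated at \<open>f\<close>.  The antipode \<open>s\<close> is only given as a linear map that is a convolution inverse
  of the identity, so it has to be shown that \<open>g \<circ> s\<close> is the point of the inverse matrix (\<open>antipode_point\<close>).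
  This follows from \<open>(a * g) * g\<inverse> = a\<close> for linear maps \<open>a\<close> (\<open>conv_cancel_right\<close>).
\<close>

section \<open>Supercommutative algebras\<close>

locale supercommutative_algebra = module sc for sc :: "'k::field \<Rightarrow> 'b::ring_1 \<Rightarrow> 'b" +
  fixes part :: "bit \<Rightarrow> 'b \<Rightarrow> 'b"
  assumes sc_mult_left: "sc k x * y = sc k (x * y)"
    and sc_mult_right: "x * sc k y = sc k (x * y)"
    and part_add: "part p (x + y) = part p x + part p y"
    and part_scale: "part p (sc k x) = sc k (part p x)"
    and part_sum: "part 0 x + part 1 x = x"
    and part_part: "part p (part q x) = (if p = q then part p x else 0)"
    and part_mult: "part p x = x \<Longrightarrow> part q y = y \<Longrightarrow> part (p + q) (x * y) = x * y"
    and part_one: "part 0 1 = 1"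
    and supercomm: "part p x = x \<Longrightarrow> part q y = y \<Longrightarrow> x * y = koszul p q (y * x)"
    and odd_square: "part 1 x = x \<Longrightarrow> x * x = 0"
begin

lemma part_zero [simp]: "part p 0 = 0"
  using part_add[of p 0 0] by simp

lemma part_minus: "part p (- x) = - part p x"
  using part_add[of p x "- x"] by (simp add: eq_neg_iff_add_eq_0 add.commute)

lemma part_setsum: "part p (sum f A) = (\<Sum>i\<in>A. part p (f i))"
  by (induction A rule: infinite_finite_induct) (auto simp: part_add)

lemma part_homogeneous: "part q x = x \<Longrightarrow> part p x = (if p = q then x else 0)"
  using part_part[of p q x] by auto

lemma even_central: "part 0 x = x \<Longrightarrow> x * y = y * x"
proof -
  assume x: "part 0 x = x"
  have "x * part p y = part p y * x" for p
    using supercomm[OF x, of p "part p y"] part_part[of p p y] by simp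
  then have "x * (part 0 y + part 1 y) = (part 0 y + part 1 y) * x"
    by (simp only: distrib_left distrib_right)
  then show ?thesis by (simp only: part_sum)
qed

lemma part_even_mult:
  assumes x: "part 0 x = x"
  shows "part p (x * y) = x * part p y"
proof -
  have "part q (x * part q y) = x * part q y" for q
    using part_mult[OF x, of q "part q y"] by (simp only: part_part if_True add_0_left refl)
  then have "part p (x * part q y) = (if p = q then x * part q y else 0)" for q
    by (rule part_homogeneous)
  then have "part p (x * (part 0 y + part 1 y)) = x * part p y"
    by (cases p) (simp_all add: distrib_left part_add)
  then show ?thesis by (simp only: part_sum)
qed

lemma superalgebra_homI:
  assumes "module scA" "\<And>x y. f (x + y) = f x + f y" "\<And>k x. f (scA k x) = sc k (f x)"
    "\<And>p x. f (partA p x) = part p (f x)" "f 1 = 1" "\<And>x y. f (x * y) = f x * f y"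
  shows "superalgebra_hom scA partA sc part f"
  using assms module_axioms
  unfolding superalgebra_hom_def even_linear_def module_hom_def module_hom_axioms_def by blast

end

lemma superalgebra_homD:
  assumes "superalgebra_hom scA partA scB partB f"
  shows superalgebra_hom_add: "f (x + y) = f x + f y"
    and superalgebra_hom_scale: "f (scA k x) = scB k (f x)"
    and superalgebra_hom_part: "f (partA p x) = partB p (f x)"
    and superalgebra_hom_one: "f 1 = 1"
    and superalgebra_hom_mult: "f (x * y) = f x * f y"
    and superalgebra_hom_linear: "module_hom scA scB f"
  using assms
  unfolding superalgebra_hom_def even_linear_def module_hom_def module_hom_axioms_def by blast+


section \<open>The universal property of the free commutative superalgebra\<close>

definition sfree_scale :: "'k::field \<Rightarrow> ('k, 'm, 'n) sfree \<Rightarrow> ('k, 'm, 'n) sfree" where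
  "sfree_scale k x = sconst k * x"

lemma module_sfree: "module sfree_scale"
  by standard (simp_all add: sfree_scale_def algebra_simps sconst_add sconst_mult)

lemma sfree_word_induct [case_names one var scale add]:
  fixes x :: "('k::field, 'm, 'n) sfree"
  assumes one: "P 1" and var: "\<And>i x. P x \<Longrightarrow> P (svar i * x)"
    and scale: "\<And>k x. P x \<Longrightarrow> P (sfree_scale k x)" and add: "\<And>x y. P x \<Longrightarrow> P y \<Longrightarrow> P (x + y)"
  shows "P x"
proof (induction x rule: sfree_span_induct)
  case (word c w)
  have "P (sword (FMon xs))" for xs
    by (induction xs) (simp_all add: one var sword_Cons)
  then show ?case using scale[of "sword w" c] by (cases w) (simp add: sfree_scale_def)
qed (rule add)

context supercommutative_algebra
begin

definition free_eval :: "('x \<Rightarrow> 'b) \<Rightarrow> ('x fmon \<Rightarrow>\<^sub>0 'k) \<Rightarrow> 'b" where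
  "free_eval b f = (\<Sum>w\<in>Poly_Mapping.keys f. sc (Poly_Mapping.lookup f w) (prod_list (map b (letters w))))"

lemma free_eval_add: "free_eval b (f + g) = free_eval b f + free_eval b g"
  unfolding free_eval_def by (rule setsum_keys_plus_distrib) (simp_all add: scale_left_distrib)

lemma free_eval_single [simp]: "free_eval b (Poly_Mapping.single w c) = sc c (prod_list (map b (letters w)))"
  by (simp add: free_eval_def)

lemma free_eval_mult: "free_eval b (f * g) = free_eval b f * free_eval b g"
proof (induction f rule: poly_mapping_span_induct)
  case (single u c)
  show ?case
  proof (induction g rule: poly_mapping_span_induct)
    case (single v d)
    show ?case by (simp add: mult_single sc_mult_left sc_mult_right mult.commute)
  qed (simp add: free_eval_add distrib_left)
qed (simp add: free_eval_add distrib_right)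

lemma free_eval_diff: "free_eval b (f - g) = free_eval b f - free_eval b g"
  using free_eval_add[of b "f - g" g] by simp

lemma free_eval_koszul: "free_eval b (koszul p q f) = koszul p q (free_eval b f)"
  using free_eval_diff[of b 0 f] by (simp add: koszul_def free_eval_def)

definition homogeneous_matrix :: "(('m, 'n) gen \<Rightarrow> 'b) \<Rightarrow> bool" where
  "homogeneous_matrix b \<longleftrightarrow> (\<forall>x. part (gpar x) (b x) = b x)"

lemma homogeneous_matrixD: "homogeneous_matrix b \<Longrightarrow> part (gpar x) (b x) = b x"
  unfolding homogeneous_matrix_def by blast

lemma free_eval_sc_ideal:
  assumes b: "homogeneous_matrix b" and f: "f \<in> sc_ideal"
  shows "free_eval b f = 0"
  using f
proof (induction rule: sc_ideal.induct)
  case (comm x y)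
  show ?case
    using supercomm[OF homogeneous_matrixD[OF b] homogeneous_matrixD[OF b], of x y]
    by (simp add: free_eval_diff free_eval_koszul free_eval_mult)
next
  case (sq x)
  then show ?case
    using odd_square[of "b x"] homogeneous_matrixD[OF b, of x] by (simp add: free_eval_mult)
qed (simp_all add: free_eval_add free_eval_mult)

definition sfree_eval :: "(('m, 'n) gen \<Rightarrow> 'b) \<Rightarrow> ('k, 'm, 'n) sfree \<Rightarrow> 'b" where
  "sfree_eval b x = free_eval b (rep_sfree x)"

lemma sfree_eval_abs:
  assumes "homogeneous_matrix b"
  shows "sfree_eval b (abs_sfree f) = free_eval b f"
proof -
  have "rep_sfree (abs_sfree f) - f \<in> sc_ideal"
    using Quotient3_rep_abs[OF Quotient3_sfree, of f] by simp
  from free_eval_sc_ideal[OF assms this] show ?thesis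
    by (simp add: sfree_eval_def free_eval_diff)
qed

lemma sfree_eval_svar: "homogeneous_matrix b \<Longrightarrow> sfree_eval b (svar x) = b x"
  by (simp add: svar.abs_eq sfree_eval_abs)

lemma sfree_eval_hom:
  assumes b: "homogeneous_matrix (b :: ('m, 'n) gen \<Rightarrow> 'b)"
  shows "superalgebra_hom sfree_scale spart sc part (sfree_eval b)"
proof (rule superalgebra_homI[OF module_sfree])
  show add: "sfree_eval b (x + y) = sfree_eval b x + sfree_eval b y" for x y :: "('k, 'm, 'n) sfree"
    by (induction x rule: sfree.abs_induct; induction y rule: sfree.abs_induct)
      (simp add: plus_sfree.abs_eq sfree_eval_abs[OF b] free_eval_add)
  show mult: "sfree_eval b (x * y) = sfree_eval b x * sfree_eval b y" for x y :: "('k, 'm, 'n) sfree"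
    by (induction x rule: sfree.abs_induct; induction y rule: sfree.abs_induct)
      (simp add: times_sfree.abs_eq sfree_eval_abs[OF b] free_eval_mult)
  have const: "sfree_eval b (sconst k :: ('k, 'm, 'n) sfree) = sc k 1" for k
    by (simp add: sconst.abs_eq sfree_eval_abs[OF b])
  show one: "sfree_eval b 1 = 1"
    using const[of 1] by simp
  show scale: "sfree_eval b (sfree_scale k x) = sc k (sfree_eval b x)" for k and x :: "('k, 'm, 'n) sfree"
    by (simp add: sfree_scale_def mult const sc_mult_left)
  have zero: "sfree_eval b (0 :: ('k, 'm, 'n) sfree) = 0"
    using add[of 0 0] by simp
  show "sfree_eval b (spart p x) = part p (sfree_eval b x)" for p and x :: "('k, 'm, 'n) sfree"
  proof (induction x rule: sfree_span_induct)
    case (word c w)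
    have "part (wpar (FMon xs)) (sfree_eval b (sword (FMon xs) :: ('k, 'm, 'n) sfree)) =
        sfree_eval b (sword (FMon xs) :: ('k, 'm, 'n) sfree)" for xs :: "('m, 'n) gen list"
    proof (induction xs)
      case Nil
      then show ?case by (simp add: wpar_def one part_one)
    next
      case (Cons x xs)
      have "part (gpar x) (sfree_eval b (svar x :: ('k, 'm, 'n) sfree)) = sfree_eval b (svar x :: ('k, 'm, 'n) sfree)"
        by (simp only: sfree_eval_svar[OF b] homogeneous_matrixD[OF b])
      moreover have "wpar (FMon (x # xs)) = gpar x + wpar (FMon xs)"
        unfolding wpar_def fmon.sel list.map sum_list.Cons ..
      ultimately show ?case unfolding sword_Cons mult by (simp only: part_mult Cons.IH)
    qed
    from part_homogeneous[OF this[of "letters w"], of p]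
    have "part p (sfree_eval b (sword w :: ('k, 'm, 'n) sfree)) = (if p = wpar w then sfree_eval b (sword w :: ('k, 'm, 'n) sfree) else 0)"
      by simp
    then show ?case
      using scale[of c "sword w"]
      by (auto simp: spart_const_mult part_scale zero sfree_scale_def)
  qed (simp add: spart_add add part_add)
qed

lemma sfree_hom_eqI:
  assumes F: "superalgebra_hom sfree_scale spart sc part F"
    and G: "superalgebra_hom sfree_scale spart sc part G"
    and var: "\<And>x. F (svar x) = G (svar x)"
  shows "F x = G x"
  by (induction x rule: sfree_word_induct) (simp_all add: superalgebra_homD[OF F] superalgebra_homD[OF G] var)

end


section \<open>The universal property of the coordinate superalgebra\<close>

text \<open>
  Closure under inverses accounts for the denominators: a fraction is a numerator times the inverse of another
  numerator.
\<close>

lemma coordGL_generated_induct [case_names one var scale add mult inverse]: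
  fixes x :: "('k::field, 'm::{finite, linorder}, 'n::{finite, linorder}) coordGL"
  assumes one: "P 1" and var: "\<And>i j. P (coordGL_var i j)"
    and scale: "\<And>k x. P x \<Longrightarrow> P (coordGL_scale k x)" and add: "\<And>x y. P x \<Longrightarrow> P y \<Longrightarrow> P (x + y)"
    and mult: "\<And>x y. P x \<Longrightarrow> P y \<Longrightarrow> P (x * y)"
    and inverse: "\<And>x y. P x \<Longrightarrow> x * y = 1 \<Longrightarrow> y * x = 1 \<Longrightarrow> P y"
  shows "P x"
proof -
  have num: "P (loc_frac f 1)" for f
  proof (induction f rule: sfree_word_induct)
    case one
    show ?case using \<open>P 1\<close> by (simp add: one_coordGL_def)
  next
    case (var x f)
    have "loc_frac (svar x * f) 1 = coordGL_var (fst x) (snd x) * loc_frac f 1"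
      by (simp add: coordGL_var_def loc_frac_mult)
    then show ?case using mult[OF \<open>P (coordGL_var (fst x) (snd x))\<close> var] by simp
  next
    case (scale k f)
    then show ?case using \<open>P (loc_frac f 1) \<Longrightarrow> P (coordGL_scale k (loc_frac f 1))\<close>
      by (simp add: sfree_scale_def coordGL_scale_def loc_frac_mult)
  next
    case (add f g)
    then show ?case using \<open>P (loc_frac f 1) \<Longrightarrow> P (loc_frac g 1) \<Longrightarrow> P (loc_frac f 1 + loc_frac g 1)\<close>
      by (simp add: loc_frac_add)
  qed
  obtain f s where x: "x = loc_frac f s" and s: "s \<in> loc_set" by (cases x rule: coordGL_cases)
  have inv: "loc_frac s 1 * loc_frac 1 s = 1" "loc_frac 1 s * loc_frac s 1 = 1"
    unfolding one_coordGL_def loc_frac_mult[OF loc_one s] loc_frac_mult[OF s loc_one]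
    using s by (auto intro: loc_frac_eqI)
  have "x = loc_frac f 1 * loc_frac 1 s"
    using s by (simp add: x loc_frac_mult)
  then show ?thesis using mult[OF num inverse[OF num inv]] by simp
qed

context supercommutative_algebra
begin

abbreviation point ::
  "(('k, 'm::{finite, linorder}, 'n::{finite, linorder}) coordGL \<Rightarrow> 'b) \<Rightarrow> bool" where
  "point F \<equiv> superalgebra_hom coordGL_scale coordGL_part sc part F"

lemma point_eqI:
  assumes F: "point F" and G: "point G" and var: "\<And>i j. F (coordGL_var i j) = G (coordGL_var i j)"
  shows "F x = G x"
proof (induction x rule: coordGL_generated_induct)
  case (inverse x y)
  have "F y * F x = 1" "G x * G y = 1"
    using superalgebra_hom_mult[OF F, of y x] superalgebra_hom_mult[OF G, of x y] inverse
    by (simp_all add: superalgebra_homD[OF F] superalgebra_homD[OF G])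
  then have "F y = F y * (G x * G y)" by simp
  also have "\<dots> = F y * F x * G y" by (simp add: inverse mult.assoc)
  finally show ?case using \<open>F y * F x = 1\<close> by simp
qed (simp_all add: superalgebra_homD[OF F] superalgebra_homD[OF G] var)

text \<open>
  The images of the denominators are even, hence central, so the usual extension of a homomorphism to a localization
  works in the noncommutative target as well.
\<close>

lemma point_exists:
  fixes b :: "('m::{finite, linorder}, 'n::{finite, linorder}) gen \<Rightarrow> 'b"
  assumes b: "homogeneous_matrix b"
    and inv1: "d1 * sfree_eval b (block_det Inl) = 1"
    and inv2: "d2 * sfree_eval b (block_det Inr) = 1"
  obtains F where "point F" "\<And>i j. F (coordGL_var i j) = b (i, j)"
proof -
  let ?E = "sfree_eval b"
  note E = superalgebra_homD[OF sfree_eval_hom[OF b]]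
  have cent: "?E s * y = y * ?E s" if "s \<in> loc_set" for s y
  proof (rule even_central)
    have "spart 0 s = s" using loc_set_seven[OF that] by (simp add: seven_def)
    then show "part 0 (?E s) = ?E s" using E(3)[of 0 s] by simp
  qed
  have pow: "d1 ^ k * ?E (block_det Inl ^ k) = 1" "d2 ^ k * ?E (block_det Inr ^ k) = 1" for k
  proof -
    have "d ^ k * ?E (u ^ k) = 1" if "d * ?E u = 1" for d u
    proof (induction k)
      case (Suc k)
      have "d ^ Suc k * ?E (u ^ Suc k) = d ^ k * (d * ?E u) * ?E (u ^ k)"
        by (simp only: power_Suc[of u] power_Suc2[of d] E mult.assoc)
      then show ?case using Suc that by simp
    qed (simp add: E)
    then show "d1 ^ k * ?E (block_det Inl ^ k) = 1" "d2 ^ k * ?E (block_det Inr ^ k) = 1"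
      using inv1 inv2 by blast+
  qed
  have unit: "\<exists>v. v * ?E s = 1" if s: "s \<in> loc_set" for s
  proof -
    obtain k l where "s = block_det Inl ^ k * block_det Inr ^ l" using s unfolding loc_set_def by blast
    then have "d2 ^ l * d1 ^ k * ?E s = d2 ^ l * (d1 ^ k * ?E (block_det Inl ^ k)) * ?E (block_det Inr ^ l)"
      by (simp add: E mult.assoc)
    then show ?thesis by (auto simp: pow)
  qed
  define iv where "iv = (\<lambda>s. SOME v. v * ?E s = 1)"
  have iv: "iv s * ?E s = 1" "?E s * iv s = 1" if "s \<in> loc_set" for s
    using someI_ex[OF unit[OF that]] cent[OF that, of "iv s"] by (simp_all add: iv_def)
  have cancel: "x = y" if "?E s * x = ?E s * y" "s \<in> loc_set" for s x y
    using arg_cong[OF that(1), of "\<lambda>z. iv s * z"] iv[OF that(2)] by (simp flip: mult.assoc)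
  have ivc: "iv s * y = y * iv s" if "s \<in> loc_set" for s y
    by (rule cancel[OF _ that])
      (metis cent[OF that] iv[OF that] mult.assoc mult_1_left mult_1_right)
  have wd: "?E f * iv s = ?E g * iv t" if eq: "loc_frac f s = loc_frac g t" and st: "s \<in> loc_set" "t \<in> loc_set" for f g s t
  proof -
    obtain u where u: "u \<in> loc_set" "u * (t * f) = u * (s * g)"
      using eq unfolding loc_frac_eq_iff[OF st] by blast
    have "?E u * (?E t * ?E f) = ?E u * (?E s * ?E g)"
      using arg_cong[OF u(2), of ?E] by (simp only: E)
    from cancel[OF this u(1)] have tf: "?E t * ?E f = ?E s * ?E g" .
    have "?E f * iv s = iv t * ?E t * ?E f * iv s"
      by (simp add: iv st)
    also have "\<dots> = iv t * (?E t * ?E f) * iv s"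
      by (simp only: mult.assoc)
    also have "\<dots> = iv t * (?E g * ?E s) * iv s"
      by (simp only: tf cent[OF st(1), of "?E g"])
    also have "\<dots> = iv t * ?E g * (?E s * iv s)"
      by (simp only: mult.assoc)
    also have "\<dots> = ?E g * iv t"
      by (simp add: iv st ivc[OF st(2), of "?E g"])
    finally show ?thesis .
  qed
  define F where "F = (\<lambda>x. let (f, s) = (SOME z. snd z \<in> loc_set \<and> x = loc_frac (fst z) (snd z)) in ?E f * iv s)"
  have F: "F (loc_frac f s) = ?E f * iv s" if "s \<in> loc_set" for f s
  proof -
    have "\<exists>z. snd z \<in> loc_set \<and> loc_frac f s = loc_frac (fst z) (snd z)" using that by force
    from someI_ex[OF this] show ?thesis
      unfolding F_def using wd[OF _ _ that] by (auto simp: Let_def split: prod.splits)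
  qed
  have iv_mult: "iv (s * t) = iv s * iv t" if "s \<in> loc_set" "t \<in> loc_set" for s t
  proof (rule cancel[OF _ loc_mult[OF that]])
    have "?E (s * t) * (iv s * iv t) = ?E s * (?E t * iv s) * iv t"
      by (simp only: E mult.assoc)
    also have "\<dots> = ?E s * iv s * (?E t * iv t)"
      by (simp only: ivc[OF that(1), of "?E t", symmetric] mult.assoc)
    finally have "?E (s * t) * (iv s * iv t) = ?E s * iv s * (?E t * iv t)" .
    then show "?E (s * t) * iv (s * t) = ?E (s * t) * (iv s * iv t)" using iv that by simp
  qed
  have iv1: "iv 1 = 1" using iv[of 1] by (simp add: E)
  have iv_even: "part 0 (iv s) = iv s" if "s \<in> loc_set" for s
  proof -
    have s0: "part 0 (?E s) = ?E s"
      using loc_set_seven[OF that] E(3)[of 0 s] by (simp add: seven_def)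
    show ?thesis
    proof (rule cancel[OF _ that])
      show "?E s * part 0 (iv s) = ?E s * iv s"
        using part_even_mult[OF s0, of 0 "iv s"] iv that part_one by simp
    qed
  qed
  have "point F"
  proof (rule superalgebra_homI[OF module_coordGL])
    fix x y :: "('k, 'm, 'n) coordGL" and k p
    obtain f s where x: "x = loc_frac f s" "s \<in> loc_set" by (cases x rule: coordGL_cases)
    obtain g t where y: "y = loc_frac g t" "t \<in> loc_set" by (cases y rule: coordGL_cases)
    have "?E f * ?E g * (iv s * iv t) = ?E f * (?E g * iv s) * iv t"
      by (simp only: mult.assoc)
    also have "\<dots> = ?E f * iv s * (?E g * iv t)"
      by (simp only: ivc[OF x(2), of "?E g", symmetric] mult.assoc)
    finally show "F (x * y) = F x * F y"
      unfolding x(1) y(1) by (simp add: loc_frac_mult x(2) y(2) F E iv_mult)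
    have "?E f * ?E t * (iv s * iv t) = ?E f * (?E t * iv t) * iv s"
      by (simp only: ivc[OF x(2), of "iv t"] mult.assoc)
    moreover have "?E g * ?E s * (iv s * iv t) = ?E g * (?E s * iv s) * iv t"
      by (simp only: mult.assoc)
    ultimately have "?E f * ?E t * (iv s * iv t) = ?E f * iv s" "?E g * ?E s * (iv s * iv t) = ?E g * iv t"
      by (simp_all only: iv[OF x(2)] iv[OF y(2)] mult_1_right)
    then show "F (x + y) = F x + F y"
      unfolding x(1) y(1) by (simp add: loc_frac_add x(2) y(2) F E iv_mult distrib_right)
    show "F (coordGL_scale k x) = sc k (F x)"
      using E(2)[of k f] unfolding x(1)
      by (simp add: coordGL_scale_def loc_frac_mult x(2) F sfree_scale_def sc_mult_left)
    show "F (coordGL_part p x) = part p (F x)"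
      using part_even_mult[OF iv_even[OF x(2)], of p "?E f"]
      unfolding x(1) by (simp add: loc_frac_part x(2) F E ivc)
  qed (simp add: one_coordGL_def F E iv1)
  then show ?thesis
    by (rule that) (simp_all add: coordGL_var_def F iv1 sfree_eval_svar[OF b])
qed

end


section \<open>Power series over a supercommutative algebra\<close>

unbundle fps_syntax

text \<open>
  In characteristic 2 this does not follow from supercommutativity.  An odd word contains an odd letter, whose
  square is zero; the mixed terms in the square of a sum cancel in pairs.
\<close>

lemma sfree_odd_square: "spart 1 x = x \<Longrightarrow> x * x = (0 :: ('k::field, 'm, 'n) sfree)"
proof -
  have "spart 1 x * spart 1 x = 0" for x :: "('k, 'm, 'n) sfree"
  proof (induction x rule: sfree_span_induct)
    case (word c w)
    have "(sword (FMon xs) :: ('k, 'm, 'n) sfree) * sword (FMon xs) = 0" if "wpar (FMon xs) = 1" for xs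
      using that
    proof (induction xs)
      case (Cons x xs)
      let ?x = "svar x :: ('k, 'm, 'n) sfree" and ?w = "sword (FMon xs) :: ('k, 'm, 'n) sfree"
      have par: "gpar x + wpar (FMon xs) = 1"
        using Cons.prems unfolding wpar_def fmon.sel list.map sum_list.Cons .
      have "?w * ?x = koszul (wpar (FMon xs)) (gpar x) (?x * ?w)"
        using sword_supercomm[of xs "[x]"]
        by (simp only: sword_Cons sword_Nil wpar_def fmon.sel list.map sum_list.Cons sum_list.Nil
            add_0_right mult_1_right)
      then have "sword (FMon (x # xs)) * sword (FMon (x # xs)) =
          koszul (wpar (FMon xs)) (gpar x) (?x * ?x * (?w * ?w))"
        by (simp add: sword_Cons mult.assoc koszul_mult flip: mult.assoc[of ?w ?x])
      moreover have "?x * ?x * (?w * ?w) = 0"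
      proof (cases "gpar x = 1")
        case True
        show ?thesis unfolding svar_odd_square[OF True] by simp
      next
        case False
        then have "?w * ?w = 0" using par by (intro Cons.IH) (cases "gpar x"; simp)
        then show ?thesis by simp
      qed
      ultimately show ?case by (simp add: koszul_def)
    qed (simp add: wpar_def)
    from this[of "letters w"] have "wpar w = 1 \<Longrightarrow> (sword w :: ('k, 'm, 'n) sfree) * sword w = 0" by simp
    moreover have "sconst c * sword w * (sconst c * sword w) = sconst c * (sconst c * ((sword w :: ('k, 'm, 'n) sfree) * sword w))"
      by (simp only: mult.assoc sconst_left[of "sword w"])
    ultimately show ?case
      by (cases "wpar w = 1") (simp_all add: spart_const_mult)
  next
    case (add x y)
    have "spart 1 x * spart 1 y = - (spart 1 y * spart 1 x)"
      using sfree_supercomm[of 1 x 1 y] by (simp add: koszul_def)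
    with add show ?case by (simp add: spart_add algebra_simps)
  qed
  then show "spart 1 x = x \<Longrightarrow> x * x = 0" by metis
qed

lemma supercommutative_sfree: "supercommutative_algebra sfree_scale (spart :: bit \<Rightarrow> ('k::field, 'm, 'n) sfree \<Rightarrow> _)"
proof (intro supercommutative_algebra.intro supercommutative_algebra_axioms.intro module_sfree)
  fix k p q and x y :: "('k, 'm, 'n) sfree"
  show "sfree_scale k x * y = sfree_scale k (x * y)" "x * sfree_scale k y = sfree_scale k (x * y)"
    by (simp_all add: sfree_scale_def mult.assoc sconst_left)
  show "spart p (sfree_scale k x) = sfree_scale k (spart p x)"
    by (simp add: sfree_scale_def spart_const_mult)
  show "spart (p + q) (x * y) = x * y" if x: "spart p x = x" and y: "spart q y = y"
  proof -
    have "spart r x = (if r = p then x else 0)" "spart r y = (if r = q then y else 0)" for r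
      using spart_spart[of r p x] spart_spart[of r q y] x y by auto
    then show ?thesis unfolding spart_mult by (cases p; cases q) simp_all
  qed
  show "x * y = koszul p q (y * x)" if "spart p x = x" "spart q y = y"
    using sfree_supercomm[of p x q y] that by simp
qed (simp_all add: spart_add spart_sum spart_spart sfree_odd_square)

interpretation sfree: supercommutative_algebra sfree_scale spart
  by (rule supercommutative_sfree)

definition fps_scale :: "('k \<Rightarrow> 'b \<Rightarrow> 'b) \<Rightarrow> 'k \<Rightarrow> 'b fps \<Rightarrow> 'b fps" where
  "fps_scale sc k f = Abs_fps (\<lambda>n. sc k (f $ n))"

definition fps_part :: "(bit \<Rightarrow> 'b \<Rightarrow> 'b) \<Rightarrow> bit \<Rightarrow> 'b fps \<Rightarrow> 'b fps" where
  "fps_part part p f = Abs_fps (\<lambda>n. part p (f $ n))"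

lemma fps_scale_nth [simp]: "fps_scale sc k f $ n = sc k (f $ n)"
  by (simp add: fps_scale_def)

lemma fps_part_nth [simp]: "fps_part part p f $ n = part p (f $ n)"
  by (simp add: fps_part_def)

lemma koszul_fps_nth: "koszul p q f $ n = koszul p q (f $ n :: 'b::ab_group_add)"
  by (simp add: koszul_def)

context supercommutative_algebra
begin

lemma koszul_sum: "koszul p q (sum f A) = (\<Sum>i\<in>A. koszul p q (f i :: 'c::ab_group_add))"
  by (simp add: koszul_def sum_negf)

text \<open>
  A coefficient of \<open>x * x\<close> depends on finitely many terms of \<open>x\<close>, and a finite sum of odd terms squares
  to zero by induction on the number of terms, the mixed products cancelling.  Dividing by 2 is avoided in this way.
\<close>

lemma fps_odd_square:
  assumes x: "fps_part part 1 x = x"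
  shows "x * x = 0"
proof (rule fps_ext)
  fix n
  have odd: "part 1 (x $ i) = x $ i" for i
    using arg_cong[OF x, of "\<lambda>f. f $ i"] by simp
  define trunc where "trunc = (\<lambda>m. \<Sum>i<m. fps_const (x $ i) * fps_X ^ i)"
  have mono: "fps_const (x $ i) * fps_X ^ i * (fps_const (x $ j) * fps_X ^ j) =
      fps_const (x $ i * x $ j) * fps_X ^ (i + j)" for i j
  proof -
    have "fps_const (x $ i) * fps_X ^ i * (fps_const (x $ j) * fps_X ^ j) =
        fps_const (x $ i) * (fps_X ^ i * fps_const (x $ j)) * fps_X ^ j"
      by (simp only: mult.assoc)
    also have "\<dots> = fps_const (x $ i) * fps_const (x $ j) * (fps_X ^ i * fps_X ^ j)"
      by (simp only: fps_mult_fps_X_power_commute[of i "fps_const (x $ j)"] mult.assoc)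
    finally show ?thesis by (simp only: fps_const_mult power_add)
  qed
  have sq: "trunc m * trunc m = 0" for m
  proof (induction m)
    case (Suc m)
    let ?u = "fps_const (x $ m) * fps_X ^ m"
    have "trunc m * ?u + ?u * trunc m =
        (\<Sum>i<m. fps_const (x $ i * x $ m + x $ m * x $ i) * fps_X ^ (i + m))"
      unfolding trunc_def sum_distrib_left sum_distrib_right mono sum.distrib[symmetric]
      by (intro sum.cong refl) (simp add: add.commute[of m] distrib_right flip: fps_const_add)
    also have "\<dots> = 0"
    proof (intro sum.neutral ballI)
      show "fps_const (x $ i * x $ m + x $ m * x $ i) * fps_X ^ (i + m) = 0" for i
        using supercomm[OF odd odd, of i m] by (simp add: koszul_def)
    qed
    finally have cross: "trunc m * ?u + ?u * trunc m = 0" .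
    have "trunc (Suc m) * trunc (Suc m) = trunc m * trunc m + (trunc m * ?u + ?u * trunc m) + ?u * ?u"
      by (simp add: trunc_def algebra_simps)
    also have "\<dots> = 0"
      unfolding Suc cross mono by (simp add: odd_square odd)
    finally show ?case .
  qed (simp add: trunc_def)
  have trunc_nth: "trunc (Suc n) $ i = x $ i" if "i \<le> n" for i
  proof -
    have "trunc (Suc n) $ i = (\<Sum>j<Suc n. if j = i then x $ i else 0)"
      unfolding trunc_def fps_sum_nth by (intro sum.cong) (auto simp: fps_X_power_nth)
    then show ?thesis using that by simp
  qed
  have "(x * x) $ n = (trunc (Suc n) * trunc (Suc n)) $ n"
    unfolding fps_mult_nth by (intro sum.cong refl arg_cong2[of _ _ _ _ "(*)"]) (simp_all add: trunc_nth)
  then show "(x * x) $ n = 0 $ n" by (simp add: sq)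
qed

lemma supercommutative_fps: "supercommutative_algebra (fps_scale sc) (fps_part part)"
proof (intro supercommutative_algebra.intro supercommutative_algebra_axioms.intro)
  show "module (fps_scale sc)"
    by standard (rule fps_ext, simp add: scale_left_distrib scale_right_distrib)+
  fix k p q and x y :: "'b fps"
  show "fps_scale sc k x * y = fps_scale sc k (x * y)" "x * fps_scale sc k y = fps_scale sc k (x * y)"
    by (rule fps_ext, simp add: fps_mult_nth sc_mult_left sc_mult_right scale_sum_right)+
  show "fps_part part p (x + y) = fps_part part p x + fps_part part p y"
    by (rule fps_ext) (simp add: part_add)
  show "fps_part part p (fps_scale sc k x) = fps_scale sc k (fps_part part p x)"
    by (rule fps_ext) (simp add: part_scale)
  show "fps_part part 0 x + fps_part part 1 x = x"
    by (rule fps_ext) (simp add: part_sum)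
  show "fps_part part p (fps_part part q x) = (if p = q then fps_part part p x else 0)"
    by (rule fps_ext) (simp add: part_part)
  show "fps_part part 0 1 = 1"
    by (rule fps_ext) (simp add: part_one)
  show "fps_part part 1 x = x \<Longrightarrow> x * x = 0"
    by (rule fps_odd_square)
  assume "fps_part part p x = x" "fps_part part q y = y"
  then have x: "part p (x $ n) = x $ n" and y: "part q (y $ n) = y $ n" for n
    by (metis fps_part_nth)+
  show "fps_part part (p + q) (x * y) = x * y"
    by (rule fps_ext) (simp only: fps_part_nth fps_mult_nth part_setsum part_mult[OF x y])
  show "x * y = koszul p q (y * x)"
  proof (rule fps_ext)
    fix n
    have "(x * y) $ n = (\<Sum>i=0..n. koszul p q (y $ (n - i) * x $ i))"
      unfolding fps_mult_nth by (simp only: supercomm[OF x y])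
    also have "\<dots> = koszul p q (\<Sum>i=0..n. y $ i * x $ (n - i))"
      unfolding koszul_sum[symmetric]
      by (subst sum.atLeastAtMost_rev) (auto intro!: arg_cong[of _ _ "koszul p q"] sum.cong)
    finally show "(x * y) $ n = koszul p q (y * x) $ n"
      by (simp add: koszul_fps_nth fps_mult_nth)
  qed
qed

end


section \<open>Convolution of linear maps\<close>

text \<open>
  By definition, \<open>tensor_lift\<close> is a finite linear combination of values of \<open>\<beta>\<close>.
\<close>

lemma tensor_lift_comp:
  assumes h: "module_hom scA scB h"
  shows "h (tensor_lift scA \<beta> t) = tensor_lift scB (\<lambda>x y. h (\<beta> x y)) t"
proof -
  interpret module_hom scA scB h by (rule h)
  show ?thesis by (simp add: tensor_lift_def sum scale)
qed

text \<open>
  The sign picked up by \<open>x\<close> when it is moved past an element of parity \<open>q\<close>, extended linearly to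
  inhomogeneous \<open>x\<close>.
\<close>

definition twist ::
  "bit \<Rightarrow> ('k::field, 'm::{finite, linorder}, 'n::{finite, linorder}) coordGL \<Rightarrow> ('k, 'm, 'n) coordGL" where
  "twist q x = coordGL_part 0 x + koszul 1 q (coordGL_part 1 x)"

lemma coordGL_part_homogeneous: "coordGL_part q x = x \<Longrightarrow> coordGL_part p x = (if p = q then x else 0)"
  using coordGL_part_part[of p q x] by auto

lemma twist_homogeneous: "coordGL_part p x = x \<Longrightarrow> twist q x = koszul p q x"
  using coordGL_part_homogeneous[of p x 0] coordGL_part_homogeneous[of p x 1]
  by (cases p) (simp_all add: twist_def koszul_def)

lemma coordGL_scale_add: "coordGL_scale k (x + y) = coordGL_scale k x + coordGL_scale k y"
  by (rule module.scale_right_distrib[OF module_coordGL])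

lemma coordGL_scale_koszul: "koszul p q (coordGL_scale k x) = coordGL_scale k (koszul p q x)"
  by (simp add: koszul_def module.scale_minus_right[OF module_coordGL])

lemma twist_add: "twist q (x + y) = twist q x + twist q y"
  by (simp add: twist_def coordGL_part_add koszul_add)

lemma twist_scale: "twist q (coordGL_scale k x) = coordGL_scale k (twist q x)"
  by (simp add: twist_def coordGL_part_scale coordGL_scale_koszul coordGL_scale_add)

lemma twist_zero [simp]: "twist 0 x = x"
  by (simp add: twist_def coordGL_part_sum)

lemma coordGL_part_koszul: "coordGL_part p (koszul q r x) = koszul q r (coordGL_part p x)"
proof -
  have "coordGL_part p 0 = 0"
    using coordGL_part_add[of p 0 0] by simp
  then have "coordGL_part p (- x) = - coordGL_part p x"
    by (metis coordGL_part_add add.right_inverse minus_unique)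
  then show ?thesis by (simp add: koszul_def)
qed

lemma twist_twist: "twist p (twist q x) = twist (p + q) x"
proof -
  have "twist p (koszul 1 q (coordGL_part 1 x)) = koszul 1 p (koszul 1 q (coordGL_part 1 x))"
    by (rule twist_homogeneous) (simp add: coordGL_part_koszul coordGL_part_part)
  moreover have "twist p (coordGL_part 0 x) = coordGL_part 0 x"
    using twist_homogeneous[of 0 "coordGL_part 0 x" p] by (simp add: coordGL_part_part)
  ultimately have "twist p (twist q x) = coordGL_part 0 x + koszul 1 p (koszul 1 q (coordGL_part 1 x))"
    by (simp only: twist_def[of q x] twist_add)
  then show ?thesis by (simp only: koszul_koszul twist_def)
qed

lemma coordGL_part_var: "coordGL_part (gpar (i, j)) (coordGL_var i j) = coordGL_var i j"
  by (simp only: coordGL_var_def loc_frac_part[OF loc_one] spart_svar if_True refl)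

lemma coordGL2_part_add: "coordGL2_part p (t + u) = coordGL2_part p t + coordGL2_part p u"
  unfolding coordGL2_part_def
  by (rule tensor_lift_add[OF module_coordGL2 bilinear_mapI[OF module_coordGL2]])
    (simp_all only: coordGL_part_add coordGL_part_scale tensor_add_left tensor_add_right sum.distrib
      tensor_scale_left tensor_scale_right module.scale_sum_right[OF module_coordGL2])

lemma coordGL2_part_homogeneous:
  assumes "coordGL_part q x = x" "coordGL_part r y = y"
  shows "coordGL2_part p (x \<otimes> y) = (if p = q + r then x \<otimes> y else 0)"
  unfolding coordGL2_part_tensor coordGL_part_homogeneous[OF assms(1)] coordGL_part_homogeneous[OF assms(2)]
  by (cases p; cases q; cases r) simp_all

lemma is_comultiplicationD:
  assumes "is_comultiplication \<delta>"
  shows "superalgebra_hom coordGL_scale coordGL_part coordGL2_scale coordGL2_part \<delta>"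
    and "\<delta> (coordGL_var i j) = (\<Sum>t\<in>UNIV. coordGL_var i t \<otimes> coordGL_var t j)"
  using assms unfolding is_comultiplication_def by blast+

lemma module_hom_coordGLI:
  assumes "module sc" "\<And>x y. a (x + y) = a x + a y" "\<And>k x. a (coordGL_scale k x) = sc k (a x)"
  shows "module_hom coordGL_scale sc a"
  using assms module_coordGL unfolding module_hom_def module_hom_axioms_def by blast

context supercommutative_algebra
begin

abbreviation lin :: "(('k, 'm::{finite, linorder}, 'n::{finite, linorder}) coordGL \<Rightarrow> 'b) \<Rightarrow> bool" where
  "lin \<equiv> module_hom coordGL_scale sc"

lemmas linI = module_hom_coordGLI[OF module_axioms]

lemma linD:
  assumes "lin a"
  shows "a (x + y) = a x + a y" "a (coordGL_scale k x) = sc k (a x)" "a (koszul p q x) = koszul p q (a x)"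
    "a (sum h A) = (\<Sum>i\<in>A. a (h i))"
  using module_hom.add[OF assms] module_hom.scale[OF assms] module_hom.neg[OF assms] module_hom.sum[OF assms]
  by (auto simp: koszul_def)

text \<open>
  The map \<open>x \<otimes> y \<mapsto> a x * b y\<close>, with values multiplied in the target; convolution is its composition with the
  comultiplication.
\<close>

definition pairing ::
  "(('k, 'm::{finite, linorder}, 'n::{finite, linorder}) coordGL \<Rightarrow> 'b) \<Rightarrow> (('k, 'm, 'n) coordGL \<Rightarrow> 'b) \<Rightarrow>
   ('k, 'm, 'n) coordGL2 \<Rightarrow> 'b" where
  "pairing a b = tensor_lift sc (\<lambda>x y. a x * b y)"

definition conv ::
  "(('k, 'm::{finite, linorder}, 'n::{finite, linorder}) coordGL \<Rightarrow> ('k, 'm, 'n) coordGL2) \<Rightarrow>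
   (('k, 'm, 'n) coordGL \<Rightarrow> 'b) \<Rightarrow> (('k, 'm, 'n) coordGL \<Rightarrow> 'b) \<Rightarrow> ('k, 'm, 'n) coordGL \<Rightarrow> 'b" where
  "conv \<delta> a b f = pairing a b (\<delta> f)"

context
  fixes a b :: "('k, 'm::{finite, linorder}, 'n::{finite, linorder}) coordGL \<Rightarrow> 'b"
  assumes a: "lin a" and b: "lin b"
begin

lemma pairing_bilinear: "bilinear_map sc (\<lambda>x y. a x * b y)"
  by (rule bilinear_mapI[OF module_axioms])
    (simp_all add: linD[OF a] linD[OF b] distrib_left distrib_right sc_mult_left sc_mult_right)

lemma pairing_tensor: "pairing a b (x \<otimes> y) = a x * b y"
  unfolding pairing_def by (rule tensor_lift_tensor[OF module_axioms pairing_bilinear])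

lemma pairing_hom: "module_hom coordGL2_scale sc (pairing a b)"
  unfolding pairing_def by (rule tensor_lift_hom[OF module_axioms pairing_bilinear])

lemmas pairing_add = module_hom.add[OF pairing_hom]
  and pairing_scale = module_hom.scale[OF pairing_hom]
  and pairing_sum = module_hom.sum[OF pairing_hom]

lemma pairing_koszul: "pairing a b (koszul p q t) = koszul p q (pairing a b t)"
  using module_hom.neg[OF pairing_hom] by (simp add: koszul_def)

end

lemma pairing_sum_left: "pairing (\<lambda>x. \<Sum>i\<in>A. a i x) b t = (\<Sum>i\<in>A. pairing (a i) b t)"
  unfolding pairing_def tensor_lift_def
  by (subst sum.swap) (simp add: sum_distrib_right scale_sum_right)

lemma pairing_add_left: "pairing (\<lambda>x. a x + a' x) b t = pairing a b t + pairing a' b t"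
  unfolding pairing_def tensor_lift_def
  by (simp add: distrib_right scale_right_distrib sum.distrib)

lemma pairing_scale_left: "pairing (\<lambda>x. sc k (a x)) b t = sc k (pairing a b t)"
  unfolding pairing_def tensor_lift_def
  by (simp add: sc_mult_left scale_sum_right mult.commute)

lemma pairing_part:
  assumes a: "point a" and b: "point b"
  shows "pairing a b (coordGL2_part p t) = part p (pairing a b t)"
proof (induction t rule: tensor_span_induct_homogeneous)
  note ab = superalgebra_hom_linear[OF a] superalgebra_hom_linear[OF b]
  case (tensor q r x y)
  have "part (q + r) (a x * b y) = a x * b y"
    by (rule part_mult) (metis superalgebra_hom_part[OF a] tensor(1), metis superalgebra_hom_part[OF b] tensor(2))
  then have "part p (a x * b y) = (if p = q + r then a x * b y else 0)"
    by (rule part_homogeneous)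
  then show ?case
    by (simp add: coordGL2_part_homogeneous[OF tensor] pairing_tensor[OF ab] module_hom.zero[OF pairing_hom[OF ab]])
next
  note ab = superalgebra_hom_linear[OF a] superalgebra_hom_linear[OF b]
  case (add t u)
  then show ?case by (simp add: coordGL2_part_add pairing_add[OF ab] part_add)
qed

lemma pairing_mult:
  assumes a: "point a" and b: "point b"
  shows "pairing a b (t * u) = pairing a b t * pairing a b u"
proof (induction t rule: tensor_span_induct_homogeneous)
  note ab = superalgebra_hom_linear[OF a] superalgebra_hom_linear[OF b]
  case (tensor p q x y)
  note xy = this
  show ?case
  proof (induction u rule: tensor_span_induct_homogeneous)
    case (tensor p' q' x' y')
    have "part q (b y) = b y" "part p' (a x') = a x'"
      by (metis superalgebra_hom_part[OF b] xy(2), metis superalgebra_hom_part[OF a] tensor(1))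
    from supercomm[OF this] have "a x * b y * (a x' * b y') = koszul q p' (a x * a x' * (b y * b y'))"
      by (metis koszul_mult mult.assoc)
    then show ?case
      by (simp add: tensor_times_homogeneous[OF xy(2) tensor(1)] pairing_koszul[OF ab] pairing_tensor[OF ab]
          superalgebra_hom_mult[OF a] superalgebra_hom_mult[OF b])
  qed (simp add: distrib_left pairing_add[OF ab])
next
  note ab = superalgebra_hom_linear[OF a] superalgebra_hom_linear[OF b]
  case (add t t')
  then show ?case by (simp add: distrib_right pairing_add[OF ab])
qed

context
  fixes \<delta> :: "('k, 'm::{finite, linorder}, 'n::{finite, linorder}) coordGL \<Rightarrow> ('k, 'm, 'n) coordGL2"
  assumes \<delta>: "is_comultiplication \<delta>"
begin

lemmas comult = superalgebra_homD[OF is_comultiplicationD(1)[OF \<delta>]]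

lemma conv_lin: "lin a \<Longrightarrow> lin b \<Longrightarrow> lin (conv \<delta> a b)"
  by (rule linI) (simp_all add: conv_def comult pairing_add pairing_scale)

lemma conv_one: "lin a \<Longrightarrow> lin b \<Longrightarrow> conv \<delta> a b 1 = a 1 * b 1"
  by (simp add: conv_def comult one_coordGL2_def pairing_tensor)

lemma conv_var: "lin a \<Longrightarrow> lin b \<Longrightarrow>
    conv \<delta> a b (coordGL_var i j) = (\<Sum>t\<in>UNIV. a (coordGL_var i t) * b (coordGL_var t j))"
  by (simp add: conv_def is_comultiplicationD(2)[OF \<delta>] pairing_sum pairing_tensor)

lemma conv_point:
  assumes a: "point a" and b: "point b"
  shows "point (conv \<delta> a b)"
proof -
  note ab = superalgebra_hom_linear[OF a] superalgebra_hom_linear[OF b]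
  show ?thesis
    by (rule superalgebra_homI[OF module_coordGL])
      (simp_all add: linD[OF conv_lin[OF ab]] conv_one[OF ab] superalgebra_hom_one[OF a] superalgebra_hom_one[OF b],
       simp_all add: conv_def comult pairing_part[OF a b] pairing_mult[OF a b])
qed

text \<open>
  Expands only the first factor \<open>c\<^bsub>ij\<^esub>\<close> of the argument: what is left is a sum of convolutions with modified linear
  maps in place of \<open>a\<close>, evaluated at \<open>y\<close>.  The twist comes from moving \<open>c\<^bsub>tj\<^esub>\<close> past the first tensor factor of
  \<open>\<delta> y\<close>.
\<close>

lemma conv_var_mult:
  assumes a: "lin a" and b: "point b"
  shows "conv \<delta> a b (coordGL_var i j * y) =
    (\<Sum>t\<in>UNIV. conv \<delta> (\<lambda>x. a (coordGL_var i t * twist (gpar (t, j)) x) * b (coordGL_var t j)) b y)"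
proof -
  note bl = superalgebra_hom_linear[OF b]
  have "pairing a b ((u \<otimes> v) * t) = pairing (\<lambda>x. a (u * twist q x) * b v) b t"
    if v: "coordGL_part q v = v" for q u v t
  proof -
    have l: "lin (\<lambda>x. a (u * twist q x) * b v)"
      by (rule linI) (simp_all add: twist_add twist_scale distrib_left distrib_right linD[OF a] coordGL_scale_mult sc_mult_left)
    show ?thesis
    proof (induction t rule: tensor_span_induct_homogeneous)
      case (tensor p p' x y)
      have "koszul q p z = koszul p q z" for z :: 'b
        by (simp add: koszul_def mult.commute)
      then show ?case
        by (simp add: tensor_times_homogeneous[OF v tensor(1)] pairing_koszul[OF a bl] pairing_tensor[OF a bl]
            pairing_tensor[OF l bl] twist_homogeneous[OF tensor(1)] koszul_mult linD(3)[OF a]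
            superalgebra_hom_mult[OF b] mult.assoc)
    qed (simp add: distrib_left pairing_add[OF a bl] pairing_add[OF l bl])
  qed
  from this[OF coordGL_part_var] show ?thesis
    by (simp add: conv_def comult is_comultiplicationD(2)[OF \<delta>] sum_distrib_right pairing_sum[OF a bl])
qed

text \<open>
  Moving \<open>r\<close> to the left past the values of \<open>b\<close> costs the sign that turns the twist of \<open>y\<close>, that is, of both tensor
  factors of \<open>\<delta> y\<close>, into a twist of the first factor alone.
\<close>

lemma conv_twist_mult:
  assumes a: "lin a" and b: "point b" and r: "part q r = r"
  shows "conv \<delta> a b (twist q y) * r = conv \<delta> (\<lambda>x. a (twist q x) * r) b y"
proof -
  note bl = superalgebra_hom_linear[OF b]
  have l: "lin (\<lambda>x. a (twist q x) * r)"
    by (rule linI) (simp_all add: twist_add twist_scale distrib_right linD[OF a] sc_mult_left)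
  have "pairing a b (coordGL2_part 0 t + koszul 1 q (coordGL2_part 1 t)) * r = pairing (\<lambda>x. a (twist q x) * r) b t" for t
  proof (induction t rule: tensor_span_induct_homogeneous)
    case (tensor p p' x y)
    have 1: "coordGL2_part 0 (x \<otimes> y) + koszul 1 q (coordGL2_part 1 (x \<otimes> y)) = koszul (p + p') q (x \<otimes> y)"
      unfolding coordGL2_part_homogeneous[OF tensor] by (cases p; cases p') (simp_all add: koszul_def)
    have "part p' (b y) = b y"
      by (metis superalgebra_hom_part[OF b] tensor(2))
    from supercomm[OF this r] have "koszul (p + p') q (a x * b y) * r = koszul (p + p') q (koszul p' q (a x * r * b y))"
      by (simp add: koszul_mult mult.assoc)
    also have "\<dots> = koszul p q (a x) * r * b y"
      by (cases p; cases p'; cases q) (simp_all add: koszul_def)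
    finally show ?case
      unfolding 1 by (simp add: pairing_koszul[OF a bl] pairing_tensor[OF a bl] pairing_tensor[OF l bl]
          twist_homogeneous[OF tensor(1)] linD(3)[OF a])
  next
    case (add t u)
    have "coordGL2_part 0 (t + u) + koszul 1 q (coordGL2_part 1 (t + u)) =
        (coordGL2_part 0 t + koszul 1 q (coordGL2_part 1 t)) + (coordGL2_part 0 u + koszul 1 q (coordGL2_part 1 u))"
      by (simp add: coordGL2_part_add koszul_add)
    then show ?case using add by (simp only: pairing_add[OF a bl] pairing_add[OF l bl] distrib_right)
  qed
  moreover have "\<delta> (koszul p q' x) = koszul p q' (\<delta> x)" for p q' x
    using module_hom.neg[OF comult(6)] by (simp add: koszul_def)
  ultimately show ?thesis
    by (simp add: conv_def twist_def comult)
qed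

text \<open>
  A substitute for coassociativity and the antipode axiom that needs no triple tensor product.  Let \<open>L\<close> be the
  operator \<open>a \<mapsto> (a * b) * b'\<close>.  The elements \<open>x\<close> such that \<open>L\<close> commutes with multiplication of the argument by
  \<open>x\<close>, for all linear \<open>a\<close>, are closed under sums, products and inverses.  They contain the generators: by the two
  previous lemmas the signs combine to one independent of the inner summation index, and that inner sum is an entry
  of the product of the matrices of \<open>b\<close> and \<open>b'\<close>, the identity matrix.  So \<open>L\<close> may be evaluated at \<open>1\<close>, where it
  is trivial.
\<close>

lemma conv_cancel_right:
  assumes b: "point b" and b': "point b'"
    and inv: "\<And>i j. (\<Sum>t\<in>UNIV. b (coordGL_var i t) * b' (coordGL_var t j)) = (if i = j then 1 else 0)"
    and a: "lin a"
  shows "conv \<delta> (conv \<delta> a b) b' x = a x"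
proof -
  note bl = superalgebra_hom_linear[OF b] and bl' = superalgebra_hom_linear[OF b']
  define L where "L = (\<lambda>a. conv \<delta> (conv \<delta> a b) b')"
  have L_lin: "lin (L a)" if "lin a" for a
    unfolding L_def by (intro conv_lin that bl bl')
  have L_sum: "L (\<lambda>x. \<Sum>i\<in>A. a i x) y = (\<Sum>i\<in>A. L (a i) y)" for A y and a :: "('m + 'n) \<Rightarrow> _"
    by (simp add: L_def conv_def[abs_def] pairing_sum_left)
  have L_add: "L (\<lambda>x. a x + a' x) y = L a y + L a' y" for a a' y
    by (simp add: L_def conv_def[abs_def] pairing_add_left)
  have L_scale: "L (\<lambda>x. sc k (a x)) y = sc k (L a y)" for a k y
    by (simp add: L_def conv_def[abs_def] pairing_scale_left)
  have mult_lin: "lin (\<lambda>z. a (x * z))" if "lin a" for a x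
    by (rule linI) (simp_all add: distrib_left coordGL_scale_mult linD[OF that])
  have "\<forall>a y. lin a \<longrightarrow> L a (x * y) = L (\<lambda>z. a (x * z)) y" for x
  proof (induction x rule: coordGL_generated_induct)
    case (var i j)
    show ?case
    proof (intro allI impI)
      fix a :: "('k, 'm, 'n) coordGL \<Rightarrow> 'b" and y
      assume a: "lin a"
      define A where "A = (\<lambda>t w. a (coordGL_var i t * twist (gpar (t, j)) w))"
      \<comment> \<open>the parities of \<open>c\<^bsub>tu\<^esub>\<close> and \<open>c\<^bsub>uj\<^esub>\<close> add up to that of \<open>c\<^bsub>tj\<^esub>\<close>, whence \<open>u\<close> does not occur in \<open>A t\<close>\<close>
      have inner: "conv \<delta> a b (coordGL_var i u * twist (gpar (u, j)) z) * b' (coordGL_var u j) =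
          (\<Sum>t\<in>UNIV. conv \<delta> (\<lambda>w. A t w * (b (coordGL_var t u) * b' (coordGL_var u j))) b z)" for u z
      proof -
        have g: "gpar (t, u) + gpar (u, j) = gpar (t, j)" for t
          by (simp only: gpar_def fst_conv snd_conv add.assoc bit_add_self2)
        have p: "part (gpar (u, j)) (b' (coordGL_var u j)) = b' (coordGL_var u j)"
          by (metis superalgebra_hom_part[OF b'] coordGL_part_var)
        have l: "lin (\<lambda>w. a (coordGL_var i t * twist (gpar (t, u)) w) * b (coordGL_var t u))" for t
          by (rule linI) (simp_all add: twist_add twist_scale distrib_left distrib_right linD[OF a] coordGL_scale_mult sc_mult_left)
        show ?thesis
          unfolding conv_var_mult[OF a b] sum_distrib_right conv_twist_mult[OF l b p] twist_twist g A_def mult.assoc ..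
      qed
      have "L a (coordGL_var i j * y) = (\<Sum>u\<in>UNIV. \<Sum>t\<in>UNIV. L (\<lambda>w. A t w * (b (coordGL_var t u) * b' (coordGL_var u j))) y)"
        unfolding L_def conv_var_mult[OF conv_lin[OF a bl] b'] inner
        by (simp add: conv_def[abs_def] pairing_sum_left)
      also have "\<dots> = L (\<lambda>w. \<Sum>t\<in>UNIV. A t w * (\<Sum>u\<in>UNIV. b (coordGL_var t u) * b' (coordGL_var u j))) y"
        unfolding L_sum sum_distrib_left by (rule sum.swap)
      also have "(\<lambda>w. \<Sum>t\<in>UNIV. A t w * (\<Sum>u\<in>UNIV. b (coordGL_var t u) * b' (coordGL_var u j))) = A j"
      proof
        fix w
        have "(\<Sum>t\<in>UNIV. A t w * (\<Sum>u\<in>UNIV. b (coordGL_var t u) * b' (coordGL_var u j))) =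
            (\<Sum>t\<in>UNIV. if t = j then A t w else 0)"
          unfolding inv by (intro sum.cong) auto
        then show "(\<Sum>t\<in>UNIV. A t w * (\<Sum>u\<in>UNIV. b (coordGL_var t u) * b' (coordGL_var u j))) = A j w"
          by simp
      qed
      also have "A j = (\<lambda>z. a (coordGL_var i j * z))"
        by (simp add: A_def gpar_diag)
      finally show "L a (coordGL_var i j * y) = L (\<lambda>z. a (coordGL_var i j * z)) y" .
    qed
  next
    case (scale k x)
    then show ?case by (simp add: coordGL_scale_mult linD L_lin L_scale)
  next
    case (add x x')
    then show ?case by (simp add: distrib_right linD L_lin L_add)
  next
    case (mult x x')
    then show ?case by (simp add: mult.assoc mult_lin)
  next
    case (inverse x x')
    show ?case
    proof (intro allI impI)
      fix a :: "('k, 'm, 'n) coordGL \<Rightarrow> 'b" and y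
      assume a: "lin a"
      have "L (\<lambda>z. a (x' * z)) (x * (x' * y)) = L (\<lambda>z. a (x' * (x * z))) (x' * y)"
        using inverse(1) mult_lin[OF a, of x'] by blast
      then show "L a (x' * y) = L (\<lambda>z. a (x' * z)) y"
        by (simp add: inverse(2,3) flip: mult.assoc)
    qed
  qed simp
  from this[of x] have "L a (x * 1) = L (\<lambda>z. a (x * z)) 1" using a by blast
  then show ?thesis
    unfolding L_def using conv_one[OF conv_lin[OF mult_lin[OF a] bl] bl'] conv_one[OF mult_lin[OF a] bl]
    by (simp add: superalgebra_hom_one[OF b] superalgebra_hom_one[OF b'])
qed

end

end


section \<open>Coadjoint invariants under conjugation\<close>

lemma is_antipodeD:
  assumes "is_antipode \<delta> s"
  shows "module_hom coordGL_scale coordGL_scale s" "s (coordGL_part p x) = coordGL_part p (s x)"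
    "tensor_lift coordGL_scale (\<lambda>x y. s x * y) (\<delta> f) = coordGL_scale (coordGL_counit f) 1"
  using assms unfolding is_antipode_def even_linear_def by blast+

context supercommutative_algebra
begin

lemma counit_point: "point (\<lambda>f. sc (coordGL_counit f) 1)"
proof (rule superalgebra_homI[OF module_coordGL])
  fix p and x :: "('k, 'm::{finite, linorder}, 'n::{finite, linorder}) coordGL"
  have "part p 1 = (if p = 0 then 1 else 0)" by (rule part_homogeneous[OF part_one])
  then show "sc (coordGL_counit (coordGL_part p x)) 1 = part p (sc (coordGL_counit x) 1)"
    by (simp add: superalgebra_homD[OF coordGL_counit_hom] purely_even_def part_scale)
qed (simp_all add: superalgebra_homD[OF coordGL_counit_hom] scale_left_distrib sc_mult_left)

text \<open>
  By the antipode axiom \<open>(g \<circ> s) * g\<close> is the unit for convolution; cancelling \<open>g\<close> on the right leaves \<open>g'\<close>.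
\<close>

lemma antipode_point:
  fixes \<delta> :: "('k, 'm::{finite, linorder}, 'n::{finite, linorder}) coordGL \<Rightarrow> ('k, 'm, 'n) coordGL2"
  assumes \<delta>: "is_comultiplication \<delta>" and s: "is_antipode \<delta> s" and g: "point g" and g': "point g'"
    and inv: "\<And>i j. (\<Sum>t\<in>UNIV. g (coordGL_var i t) * g' (coordGL_var t j)) = (if i = j then 1 else 0)"
  shows "g (s x) = g' x"
proof -
  have gs: "lin (\<lambda>x. g (s x))"
    by (rule linI) (simp_all add: module_hom.add[OF is_antipodeD(1)[OF s]]
        module_hom.scale[OF is_antipodeD(1)[OF s]] superalgebra_homD[OF g])
  have "conv \<delta> (\<lambda>x. g (s x)) g = (\<lambda>f. sc (coordGL_counit f) 1)"
  proof
    fix f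
    have "conv \<delta> (\<lambda>x. g (s x)) g f = g (tensor_lift coordGL_scale (\<lambda>x y. s x * y) (\<delta> f))"
      unfolding conv_def pairing_def tensor_lift_comp[OF superalgebra_hom_linear[OF g]]
      by (simp only: superalgebra_hom_mult[OF g])
    then show "conv \<delta> (\<lambda>x. g (s x)) g f = sc (coordGL_counit f) 1"
      by (simp add: is_antipodeD(3)[OF s] superalgebra_homD[OF g])
  qed
  then have "g (s x) = conv \<delta> (\<lambda>f. sc (coordGL_counit f) 1) g' x"
    using conv_cancel_right[OF \<delta> g g' inv gs] by simp
  also have "\<dots> = g' x"
  proof (rule point_eqI[OF conv_point[OF \<delta> counit_point g'] g'])
    fix i j
    have "conv \<delta> (\<lambda>f. sc (coordGL_counit f) 1) g' (coordGL_var i j) =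
        (\<Sum>t\<in>UNIV. if t = i then g' (coordGL_var t j) else 0)"
      unfolding conv_var[OF \<delta> superalgebra_hom_linear[OF counit_point] superalgebra_hom_linear[OF g']]
      by (intro sum.cong) (auto simp: coordGL_counit_var sc_mult_left)
    then show "conv \<delta> (\<lambda>f. sc (coordGL_counit f) 1) g' (coordGL_var i j) = g' (coordGL_var i j)"
      by simp
  qed
  finally show ?thesis .
qed

text \<open>
  The Koszul sign in the coaction is exactly the one for interchanging \<open>t(f\<^sub>2)\<close> and \<open>g(s(f\<^sub>1))\<close> in the target, so
  \<open>\<Sum> \<plusminus> t(f\<^sub>2) g(s(f\<^sub>1)) g(f\<^sub>3)\<close> becomes \<open>\<Sum> g(s(f\<^sub>1)) t(f\<^sub>2) g(f\<^sub>3)\<close>.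
\<close>

lemma pairing_coadjoint:
  fixes \<delta> :: "('k, 'm::{finite, linorder}, 'n::{finite, linorder}) coordGL \<Rightarrow> ('k, 'm, 'n) coordGL2"
  assumes s: "is_antipode \<delta> s" and g: "point g" and t: "point t"
  shows "pairing t g (coadjoint \<delta> s f) = conv \<delta> (conv \<delta> (\<lambda>x. g (s x)) t) g f"
proof -
  note tl = superalgebra_hom_linear[OF t] and gl = superalgebra_hom_linear[OF g]
  have hom: "module_hom coordGL2_scale sc (pairing t g)"
    by (rule pairing_hom[OF tl gl])
  have parts: "pairing t g (koszul p q (coordGL_part q y \<otimes> (s (coordGL_part p x) * z))) =
      g (s (coordGL_part p x)) * t (coordGL_part q y) * g z" for p q x y z
  proof -
    have "part q (t (coordGL_part q y)) = t (coordGL_part q y)"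
      by (simp add: superalgebra_hom_part[OF t] part_part)
    moreover have "part p (g (s (coordGL_part p x))) = g (s (coordGL_part p x))"
      by (simp add: is_antipodeD(2)[OF s] superalgebra_hom_part[OF g] part_part)
    ultimately have "t (coordGL_part q y) * g (s (coordGL_part p x)) =
        koszul q p (g (s (coordGL_part p x)) * t (coordGL_part q y))"
      by (rule supercomm)
    then have "koszul p q (t (coordGL_part q y) * g (s (coordGL_part p x))) = g (s (coordGL_part p x)) * t (coordGL_part q y)"
      by (cases p; cases q) (simp_all add: koszul_def)
    then have "koszul p q (t (coordGL_part q y) * g (s (coordGL_part p x))) * g z =
        g (s (coordGL_part p x)) * t (coordGL_part q y) * g z" by simp
    then show ?thesis
      by (simp only: pairing_koszul[OF tl gl] pairing_tensor[OF tl gl] superalgebra_hom_mult[OF g] koszul_mult mult.assoc)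
  qed
  have inner: "pairing t g (\<Sum>p\<in>{0, 1}. \<Sum>q\<in>{0, 1}. koszul p q (coordGL_part q y \<otimes> (s (coordGL_part p x) * z))) =
      g (s x) * t y * g z" for x y z
  proof -
    have "pairing t g (\<Sum>p\<in>{0, 1}. \<Sum>q\<in>{0, 1}. koszul p q (coordGL_part q y \<otimes> (s (coordGL_part p x) * z))) =
        (\<Sum>p\<in>{0, 1}. g (s (coordGL_part p x))) * (\<Sum>q\<in>{0, 1}. t (coordGL_part q y)) * g z"
      by (simp only: module_hom.sum[OF hom] parts, simp only: sum_product, simp only: sum_distrib_right)
    also have "(\<Sum>p\<in>{0, 1}. g (s (coordGL_part p x))) = g (s x)"
      using module_hom.add[OF is_antipodeD(1)[OF s], of "coordGL_part 0 x" "coordGL_part 1 x"]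
        linD(1)[OF gl, of "s (coordGL_part 0 x)" "s (coordGL_part 1 x)"]
      by (simp add: coordGL_part_sum)
    also have "(\<Sum>q\<in>{0, 1}. t (coordGL_part q y)) = t y"
      using linD(1)[OF tl, of "coordGL_part 0 y" "coordGL_part 1 y"] by (simp add: coordGL_part_sum)
    finally show ?thesis .
  qed
  have mult_right: "module_hom sc sc (\<lambda>x. x * g z)" for z
    using module_axioms unfolding module_hom_def module_hom_axioms_def
    by (simp add: distrib_right sc_mult_left)
  show ?thesis
    unfolding coadjoint_def tensor_lift_comp[OF hom] inner
    unfolding conv_def pairing_def
    by (simp only: tensor_lift_comp[OF mult_right])
qed

text \<open>
  The left-hand side is the value of \<open>f\<close> at the conjugate \<open>g\<inverse> t g\<close>: invariants are class functions on points.
\<close>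

lemma invariant_conjugation:
  fixes \<delta> :: "('k, 'm::{finite, linorder}, 'n::{finite, linorder}) coordGL \<Rightarrow> ('k, 'm, 'n) coordGL2"
  assumes \<delta>: "is_comultiplication \<delta>" and s: "is_antipode \<delta> s" and g: "point g" and g': "point g'"
    and inv: "\<And>i j. (\<Sum>t\<in>UNIV. g (coordGL_var i t) * g' (coordGL_var t j)) = (if i = j then 1 else 0)"
    and t: "point t" and f: "f \<in> coadjoint_invariants \<delta> s"
  shows "conv \<delta> (conv \<delta> g' t) g f = t f"
proof -
  have "conv \<delta> (conv \<delta> g' t) g f = pairing t g (coadjoint \<delta> s f)"
    by (simp only: pairing_coadjoint[OF s g t] antipode_point[OF \<delta> s g g' inv])
  also have "\<dots> = t f"
    using f by (simp add: coadjoint_invariants_def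
        pairing_tensor[OF superalgebra_hom_linear[OF t] superalgebra_hom_linear[OF g]] superalgebra_hom_one[OF g])
  finally show ?thesis .
qed

end

section \<open>Diagonal points\<close>

lemma prod_list_commute:
  fixes x :: "'b::monoid_mult"
  assumes "\<And>y. y \<in> set ys \<Longrightarrow> x * y = y * x"
  shows "x * prod_list ys = prod_list ys * x"
  using assms
proof (induction ys)
  case (Cons y ys)
  have "x * prod_list (y # ys) = y * (x * prod_list ys)"
    using Cons.prems[of y] by (simp flip: mult.assoc)
  with Cons show ?case by (simp add: mult.assoc)
qed simp

lemma prod_list_mset_cong:
  fixes h :: "'x \<Rightarrow> 'b::monoid_mult"
  assumes comm: "\<And>x y. h x * h y = h y * h x" and "mset xs = mset ys"
  shows "prod_list (map h xs) = prod_list (map h ys)"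
  using assms(2)
proof (induction xs arbitrary: ys)
  case (Cons x xs)
  then have "x \<in> set ys" by (metis list.set_intros(1) set_mset_mset)
  then obtain us vs where ys: "ys = us @ x # vs" by (meson split_list)
  have "prod_list (map h xs) = prod_list (map h (us @ vs))"
    using Cons.prems by (intro Cons.IH) (simp add: ys)
  moreover have "h x * prod_list (map h us) = prod_list (map h us) * h x"
    by (rule prod_list_commute) (use comm in auto)
  ultimately show ?case
    by (simp add: ys) (simp flip: mult.assoc)
qed simp

context supercommutative_algebra
begin

text \<open>
  On a word both \<open>\<phi>\<close> and \<open>t\<close> vanish unless all letters are diagonal, and otherwise the value of \<open>t\<close> depends only on
  the monomial \<open>\<phi>\<close> assigns to it, as the diagonal entries are even and commute.  So on numerators \<open>t\<close> is a linear map
  \<open>\<tau>\<close> composed with \<open>\<phi>\<close>.  Clearing the denominator of \<open>f\<close> makes it unnecessary to treat negative exponents.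
\<close>

lemma diagonal_point_factors:
  fixes \<phi> :: "('k, 'm::{finite, linorder}, 'n::{finite, linorder}) coordGL \<Rightarrow> ('k, 'm, 'n) laurent"
  assumes \<phi>: "superalgebra_hom coordGL_scale coordGL_part laurent_scale purely_even \<phi>"
    and \<phi>_var: "\<And>i j. \<phi> (coordGL_var i j) = (if i = j then laurent_var i else 0)"
    and t: "point t" and t_var: "\<And>i j. t (coordGL_var i j) = (if i = j then d i else 0)"
    and f: "\<phi> f = 0"
  shows "t f = 0"
proof -
  note P = superalgebra_homD[OF \<phi>] and T = superalgebra_homD[OF t]
  have comm: "d i * d j = d j * d i" for i j
  proof (rule even_central)
    have "coordGL_part 0 (coordGL_var i i) = (coordGL_var i i :: ('k, 'm, 'n) coordGL)"
      using coordGL_part_var[of i i] by (simp add: gpar_diag)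
    then have "part 0 (t (coordGL_var i i)) = t (coordGL_var i i)"
      by (simp only: T(3)[symmetric])
    then show "part 0 (d i) = d i" by (simp add: t_var)
  qed
  define expo where "expo = (\<lambda>is :: ('m + 'n) list. \<Sum>i\<leftarrow>is. Poly_Mapping.single i (1::int))"
  have expo_lookup: "Poly_Mapping.lookup (expo is) i = int (count (mset is) i)" for "is" i
    by (induction "is") (auto simp: expo_def lookup_add lookup_single when_def)
  \<comment> \<open>for an exponent vector with a negative entry, \<open>SOME\<close> picks an unspecified list\<close>
  define M where "M = (\<lambda>\<mu>. prod_list (map d (SOME is. expo is = \<mu>)))"
  have M: "M (expo is) = prod_list (map d is)" for "is"
  proof -
    have "expo (SOME js. expo js = expo is) = expo is" by (rule someI[of _ "is"]) simp
    then have "mset (SOME js. expo js = expo is) = mset is"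
      by (metis expo_lookup multiset_eqI of_nat_eq_iff)
    then show ?thesis unfolding M_def by (rule prod_list_mset_cong[OF comm])
  qed
  define \<tau> where "\<tau> = (\<lambda>l :: ('k, 'm, 'n) laurent. \<Sum>\<mu>\<in>Poly_Mapping.keys l. sc (Poly_Mapping.lookup l \<mu>) (M \<mu>))"
  have \<tau>_add: "\<tau> (l + l') = \<tau> l + \<tau> l'" for l l'
    unfolding \<tau>_def by (rule setsum_keys_plus_distrib) (simp_all add: scale_left_distrib)
  have \<tau>_single: "\<tau> (Poly_Mapping.single \<mu> c) = sc c (M \<mu>)" for \<mu> c
    by (simp add: \<tau>_def)
  have \<tau>_zero: "\<tau> 0 = 0"
    by (simp add: \<tau>_def)
  have scale_single: "laurent_scale c (Poly_Mapping.single \<mu> 1) = Poly_Mapping.single \<mu> c"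
    for c :: 'k and \<mu> :: "'m + 'n \<Rightarrow>\<^sub>0 int"
    by (simp add: laurent_scale_def map_times_single)
  have word_values: "(\<exists>is. \<phi> (loc_frac (sword (FMon xs)) 1) = Poly_Mapping.single (expo is) 1 \<and>
        t (loc_frac (sword (FMon xs)) 1) = prod_list (map d is)) \<or>
      (\<phi> (loc_frac (sword (FMon xs)) 1) = 0 \<and> t (loc_frac (sword (FMon xs)) 1) = 0)" for xs
  proof (induction xs)
    case Nil
    show ?case
      by (rule disjI1, rule exI[of _ "[]"])
        (simp add: P T expo_def flip: one_coordGL_def)
  next
    case (Cons x xs)
    obtain i j where x: "x = (i, j)" by (cases x)
    have e: "loc_frac (sword (FMon (x # xs))) 1 = coordGL_var i j * loc_frac (sword (FMon xs)) 1"
      by (simp add: coordGL_var_def loc_frac_mult sword_Cons x)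
    show ?case
    proof (cases "i = j")
      case True
      from Cons.IH show ?thesis
      proof (elim disjE exE conjE)
        fix js assume "\<phi> (loc_frac (sword (FMon xs)) 1) = Poly_Mapping.single (expo js) 1"
          "t (loc_frac (sword (FMon xs)) 1) = prod_list (map d js)"
        then show ?thesis unfolding e P T using True
          by (intro disjI1 exI[of _ "i # js"]) (simp add: \<phi>_var t_var laurent_var_def mult_single expo_def)
      qed (simp add: e P T)
    qed (simp add: e P T \<phi>_var t_var)
  qed
  have num: "\<tau> (\<phi> (loc_frac a 1)) = t (loc_frac a 1)" for a
  proof (induction a rule: sfree_span_induct)
    case (word c w)
    have "loc_frac (sconst c * sword w) 1 = coordGL_scale c (loc_frac (sword w) 1)"
      by (simp add: coordGL_scale_def loc_frac_mult)
    then show ?case using word_values[of "letters w"]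
      by (auto simp: P T scale_single \<tau>_single M module.scale_zero_right[OF module_laurent] \<tau>_zero)
  next
    case (add a b)
    have "loc_frac (a + b) 1 = loc_frac a 1 + (loc_frac b 1 :: ('k, 'm, 'n) coordGL)"
      by (simp add: loc_frac_add)
    with add show ?case by (simp add: P T \<tau>_add)
  qed
  obtain a r where f': "f = loc_frac a r" and r: "r \<in> loc_set" by (cases f rule: coordGL_cases)
  have a: "loc_frac a 1 = f * loc_frac r 1"
    unfolding f' loc_frac_mult[OF r loc_one] using r loc_central[OF r, of a] by (intro loc_frac_eqI) simp_all
  have "f = loc_frac a 1 * loc_frac 1 r"
    unfolding f' loc_frac_mult[OF loc_one r] by simp
  moreover have "t (loc_frac a 1) = 0"
    using num[of a] f by (simp add: a P \<tau>_def)
  ultimately show ?thesis by (simp add: T)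
qed

end


section \<open>Substitutions tangent to the identity\<close>

interpretation series: supercommutative_algebra "fps_scale sfree_scale" "fps_part spart"
  by (rule sfree.supercommutative_fps)

lemma superalgebra_hom_comp:
  assumes "superalgebra_hom scA partA scB partB f" "superalgebra_hom scB partB scC partC g"
  shows "superalgebra_hom scA partA scC partC (\<lambda>x. g (f x))"
  using assms unfolding superalgebra_hom_def even_linear_def module_hom_def module_hom_axioms_def by simp

lemma numerator_hom: "superalgebra_hom sfree_scale spart coordGL_scale coordGL_part (\<lambda>f. loc_frac f 1)"
  using module_sfree module_coordGL
  unfolding superalgebra_hom_def even_linear_def module_hom_def module_hom_axioms_def
  by (simp add: loc_frac_part loc_frac_mult loc_frac_add coordGL_scale_def sfree_scale_def one_coordGL_def)

text \<open>
  The lowest homogeneous component of \<open>x\<close> survives as a coefficient of \<open>E x\<close>.  The components of \<open>x\<close> are obtained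
  without a separate construction of the grading: the coefficient of \<open>z\<^sup>d\<close> in the image \<open>\<gamma> x\<close> of \<open>x\<close> under
  \<open>c \<mapsto> z c\<close> is the component of degree \<open>d\<close>.
\<close>

lemma tangent_identity_injective:
  fixes E :: "('k::field, 'm, 'n) sfree \<Rightarrow> ('k, 'm, 'n) sfree fps"
  assumes E: "superalgebra_hom sfree_scale spart (fps_scale sfree_scale) (fps_part spart) E"
    and E0: "\<And>x. E (svar x) $ 0 = 0" and E1: "\<And>x. E (svar x) $ 1 = svar x"
    and x: "E x = 0"
  shows "x = 0"
proof -
  note E = superalgebra_homD[OF E]
  define \<gamma> where "\<gamma> = series.sfree_eval (\<lambda>x :: ('m, 'n) gen. fps_const (svar x :: ('k, 'm, 'n) sfree) * fps_X)"
  have hom: "series.homogeneous_matrix (\<lambda>x :: ('m, 'n) gen. fps_const (svar x :: ('k, 'm, 'n) sfree) * fps_X)"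
    unfolding series.homogeneous_matrix_def by (auto intro!: fps_ext simp: fps_X_def)
  note \<gamma> = superalgebra_homD[OF series.sfree_eval_hom[OF hom], folded \<gamma>_def]
  have \<gamma>_word: "\<gamma> (sword (FMon xs)) = fps_const (sword (FMon xs)) * fps_X ^ length xs" for xs
  proof (induction xs)
    case (Cons y ys)
    have "\<gamma> (sword (FMon (y # ys))) =
        fps_const (svar y) * (fps_X * fps_const (sword (FMon ys))) * fps_X ^ length ys"
      by (simp add: sword_Cons \<gamma> Cons.IH mult.assoc) (simp add: \<gamma>_def series.sfree_eval_svar[OF hom] mult.assoc)
    then show ?case
      by (simp add: fps_mult_fps_X_commute sword_Cons mult.assoc flip: fps_const_mult)
  qed (simp add: \<gamma>)
  have \<gamma>_term: "\<gamma> (sconst c * sword w) $ e = (if e = length (letters w) then sconst c * sword w else 0)" for c w e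
  proof -
    have "\<gamma> (sword w) $ e = (if e = length (letters w) then sword w else 0)"
      using \<gamma>_word[of "letters w"] by simp
    then show ?thesis using \<gamma>(2)[of c "sword w"] by (simp add: sfree_scale_def)
  qed
  have E_word: "E (sword (FMon xs)) $ d = (if d = length xs then sword (FMon xs) else 0)" if "d \<le> length xs" for xs d
    using that
  proof (induction xs arbitrary: d)
    case (Cons y ys)
    define z where "z = fps_shift 1 (E (svar y))"
    have z: "E (svar y) = fps_X * z"
      by (rule fps_ext) (simp add: z_def E0)
    show ?case
    proof (cases d)
      case 0
      then show ?thesis by (simp add: sword_Cons E E0 fps_mult_nth)
    next
      case (Suc e)
      have "E (sword (FMon (y # ys))) $ d = (\<Sum>i=0..e. z $ i * E (sword (FMon ys)) $ (e - i))"
        by (simp add: sword_Cons E z mult.assoc Suc fps_mult_nth[of z])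
      also have "\<dots> = (\<Sum>i=0..e. if i = 0 then z $ 0 * E (sword (FMon ys)) $ e else 0)"
        using Cons.prems Suc by (intro sum.cong refl) (auto simp: Cons.IH)
      also have "\<dots> = svar y * E (sword (FMon ys)) $ e"
        using E1[of y] by (simp add: z_def)
      finally show ?thesis
        using Cons.prems Suc by (simp add: Cons.IH sword_Cons)
    qed
  qed (simp add: E)
  have lowest: "E (\<gamma> x $ e) $ d = (if d = e then \<gamma> x $ e else 0)" if "d \<le> e" for x d e
  proof (induction x rule: sfree_span_induct)
    case (word c w)
    have "E (sconst c * sword w) $ d = sconst c * E (sword w) $ d"
      using E(2)[of c "sword w"] by (simp add: sfree_scale_def)
    moreover have "E 0 $ d = 0" using E(1)[of 0 0] by simp
    ultimately show ?case
      using that E_word[of d "letters w"] by (auto simp: \<gamma>_term)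
  qed (simp add: \<gamma> E)
  have "\<exists>N. \<forall>M\<ge>N. x = (\<Sum>e<M. \<gamma> x $ e)"
  proof (induction x rule: sfree_span_induct)
    case (word c w)
    show ?case
      by (rule exI[of _ "Suc (length (letters w))"]) (simp add: \<gamma>_term)
  next
    case (add x y)
    then obtain N N' where "\<forall>M\<ge>N. x = (\<Sum>e<M. \<gamma> x $ e)" "\<forall>M\<ge>N'. y = (\<Sum>e<M. \<gamma> y $ e)" by blast
    then show ?case
      by (intro exI[of _ "max N N'"]) (simp add: \<gamma> sum.distrib)
  qed
  then obtain N where N: "\<And>M. M \<ge> N \<Longrightarrow> x = (\<Sum>e<M. \<gamma> x $ e)" by blast
  have "\<gamma> x $ d = 0" for d
  proof (induction d rule: less_induct)
    case (less d)
    define M where "M = max N (Suc d)"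
    have "0 = E (\<Sum>e<M. \<gamma> x $ e) $ d"
      using N[of M] x by (simp add: M_def)
    also have "\<dots> = (\<Sum>e<M. E (\<gamma> x $ e) $ d)"
      by (simp add: module_hom.sum[OF E(6)] fps_sum_nth)
    also have "\<dots> = (\<Sum>e<M. if e = d then \<gamma> x $ d else 0)"
    proof (intro sum.cong refl)
      fix e
      have "E 0 $ d = 0" using E(1)[of 0 0] by simp
      then show "E (\<gamma> x $ e) $ d = (if e = d then \<gamma> x $ d else 0)"
        using less[of e] lowest[of d e x] by (cases "e < d") auto
    qed
    also have "\<dots> = \<gamma> x $ d" by (simp add: M_def less_max_iff_disj)
    finally show ?case by simp
  qed
  then show "x = 0" using N[of N] by simp
qed

text \<open>
  The automorphism \<open>c\<^bsub>ij\<^esub> \<mapsto> c\<^bsub>ij\<^esub> - \<delta>\<^bsub>ij\<^esub> v\<^bsub>i\<^esub>\<close> of the free commutative superalgebra removes the constant term.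
  It does not extend to the coordinate superalgebra, hence the reduction to a numerator beforehand.
\<close>

lemma shifted_tangent_identity_injective:
  fixes H :: "('k::field, 'm::{finite, linorder}, 'n::{finite, linorder}) coordGL \<Rightarrow> ('k, 'm, 'n) sfree fps"
  assumes H: "series.point H"
    and H0: "\<And>i j. H (coordGL_var i j) $ 0 = (if i = j then sconst (v i) else 0)"
    and H1: "\<And>i j. H (coordGL_var i j) $ 1 = svar (i, j)"
    and f: "H f = 0"
  shows "f = 0"
proof -
  define b where "b = (\<lambda>u (x :: ('m, 'n) gen). svar x + (if fst x = snd x then sconst (u (fst x)) else 0) :: ('k, 'm, 'n) sfree)"
  have b: "sfree.homogeneous_matrix (b u)" for u
    unfolding sfree.homogeneous_matrix_def b_def by (simp add: spart_add gpar_diag)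
  have b_apply: "b u x = svar x + (if fst x = snd x then sconst (u (fst x)) else 0)" for u x
    by (simp add: b_def)
  note b_hom = sfree.sfree_eval_hom[OF b] and b_var = sfree.sfree_eval_svar[OF b]
  have const: "sfree.sfree_eval (b u) (sconst k) = sconst k" for u k
    using superalgebra_hom_scale[OF b_hom, of u k 1] superalgebra_hom_one[OF b_hom, of u]
    by (simp add: sfree_scale_def)
  have zero: "sfree.sfree_eval (b u) 0 = 0" for u
    using const[of u 0] by simp
  have shift_unshift: "sfree.sfree_eval (b (\<lambda>i. - v i)) (sfree.sfree_eval (b v) a) = a" for a
  proof (rule sfree.sfree_hom_eqI[OF superalgebra_hom_comp[OF b_hom b_hom]])
    show "superalgebra_hom sfree_scale spart sfree_scale spart (\<lambda>a. a :: ('k, 'm, 'n) sfree)"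
      using module_sfree unfolding superalgebra_hom_def even_linear_def module_hom_def module_hom_axioms_def by simp
    fix x :: "('m, 'n) gen"
    have "sfree.sfree_eval (b (\<lambda>i. - v i)) (sfree.sfree_eval (b v) (svar x)) =
        b (\<lambda>i. - v i) x + sfree.sfree_eval (b (\<lambda>i. - v i)) (if fst x = snd x then sconst (v (fst x)) else 0)"
      by (simp only: b_var b_apply[of v x] superalgebra_hom_add[OF b_hom])
    then show "sfree.sfree_eval (b (\<lambda>i. - v i)) (sfree.sfree_eval (b v) (svar x)) = svar x"
      by (simp add: b_apply const zero add.assoc flip: sconst_add)
  qed
  obtain a r where f': "f = loc_frac a r" and r: "r \<in> loc_set" by (cases f rule: coordGL_cases)
  have "loc_frac a 1 = f * loc_frac r 1"
    unfolding f' loc_frac_mult[OF r loc_one] using r loc_central[OF r, of a] by (intro loc_frac_eqI) simp_all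
  then have Ha: "H (loc_frac a 1) = 0"
    using f by (simp add: superalgebra_hom_mult[OF H])
  have "sfree.sfree_eval (b v) a = 0"
  proof (rule tangent_identity_injective[OF superalgebra_hom_comp[OF superalgebra_hom_comp[OF b_hom numerator_hom] H]])
    fix x :: "('m, 'n) gen"
    obtain i j where x: "x = (i, j)" by (cases x)
    have "loc_frac (b (\<lambda>i. - v i) x) 1 = coordGL_var i j + coordGL_scale (if i = j then - v i else 0) 1"
      by (simp add: b_def x coordGL_var_def coordGL_scale_def one_coordGL_def loc_frac_mult loc_frac_add_same)
    then have *: "H (loc_frac (sfree.sfree_eval (b (\<lambda>i. - v i)) (svar x)) 1) =
        H (coordGL_var i j) + fps_scale sfree_scale (if i = j then - v i else 0) 1"
      by (simp add: b_var superalgebra_homD[OF H])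
    show "H (loc_frac (sfree.sfree_eval (b (\<lambda>i. - v i)) (svar x)) 1) $ 0 = 0"
      unfolding * by (auto simp: H0 sfree_scale_def simp flip: sconst_add)
    show "H (loc_frac (sfree.sfree_eval (b (\<lambda>i. - v i)) (svar x)) 1) $ 1 = svar x"
      unfolding * using H1[of i j] by (simp add: sfree_scale_def x)
  qed (simp add: shift_unshift Ha)
  then have "a = 0"
    using shift_unshift[of a] by (simp add: zero)
  then show ?thesis using r by (simp add: f' loc_frac_zero)
qed


section \<open>A generic conjugate of a diagonal matrix\<close>

text \<open>
  Over a finite field, 1 plus the product of all monic linear polynomials has no root.
\<close>

lemma alg_closed_infinite: "infinite (UNIV :: 'k::alg_closed_field set)"
proof
  assume fin: "finite (UNIV :: 'k set)"
  define p :: "'k poly" where "p = (\<Prod>a\<in>UNIV. [:- a, 1:])"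
  have "degree p = card (UNIV :: 'k set)"
    unfolding p_def by (subst degree_prod_eq_sum_degree) auto
  moreover have "card (UNIV :: 'k set) > 0"
    using fin by (simp add: card_gt_0_iff)
  ultimately have "degree (p + 1) > 0"
    by (simp add: degree_add_eq_left)
  then obtain r where "poly (p + 1) r = 0"
    using alg_closed_imp_poly_has_root by blast
  moreover have "poly p r = 0"
    unfolding p_def poly_prod using fin by (intro prod_zero) auto
  ultimately show False by simp
qed

lemma distinct_nonzero_scalars:
  obtains v :: "'x::finite \<Rightarrow> 'k::alg_closed_field" where "inj v" "\<And>i. v i \<noteq> 0"
proof -
  have "infinite (UNIV - {0 :: 'k})" using alg_closed_infinite by simp
  then obtain B :: "'k set" where B: "finite B" "card B = card (UNIV :: 'x set)" "B \<subseteq> UNIV - {0}"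
    using infinite_arbitrarily_large by metis
  then obtain v :: "'x \<Rightarrow> 'k" where v: "bij_betw v UNIV B"
    using finite_same_card_bij[of "UNIV :: 'x set" B] by auto
  show ?thesis
  proof (rule that)
    show "inj v" using v by (rule bij_betw_imp_inj_on)
    show "v i \<noteq> 0" for i using bij_betwE[OF v] B(3) by auto
  qed
qed

text \<open>
  A power series with invertible constant coefficient is invertible, and here the constant coefficient is the
  determinant of a diagonal scalar matrix.
\<close>

lemma series_block_det_unit:
  fixes b :: "('m, 'n) gen \<Rightarrow> ('k::field, 'm, 'n) sfree fps" and \<iota> :: "'r::{finite, linorder} \<Rightarrow> 'm + 'n"
  assumes b: "series.homogeneous_matrix b" and \<iota>: "inj \<iota>"
    and b0: "\<And>i j. b (i, j) $ 0 = (if i = j then sconst (u i) else 0)" and u: "\<And>i. u i \<noteq> 0"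
  obtains d where "d * series.sfree_eval b (block_det \<iota>) = 1"
proof -
  note hom = superalgebra_homD[OF series.sfree_eval_hom[OF b]]
  define E where "E = (\<lambda>x. series.sfree_eval b x $ 0)"
  have add: "E (x + y) = E x + E y" and mult: "E (x * y) = E x * E y" and one: "E 1 = 1" for x y
    by (simp_all add: E_def hom fps_mult_nth)
  have zero: "E 0 = 0" using add[of 0 0] by simp
  have sum: "E (sum h A) = (\<Sum>i\<in>A. E (h i))" for h and A :: "('r \<Rightarrow> 'r) set"
    by (induction A rule: infinite_finite_induct) (auto simp: zero add)
  have plist: "E (prod_list xs) = prod_list (map E xs)" for xs
    by (induction xs) (auto simp: one mult)
  have var: "E (svar (i, j)) = (if i = j then sconst (u i) else 0)" for i j
    by (simp add: E_def series.sfree_eval_svar[OF b] b0)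
  define rows where "rows = sorted_list_of_set (UNIV :: 'r set)"
  define c where "c = prod_list (map (\<lambda>i. u (\<iota> i)) rows)"
  have c: "prod_list (map (\<lambda>i. sconst (u (\<iota> i))) is) = sconst (prod_list (map (\<lambda>i. u (\<iota> i)) is))" for "is"
    by (induction "is") (simp_all add: sconst_mult)
  have "E (block_det \<iota>) = (\<Sum>p | p permutes (UNIV::'r set). if p = id then sconst c else 0)"
    unfolding block_det_def sum
  proof (rule sum.cong[OF refl], goal_cases)
    case (1 p)
    show ?case
    proof (cases "p = id")
      case True
      then show ?thesis
        by (simp add: mult plist o_def var c c_def rows_def one)
    next
      case False
      then obtain i where "p i \<noteq> i" by (auto simp: fun_eq_iff)
      then have "\<iota> i \<noteq> \<iota> (p i)" using \<iota> by (auto dest: injD)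
      then have "0 \<in> set (map (\<lambda>i. E (svar (\<iota> i, \<iota> (p i)))) rows)"
        by (force simp: rows_def var)
      moreover have "0 \<in> set xs \<Longrightarrow> prod_list xs = 0" for xs :: "('k, 'm, 'n) sfree list"
        by (induction xs) auto
      ultimately show ?thesis using False by (simp add: mult plist o_def rows_def)
    qed
  qed
  also have "\<dots> = sconst c"
    by (subst sum.delta) (auto simp: finite_permutations permutes_id)
  finally have E: "series.sfree_eval b (block_det \<iota>) $ 0 = sconst c" by (simp add: E_def)
  have "c \<noteq> 0" unfolding c_def by (auto simp: prod_list_zero_iff u)
  then have "sconst (inverse c) * series.sfree_eval b (block_det \<iota>) $ 0 = 1"
    unfolding E by (simp flip: sconst_mult)
  from fps_left_inverse[OF this] show ?thesis by (rule that)
qed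

lemma series_point_exists:
  fixes b :: "('m::{finite, linorder}, 'n::{finite, linorder}) gen \<Rightarrow> ('k::field, 'm, 'n) sfree fps"
  assumes b: "series.homogeneous_matrix b"
    and b0: "\<And>i j. b (i, j) $ 0 = (if i = j then sconst (u i) else 0)" and u: "\<And>i. u i \<noteq> 0"
  obtains F where "series.point F" "\<And>i j. F (coordGL_var i j) = b (i, j)"
proof -
  obtain d1 where d1: "d1 * series.sfree_eval b (block_det Inl) = 1"
    by (rule series_block_det_unit[OF b inj_Inl b0 u])
  obtain d2 where d2: "d2 * series.sfree_eval b (block_det Inr) = 1"
    by (rule series_block_det_unit[OF b inj_Inr b0 u])
  show ?thesis
    by (rule series.point_exists[OF b d1 d2]) (rule that)
qed

text \<open>
  The solution \<open>X\<close>, with zero diagonal, of \<open>V X - X V = C\<close> off the diagonal, for \<open>V = diag(v\<^bsub>i\<^esub>)\<close>.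
\<close>

definition commutator_matrix :: "('m + 'n \<Rightarrow> 'k) \<Rightarrow> ('m, 'n) gen \<Rightarrow> ('k::field, 'm, 'n) sfree" where
  "commutator_matrix v x = (if fst x = snd x then 0 else sconst (1 / (v (fst x) - v (snd x))) * svar x)"

text \<open>
  The entries of the matrix power \<open>(- X)\<^sup>k\<close>, the coefficients of the geometric series for \<open>(1 + z X)\<inverse>\<close>.
\<close>

primrec neg_power ::
  "(('m::finite, 'n::finite) gen \<Rightarrow> ('k::field, 'm, 'n) sfree) \<Rightarrow> nat \<Rightarrow> ('m, 'n) gen \<Rightarrow> ('k, 'm, 'n) sfree" where
  "neg_power X 0 = (\<lambda>x. if fst x = snd x then 1 else 0)"
| "neg_power X (Suc k) = (\<lambda>x. - (\<Sum>t\<in>UNIV. X (fst x, t) * neg_power X k (t, snd x)))"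

lemma neg_power_homogeneous:
  assumes X: "\<And>x. spart (gpar x) (X x) = X x"
  shows "spart (gpar x) (neg_power X k x) = neg_power X k x"
proof (induction k arbitrary: x)
  case (Suc k)
  have "spart (gpar x) (X (fst x, t) * neg_power X k (t, snd x)) = X (fst x, t) * neg_power X k (t, snd x)" for t
  proof -
    have "gpar (fst x, t) + gpar (t, snd x) = gpar x"
      by (simp only: gpar_def fst_conv snd_conv add.assoc bit_add_self2)
    then show ?thesis
      using sfree.part_mult[OF X Suc.IH, of "(fst x, t)" "(t, snd x)"] by simp
  qed
  then show ?case by (simp add: sfree.part_minus sfree.part_setsum)
qed (simp add: gpar_diag)

definition unipotent :: "(('m, 'n) gen \<Rightarrow> ('k::field, 'm, 'n) sfree) \<Rightarrow> ('m, 'n) gen \<Rightarrow> ('k, 'm, 'n) sfree fps" where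
  "unipotent X x = fps_const (if fst x = snd x then 1 else 0) + fps_const (X x) * fps_X"

definition unipotent_inverse ::
  "(('m::finite, 'n::finite) gen \<Rightarrow> ('k::field, 'm, 'n) sfree) \<Rightarrow> ('m, 'n) gen \<Rightarrow> ('k, 'm, 'n) sfree fps" where
  "unipotent_inverse X x = Abs_fps (\<lambda>k. neg_power X k x)"

lemma unipotent_right_inverse:
  "(\<Sum>t\<in>UNIV. unipotent X (i, t) * unipotent_inverse X (t, j)) = (if i = j then 1 else 0)"
proof (rule fps_ext)
  fix k
  have *: "unipotent X (i, t) * f = fps_const (if i = t then 1 else 0) * f + fps_const (X (i, t)) * (fps_X * f)" for t f
    by (simp add: unipotent_def distrib_right mult.assoc)
  have if_mult: "(if i = t then 1 else 0) * y = (if t = i then y else 0)" for t and y :: "('a, 'b, 'c) sfree"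
    by simp
  show "(\<Sum>t\<in>UNIV. unipotent X (i, t) * unipotent_inverse X (t, j)) $ k = (if i = j then 1 else 0) $ k"
    by (cases k) (simp_all add: * fps_sum_nth unipotent_inverse_def sum.distrib if_mult sum_negf)
qed

definition diagonal_matrix :: "('m + 'n \<Rightarrow> 'k) \<Rightarrow> ('m + 'n) \<Rightarrow> ('k::field, 'm, 'n) sfree fps" where
  "diagonal_matrix v i = fps_const (sconst (v i)) + fps_const (svar (i, i)) * fps_X"

theorem theorem5p2:
  fixes \<delta> :: "('k::alg_closed_field, 'm::{finite, linorder}, 'n::{finite, linorder}) coordGL \<Rightarrow>
                 ('k, 'm, 'n) coordGL2"
    and s :: "('k, 'm, 'n) coordGL \<Rightarrow> ('k, 'm, 'n) coordGL"
    and \<phi> :: "('k, 'm, 'n) coordGL \<Rightarrow> ('k, 'm, 'n) laurent"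
  assumes comult: "is_comultiplication \<delta>"
    and antipode: "is_antipode \<delta> s"
    and phi_hom: "superalgebra_hom coordGL_scale coordGL_part laurent_scale purely_even \<phi>"
    and phi_surj: "surj \<phi>"
    and phi_var: "\<And>i j. \<phi> (coordGL_var i j) = (if i = j then laurent_var i else 0)"
  shows "inj_on \<phi> (coadjoint_invariants \<delta> s)"
proof -
  obtain v :: "'m + 'n \<Rightarrow> 'k" where inj: "inj v" and nz: "\<And>i. v i \<noteq> 0"
    by (rule distinct_nonzero_scalars) blast
  define X where "X = (commutator_matrix v :: _ \<Rightarrow> ('k, 'm, 'n) sfree)"
  have X: "spart (gpar x) (X x) = X x" for x
    by (simp add: X_def commutator_matrix_def spart_const_mult)
  have X_diag: "X (i, i) = 0" for i
    by (simp add: X_def commutator_matrix_def)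
  have "series.homogeneous_matrix (unipotent X)"
    unfolding series.homogeneous_matrix_def
    by (auto intro!: fps_ext simp: unipotent_def fps_X_def X X_diag spart_add gpar_diag)
  then obtain g where g: "series.point g" and g_var: "\<And>i j. g (coordGL_var i j) = unipotent X (i, j)"
    by (rule series_point_exists[where u = "\<lambda>_. 1"]) (auto simp: unipotent_def)
  have "series.homogeneous_matrix (unipotent_inverse X)"
    unfolding series.homogeneous_matrix_def
    by (auto intro!: fps_ext simp: unipotent_inverse_def neg_power_homogeneous[OF X])
  then obtain g' where g': "series.point g'" and g'_var: "\<And>i j. g' (coordGL_var i j) = unipotent_inverse X (i, j)"
    by (rule series_point_exists[where u = "\<lambda>_. 1"]) (auto simp: unipotent_inverse_def)
  let ?D = "\<lambda>x. if fst x = snd x then diagonal_matrix v (fst x) else 0"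
  have "series.homogeneous_matrix ?D"
    unfolding series.homogeneous_matrix_def
    by (auto intro!: fps_ext simp: diagonal_matrix_def fps_X_def spart_add gpar_diag)
  then obtain t where t: "series.point t" and t_var: "\<And>i j. t (coordGL_var i j) = (if i = j then diagonal_matrix v i else 0)"
    by (rule series_point_exists[where u = v]) (auto simp: diagonal_matrix_def nz)
  note gl = superalgebra_hom_linear[OF g] and gl' = superalgebra_hom_linear[OF g'] and tl = superalgebra_hom_linear[OF t]
  define H where "H = series.conv \<delta> (series.conv \<delta> g' t) g"
  have H: "series.point H"
    unfolding H_def by (intro series.conv_point[OF comult] g g' t)
  have "series.conv \<delta> g' t (coordGL_var i u) = unipotent_inverse X (i, u) * diagonal_matrix v u" for i u
    by (simp add: series.conv_var[OF comult gl' tl] g'_var t_var if_distrib[of "\<lambda>z. _ * z"] cong: if_cong)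
  then have H_var: "H (coordGL_var i j) = (\<Sum>u\<in>UNIV. unipotent_inverse X (i, u) * diagonal_matrix v u * unipotent X (u, j))" for i j
    by (simp add: H_def series.conv_var[OF comult series.conv_lin[OF comult gl' tl] gl] g_var)
  have nth1: "(a * b) $ 1 = a $ 0 * b $ 1 + a $ 1 * b $ 0" for a b :: "('k, 'm, 'n) sfree fps"
    by (simp add: fps_mult_nth)
  have delta: "(if i = u then 1 else 0) * y = (if u = i then y else 0)" "y * (if u = j then 1 else 0) = (if u = j then y else 0)"
    "(if u = i then z else 0) * y = (if u = i then z * y else 0)"
    for i u j :: "'m + 'n" and y z :: "('k, 'm, 'n) sfree" by simp_all
  have inv0: "unipotent_inverse X (i, u) $ 0 = (if i = u then 1 else 0)"
    and inv1: "unipotent_inverse X (i, u) $ 1 = - X (i, u)" for i u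
    by (simp_all add: unipotent_inverse_def delta if_distrib[of "\<lambda>z. _ * z"] cong: if_cong)
  have uni0: "unipotent X (i, u) $ 0 = (if i = u then 1 else 0)"
    and uni1: "unipotent X (i, u) $ 1 = X (i, u)" for i u
    by (simp_all add: unipotent_def)
  have diag0: "diagonal_matrix v u $ 0 = sconst (v u)" and diag1: "diagonal_matrix v u $ 1 = svar (u, u)" for u
    by (simp_all add: diagonal_matrix_def)
  \<comment> \<open>\<open>g' t g = (1 - z X) (V + z diag(c\<^bsub>ii\<^esub>)) (1 + z X)\<close> modulo \<open>z\<^sup>2\<close>\<close>
  have H0: "H (coordGL_var i j) $ 0 = (if i = j then sconst (v i) else 0)" for i j
    by (simp add: H_var fps_sum_nth inv0 uni0 diag0 delta if_distrib[of "\<lambda>z. z * _"] cong: if_cong)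
  have H1: "H (coordGL_var i j) $ 1 = svar (i, j)" for i j
  proof -
    have "H (coordGL_var i j) $ 1 =
        sconst (v i) * X (i, j) + (if i = j then svar (i, i) else 0) - X (i, j) * sconst (v j)"
      unfolding H_var fps_sum_nth nth1 fps_mult_nth_0 inv0 inv1 uni0 uni1 diag0 diag1
      by (simp add: distrib_right distrib_left sum.distrib delta mult.assoc sum_negf if_distrib[of "\<lambda>z. _ * z"] cong: if_cong)
    also have "\<dots> = svar (i, j)"
    proof (cases "i = j")
      case True
      then show ?thesis by (simp add: X_def commutator_matrix_def)
    next
      case False
      then have "v i - v j \<noteq> 0" using inj by (auto dest: injD)
      have "sconst (v i) = sconst (v i - v j) + (sconst (v j) :: ('k, 'm, 'n) sfree)"
        by (simp flip: sconst_add)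
      then have "sconst (v i) * X (i, j) - X (i, j) * sconst (v j) = sconst (v i - v j) * X (i, j)"
        by (simp add: distrib_right sconst_central[of "v j" "X (i, j)"])
      also have "\<dots> = sconst ((v i - v j) * (1 / (v i - v j))) * svar (i, j)"
        by (simp only: X_def commutator_matrix_def fst_conv snd_conv False if_False sconst_mult mult.assoc)
      also have "\<dots> = svar (i, j)" using \<open>v i - v j \<noteq> 0\<close> by simp
      finally show ?thesis using False by simp
    qed
    finally show ?thesis .
  qed
  show ?thesis
  proof (rule inj_onI)
    fix x y assume xy: "x \<in> coadjoint_invariants \<delta> s" "y \<in> coadjoint_invariants \<delta> s" "\<phi> x = \<phi> y"
    have inv: "H f = t f" if "f \<in> coadjoint_invariants \<delta> s" for f
      unfolding H_def
      by (rule series.invariant_conjugation[OF comult antipode g g' _ t that])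
        (simp add: g_var g'_var unipotent_right_inverse)
    have "\<phi> (x - y) = 0"
      using xy(3) by (simp add: module_hom.diff[OF superalgebra_hom_linear[OF phi_hom]])
    then have "t (x - y) = 0"
      by (rule series.diagonal_point_factors[OF phi_hom phi_var t t_var])
    then have "H (x - y) = 0"
      by (simp add: module_hom.diff[OF superalgebra_hom_linear[OF H]] module_hom.diff[OF tl] inv xy)
    then have "x - y = 0"
      by (rule shifted_tangent_identity_injective[OF H H0 H1])
    then show "x = y" by simp
  qed
qed

end
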